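(* For every integer $n>1$ let $M_n$ be the set of cells of a honeycomb lattice of step $1/n$ contained in a regular hexagon $P$ of side $1$ centered at the center of a lattice cell $O$. Color the cells of $M_n$ in the colors $0,1,2,3$ uniformly at random (all $4^{|M_n|}$ colorings being equally likely), and for $k=1,2,3$ let $B_{k,n}$ be the event that fluid $k$ percolates between sides $k$ and $k+3$ of $P$. Then $$\lim_{n\to+\infty}\bigl[P(B_{1,n}\cap B_{2,n}\cap B_{3,n})-P(B_{1,n})\,P(B_{2,n})\,P(B_{3,n})\bigr]=0.$$
   Context: Honeycomb lattice of step $1/n$: the tiling of the plane by regular hexagons (cells) of side $1/n$; two cells are adjacent if they share a side. $P$ is a regular hexagon with side $1$ whose center is the center of some lattice cell $O$ (no orientation of $P$ relative to the lattice is prescribed). $M_n$ is the set of all cells contained in $P$. A boundary cell of $M_n$ is a cell of $M_n$ adjacent to a cell not in $M_n$. The sides of $P$ are labeled $1,\dots,6$ counterclockwise. A cell $x\in M_n$ belongs to a side $A$ of $P$ if $x$ is a boundary cell of $M_n$ and $A$ is a nearest side of $P$ to $x$ (distance measured from the center of $x$; in case of ties $x$ belongs to each of its nearest sides). "Side $A$" also denotes the set of all cells belonging to the side $A$. Probability space: $\Omega$ is the set of all colorings of $M_n$ in 4 colors $0,1,2,3$, with $P(B)=|B|/4^{|M_n|}$ for $B\subset\Omega$ (the letter $P$ is used both for the hexagon and for the probability measure). For $k\in\{1,2,3\}$ and a coloring in $\Omega$, fluid $k$ percolates between two sets $A,B\subset M_n$ if some cell of $A$ is joined with some cell of $B$ by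 a chain of successively adjacent cells of $M_n$ such that every cell of the chain, including the initial cell in $A$ and the final cell in $B$, has color $0$ or $k$. *)

theory Defs
  imports "HOL-Probability.Probability"
begin

text \<open>
  The plane is \<^typ>\<open>complex\<close>. A regular hexagon is given by its centre \<open>c\<close>, its side length \<open>r\<close>
  (which is also its circumradius) and the direction \<open>\<theta>\<close> of one of its vertices.
  As \<open>j\<close> increases, vertices and sides are passed counterclockwise; both have period 6 in \<open>j\<close>.
\<close>

definition hex_vertex :: "complex \<Rightarrow> real \<Rightarrow> real \<Rightarrow> nat \<Rightarrow> complex" where
  "hex_vertex c r \<theta> j = c + of_real r * cis (\<theta> + real j * pi / 3)"

definition hex_side :: "complex \<Rightarrow> real \<Rightarrow> real \<Rightarrow> nat \<Rightarrow> complex set" where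
  "hex_side c r \<theta> j = closed_segment (hex_vertex c r \<theta> j) (hex_vertex c r \<theta> (Suc j))"

definition hexagon :: "complex \<Rightarrow> real \<Rightarrow> real \<Rightarrow> complex set" where
  "hexagon c r \<theta> = convex hull (hex_vertex c r \<theta> ` {1..6})"

text \<open>
  The honeycomb lattice of step \<open>r\<close> in which one cell is \<open>hexagon c r \<theta>\<close>. All cells of a lattice are
  translates of each other, so a cell is represented by its centre \<open>x\<close>; the cell itself is
  \<open>hexagon x r \<theta>\<close>. The centres of neighbouring cells are at distance \<open>sqrt 3 * r\<close> (twice the
  apothem), in the directions \<open>\<theta> + pi/6 + j * pi/3\<close> of the midpoints of the sides; two of these
  directions at angle \<open>pi/3\<close> generate all centres.
\<close>

definition honeycomb :: "complex \<Rightarrow> real \<Rightarrow> real \<Rightarrow> complex set" where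
  "honeycomb c r \<theta> =
     {c + of_real (sqrt 3 * r) * (of_int a * cis (\<theta> + pi / 6) + of_int b * cis (\<theta> + pi / 2))
       | a b :: int. True}"

definition cell_adj :: "real \<Rightarrow> real \<Rightarrow> complex \<Rightarrow> complex \<Rightarrow> bool" where
  "cell_adj r \<theta> x y \<longleftrightarrow>
     x \<noteq> y \<and> (\<exists>i\<in>{1..6}. \<exists>j\<in>{1..6}. hex_side x r \<theta> i = hex_side y r \<theta> j)"

text \<open>
  From here on \<open>P\<close> is \<open>hexagon c 1 \<alpha>\<close> and the lattice is \<open>honeycomb c (1 / real n) \<theta>\<close>, so that \<open>P\<close> and
  the cell \<open>O\<close> have the same centre \<open>c\<close>, while the directions \<open>\<alpha>\<close> and \<open>\<theta>\<close> are unrelated.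
\<close>

definition cells_in :: "complex \<Rightarrow> real \<Rightarrow> real \<Rightarrow> nat \<Rightarrow> complex set" where
  "cells_in c \<alpha> \<theta> n =
     {x \<in> honeycomb c (1 / real n) \<theta>. hexagon x (1 / real n) \<theta> \<subseteq> hexagon c 1 \<alpha>}"

definition boundary_cells :: "complex \<Rightarrow> real \<Rightarrow> real \<Rightarrow> nat \<Rightarrow> complex set" where
  "boundary_cells c \<alpha> \<theta> n =
     {x \<in> cells_in c \<alpha> \<theta> n.
        \<exists>y \<in> honeycomb c (1 / real n) \<theta> - cells_in c \<alpha> \<theta> n. cell_adj (1 / real n) \<theta> x y}"

definition side_cells :: "complex \<Rightarrow> real \<Rightarrow> real \<Rightarrow> nat \<Rightarrow> nat \<Rightarrow> complex set" where
  "side_cells c \<alpha> \<theta> n A =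
     {x \<in> boundary_cells c \<alpha> \<theta> n.
        \<forall>B\<in>{1..6}. infdist x (hex_side c 1 \<alpha> A) \<le> infdist x (hex_side c 1 \<alpha> B)}"

text \<open>
  Colourings are extensional functions, so that they are determined by their values on \<open>M\<close>.
\<close>

definition colorings :: "complex set \<Rightarrow> (complex \<Rightarrow> nat) set" where
  "colorings M = M \<rightarrow>\<^sub>E {0, 1, 2, 3}"

definition coloring_space :: "complex set \<Rightarrow> (complex \<Rightarrow> nat) measure" where
  "coloring_space M = uniform_count_measure (colorings M)"

lemma measure_coloring_space:
  assumes "finite M" and "B \<subseteq> colorings M"
  shows "measure (coloring_space M) B = real (card B) / 4 ^ card M"
proof -
  have "card {0, 1, 2, 3 :: nat} = 4"
    by simp
  then have "finite (colorings M)" and "card (colorings M) = 4 ^ card M"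
    using assms(1) by (simp_all only: colorings_def card_PiE finite_PiE prod_constant finite.intros)
  then show ?thesis
    using assms(2) by (simp add: coloring_space_def measure_uniform_count_measure)
qed

definition percolates ::
  "complex set \<Rightarrow> (complex \<Rightarrow> complex \<Rightarrow> bool) \<Rightarrow> (complex \<Rightarrow> nat) \<Rightarrow> nat \<Rightarrow>
   complex set \<Rightarrow> complex set \<Rightarrow> bool" where
  "percolates M adj \<omega> k A B \<longleftrightarrow>
     (\<exists>xs. xs \<noteq> [] \<and> hd xs \<in> A \<and> last xs \<in> B \<and> set xs \<subseteq> M \<and> successively adj xs \<and>
        (\<forall>x\<in>set xs. \<omega> x \<in> {0, k}))"

definition perc_event :: "complex \<Rightarrow> real \<Rightarrow> real \<Rightarrow> nat \<Rightarrow> nat \<Rightarrow> (complex \<Rightarrow> nat) set" where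
  "perc_event c \<alpha> \<theta> n k =
     {\<omega> \<in> colorings (cells_in c \<alpha> \<theta> n).
        percolates (cells_in c \<alpha> \<theta> n) (cell_adj (1 / real n) \<theta>) \<omega> k
          (side_cells c \<alpha> \<theta> n k) (side_cells c \<alpha> \<theta> n (k + 3))}"

definition coloring_prob :: "complex \<Rightarrow> real \<Rightarrow> real \<Rightarrow> nat \<Rightarrow> (complex \<Rightarrow> nat) set \<Rightarrow> real" where
  "coloring_prob c \<alpha> \<theta> n B = measure (coloring_space (cells_in c \<alpha> \<theta> n)) B"

end

theory Submission
  imports Defs
begin

text \<open>
  Encode the colours by bits: let \<open>a\<close> be the set of cells of colour \<open>0\<close> or \<open>1\<close> and \<open>b\<close> the set of cells of
  colour \<open>0\<close> or \<open>2\<close>. For a uniform colouring, \<open>a\<close> and \<open>b\<close> are independent uniformly random subsets of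
  \<open>M\<^sub>n\<close>, and the set of cells of colour \<open>0\<close> or \<open>3\<close> is the complement of the symmetric difference of \<open>a\<close>
  and \<open>b\<close>. Each fluid therefore sees critical site percolation (density \<open>1/2\<close>), any two fluids are
  independent, and only the dependence between all three has to be controlled.

  Fourier expansion on the cube turns the difference of probabilities into a sum of \<open>\<plusminus>\<close> products of the
  three Fourier coefficients over the nonempty sets \<open>S\<close> of cells. By Parseval's identity this is at
  most the largest coefficient of one crossing event with \<open>S \<noteq> {}\<close> (\<open>triple_correlation_bound\<close>), and
  such a coefficient is at most the probability that a given cell of \<open>S\<close> is pivotal
  (\<open>fourier_le_influence\<close>). A pivotal cell lies on a chain between two opposite sides of \<open>P\<close>, whose cells
  are at distance at least \<open>1\<close> for large \<open>n\<close>; hence from a pivotal cell there starts a path, in the fluid, to distance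
  of order \<open>n\<close> in lattice steps (\<open>pivotal_crossed\<close>). Both the position of the cell and the orientation of
  \<open>P\<close> disappear at this point: the probability is at most the one-arm probability of critical site
  percolation on the whole triangular lattice.

  That the one-arm probability tends to zero (\<open>one_arm_vanishes\<close>) is Harris's theorem that there is no
  percolation at density \<open>1/2\<close>. The proof combines Zhang's argument with a Burton--Keane count and stays
  within finite boxes. The probability of crossing an annulus is submultiplicative, so either the one-arm
  probability tends to zero or some ball is joined to every larger sphere with probability close to \<open>1\<close>.
  In the second case the square-root trick, an instance of Harris's correlation inequality, joins the
  ball to each single side of a larger hexagon with probability close to \<open>1\<close>. Open and closed cells
  play symmetric roles, so with probability at least \<open>1/2\<close> there are open paths to sides 0, 2, 4 and closed
  paths to sides 1, 3, 5. By planarity the closed paths keep the open ones apart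
  (\<open>six_arms_separate\<close>); if moreover the ball is open, it is a trifurcation: removing it splits an open
  cluster into three parts that all reach the sphere. So trifurcations have positive density in a hexagon
  of size \<open>L\<close>, of order \<open>L\<^sup>2\<close> of them; but there can be no more of them than cells on the sphere, which are
  of order \<open>L\<close> (\<open>trifurcation_card_le\<close>). Planarity enters only through the statement that a left-right
  path and a bottom-top path have a common cell (\<open>crossing_paths_meet\<close>).
\<close>

section \<open>Uniformly random subsets of a finite set\<close>

definition avg :: "'a set \<Rightarrow> ('a set \<Rightarrow> real) \<Rightarrow> real" where
  "avg V f = (\<Sum>\<omega>\<in>Pow V. f \<omega>) / 2 ^ card V"

definition pr :: "'a set \<Rightarrow> ('a set \<Rightarrow> bool) \<Rightarrow> real" where
  "pr V A = avg V (\<lambda>\<omega>. of_bool (A \<omega>))"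

lemma avg_const: "finite V \<Longrightarrow> avg V (\<lambda>_. k) = k"
  by (simp add: avg_def card_Pow)

lemma avg_cong: "(\<And>\<omega>. \<omega> \<subseteq> V \<Longrightarrow> f \<omega> = g \<omega>) \<Longrightarrow> avg V f = avg V g"
  unfolding avg_def by (rule arg_cong[of _ _ "\<lambda>s. s / 2 ^ card V"], rule sum.cong) auto

lemma avg_mono: "(\<And>\<omega>. \<omega> \<subseteq> V \<Longrightarrow> f \<omega> \<le> g \<omega>) \<Longrightarrow> avg V f \<le> avg V g"
  unfolding avg_def by (intro divide_right_mono sum_mono) auto

lemma avg_add: "avg V (\<lambda>\<omega>. f \<omega> + g \<omega>) = avg V f + avg V g"
  by (simp add: avg_def sum.distrib add_divide_distrib)

lemma avg_diff: "avg V (\<lambda>\<omega>. f \<omega> - g \<omega>) = avg V f - avg V g"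
  by (simp add: avg_def sum_subtractf diff_divide_distrib)

lemma avg_cmult: "avg V (\<lambda>\<omega>. k * f \<omega>) = k * avg V f"
  by (simp add: avg_def sum_distrib_left)

lemma avg_sum: "avg V (\<lambda>\<omega>. \<Sum>i\<in>I. f i \<omega>) = (\<Sum>i\<in>I. avg V (f i))"
  unfolding avg_def by (subst sum.swap) (simp add: sum_divide_distrib)

text \<open>
  A subset of a disjoint union is a pair of subsets: the source of all independence used below.
\<close>

lemma avg_split:
  assumes "finite U" "finite W" "U \<inter> W = {}"
  shows "avg (U \<union> W) (\<lambda>\<omega>. f (\<omega> \<inter> U) * g (\<omega> \<inter> W)) = avg U f * avg W g"
proof -
  have "(\<Sum>\<omega>\<in>Pow (U \<union> W). f (\<omega> \<inter> U) * g (\<omega> \<inter> W))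
      = (\<Sum>(a, b)\<in>Pow U \<times> Pow W. f a * g b)"
    by (rule sum.reindex_bij_witness[where i = "\<lambda>(a, b). a \<union> b" and j = "\<lambda>\<omega>. (\<omega> \<inter> U, \<omega> \<inter> W)"])
       (use assms(3) in \<open>auto simp: Int_Un_distrib2 Int_absorb2\<close>)
  then show ?thesis
    using assms by (simp add: avg_def sum_product sum.cartesian_product card_Un_disjoint power_add)
qed

lemma avg_restrict:
  assumes "finite V" "U \<subseteq> V"
  shows "avg V (\<lambda>\<omega>. f (\<omega> \<inter> U)) = avg U f"
  using avg_split[of U "V - U" f "\<lambda>_. 1"] assms finite_subset[OF assms(2,1)]
  by (simp add: avg_const Un_absorb1)

lemma avg_image:
  assumes "inj_on \<phi> V"
  shows "avg (\<phi> ` V) f = avg V (\<lambda>\<omega>. f (\<phi> ` \<omega>))"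
proof -
  have "inj_on ((`) \<phi>) (Pow V)"
    using assms by (rule inj_on_image_Pow)
  then have "(\<Sum>\<omega>\<in>Pow (\<phi> ` V). f \<omega>) = (\<Sum>\<omega>\<in>Pow V. f (\<phi> ` \<omega>))"
    by (simp add: image_Pow_surj[symmetric, OF refl] sum.reindex)
  then show ?thesis
    using assms by (simp add: avg_def card_image)
qed

lemma avg_permute:
  assumes "bij_betw \<phi> (Pow V) (Pow V)"
  shows "avg V (\<lambda>\<omega>. f (\<phi> \<omega>)) = avg V f"
  using sum.reindex_bij_betw[OF assms, of f] by (simp add: avg_def)

lemma avg_compl: "avg V (\<lambda>\<omega>. f (V - \<omega>)) = avg V f"
  by (rule avg_permute, rule bij_betwI[where g = "\<lambda>\<omega>. V - \<omega>"]) auto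

lemma avg_insert:
  assumes "finite V" "x \<notin> V"
  shows "avg (insert x V) f = (avg V f + avg V (\<lambda>\<omega>. f (insert x \<omega>))) / 2"
proof -
  have "(\<Sum>\<omega>\<in>insert x ` Pow V. f \<omega>) = (\<Sum>\<omega>\<in>Pow V. f (insert x \<omega>))"
    by (rule sum.reindex_cong[of "insert x"]) (use assms(2) in \<open>auto simp: inj_on_def\<close>)
  moreover have "Pow V \<inter> insert x ` Pow V = {}"
    using assms(2) by auto
  ultimately show ?thesis
    using assms by (simp add: avg_def Pow_insert sum.union_disjoint field_simps)
qed

lemma pr_nonneg: "0 \<le> pr V A"
  by (simp add: pr_def avg_def sum_nonneg)

lemma pr_mono: "(\<And>\<omega>. \<omega> \<subseteq> V \<Longrightarrow> A \<omega> \<Longrightarrow> B \<omega>) \<Longrightarrow> pr V A \<le> pr V B"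
  unfolding pr_def by (rule avg_mono) auto

lemma pr_le_1: "finite V \<Longrightarrow> pr V A \<le> 1"
  using avg_mono[of V "\<lambda>\<omega>. of_bool (A \<omega>)" "\<lambda>_. 1"] by (simp add: pr_def avg_const)

lemma pr_not: "finite V \<Longrightarrow> pr V (\<lambda>\<omega>. \<not> A \<omega>) = 1 - pr V A"
  using avg_diff[of V "\<lambda>_. 1" "\<lambda>\<omega>. of_bool (A \<omega>)"] by (simp add: pr_def avg_const of_bool_not_iff)

lemma pr_Int_ge:
  assumes "finite V" "pr V A \<ge> 1 - a" "pr V B \<ge> 1 - b"
  shows "pr V (\<lambda>\<omega>. A \<omega> \<and> B \<omega>) \<ge> 1 - (a + b)"
proof -
  have "avg V (\<lambda>\<omega>. of_bool (A \<omega>) + of_bool (B \<omega>)) \<le> avg V (\<lambda>\<omega>. 1 + of_bool (A \<omega> \<and> B \<omega>))"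
    by (rule avg_mono) auto
  then show ?thesis
    using assms by (simp add: pr_def avg_add avg_const)
qed

lemma pr_indep:
  assumes "finite V" "U \<subseteq> V" "W \<subseteq> V" "U \<inter> W = {}"
    and "\<And>\<omega>. A \<omega> \<longleftrightarrow> A (\<omega> \<inter> U)" "\<And>\<omega>. B \<omega> \<longleftrightarrow> B (\<omega> \<inter> W)"
  shows "pr V (\<lambda>\<omega>. A \<omega> \<and> B \<omega>) = pr V A * pr V B"
proof -
  have fin: "finite U" "finite W"
    using assms(1-3) finite_subset by auto
  have "pr V A = avg V (\<lambda>\<omega>. of_bool (A (\<omega> \<inter> U)))" "pr V B = avg V (\<lambda>\<omega>. of_bool (B (\<omega> \<inter> W)))"
    unfolding pr_def using assms(5,6) by (auto intro: avg_cong)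
  then have *: "pr V A = pr U A" "pr V B = pr W B"
    by (simp_all add: pr_def avg_restrict[OF assms(1,2), of "\<lambda>\<omega>. of_bool (A \<omega>)"]
        avg_restrict[OF assms(1,3), of "\<lambda>\<omega>. of_bool (B \<omega>)"])
  have "pr V (\<lambda>\<omega>. A \<omega> \<and> B \<omega>)
      = avg V (\<lambda>\<omega>. of_bool (A ((\<omega> \<inter> (U \<union> W)) \<inter> U)) * of_bool (B ((\<omega> \<inter> (U \<union> W)) \<inter> W)))"
  proof (unfold pr_def, rule avg_cong)
    fix \<omega>
    have "\<omega> \<inter> (U \<union> W) \<inter> U = \<omega> \<inter> U" "\<omega> \<inter> (U \<union> W) \<inter> W = \<omega> \<inter> W" by auto
    then show "of_bool (A \<omega> \<and> B \<omega>)
      = (of_bool (A ((\<omega> \<inter> (U \<union> W)) \<inter> U)) * of_bool (B ((\<omega> \<inter> (U \<union> W)) \<inter> W)) :: real)"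
      using assms(5)[of \<omega>] assms(6)[of \<omega>] by simp
  qed
  also have "\<dots> = avg (U \<union> W) (\<lambda>\<omega>. of_bool (A (\<omega> \<inter> U)) * of_bool (B (\<omega> \<inter> W)))"
    using assms(2,3)
    by (intro avg_restrict[OF assms(1), of "U \<union> W" "\<lambda>\<omega>. of_bool (A (\<omega> \<inter> U)) * of_bool (B (\<omega> \<inter> W))"]) auto
  also have "\<dots> = pr U A * pr W B"
    using avg_split[OF fin assms(4), of "\<lambda>\<omega>. of_bool (A \<omega>)" "\<lambda>\<omega>. of_bool (B \<omega>)"] by (simp add: pr_def)
  finally show ?thesis
    by (simp add: *)
qed

lemma pr_restrict:
  assumes "finite V" "U \<subseteq> V" "\<And>\<omega>. A \<omega> \<longleftrightarrow> A (\<omega> \<inter> U)"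
  shows "pr V A = pr U A"
proof -
  have "pr V A = avg V (\<lambda>\<omega>. of_bool (A (\<omega> \<inter> U)))"
    unfolding pr_def using assms(3) by (auto intro: avg_cong)
  then show ?thesis
    by (simp add: pr_def avg_restrict[OF assms(1,2), of "\<lambda>\<omega>. of_bool (A \<omega>)"])
qed

lemma pr_mono_sites:
  assumes "finite V" "U \<subseteq> V" "\<And>\<omega> \<eta>. \<omega> \<subseteq> \<eta> \<Longrightarrow> A \<omega> \<Longrightarrow> A \<eta>"
  shows "pr U A \<le> pr V A"
proof -
  have "pr U A = pr V (\<lambda>\<omega>. A (\<omega> \<inter> U))"
    by (simp add: pr_def avg_restrict[OF assms(1,2), of "\<lambda>\<omega>. of_bool (A \<omega>)"])
  also have "\<dots> \<le> pr V A"
    using assms(3)[of "_ \<inter> U"] by (intro pr_mono) auto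
  finally show ?thesis .
qed

lemma pr_image: "inj_on \<phi> V \<Longrightarrow> pr (\<phi> ` V) A = pr V (\<lambda>\<omega>. A (\<phi> ` \<omega>))"
  by (simp add: pr_def avg_image)

lemma pr_compl: "pr V (\<lambda>\<omega>. A (V - \<omega>)) = pr V A"
  unfolding pr_def by (rule avg_compl)

text \<open>
  Harris's inequality (the FKG inequality for product measure). In the induction on the number of sites,
  conditioning on the last site leaves two averages of each function, both ordered the same way, and the
  rest is Chebyshev's inequality for two values.
\<close>

lemma harris:
  assumes "finite V"
    and "\<And>\<omega> \<eta>. \<omega> \<subseteq> \<eta> \<Longrightarrow> f \<omega> \<le> f \<eta>" "\<And>\<omega> \<eta>. \<omega> \<subseteq> \<eta> \<Longrightarrow> g \<omega> \<le> g \<eta>"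
  shows "avg V f * avg V g \<le> avg V (\<lambda>\<omega>. f \<omega> * g \<omega>)"
  using assms
proof (induction V arbitrary: f g rule: finite_induct)
  case empty
  then show ?case by (simp add: avg_def)
next
  case (insert x V)
  define f1 g1 where "f1 = (\<lambda>\<omega>. f (insert x \<omega>))" and "g1 = (\<lambda>\<omega>. g (insert x \<omega>))"
  have m1: "f1 \<omega> \<le> f1 \<eta>" "g1 \<omega> \<le> g1 \<eta>" if "\<omega> \<subseteq> \<eta>" for \<omega> \<eta>
    using that insert.prems by (auto simp: f1_def g1_def intro!: insert.prems)
  have "avg V f \<le> avg V f1" "avg V g \<le> avg V g1"
    by (auto simp: f1_def g1_def intro!: avg_mono insert.prems)
  then have "0 \<le> (avg V f1 - avg V f) * (avg V g1 - avg V g)"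
    by simp
  moreover have "avg V f * avg V g \<le> avg V (\<lambda>\<omega>. f \<omega> * g \<omega>)"
    using insert.IH[of f g] insert.prems by blast
  moreover have "avg V f1 * avg V g1 \<le> avg V (\<lambda>\<omega>. f1 \<omega> * g1 \<omega>)"
    using insert.IH[of f1 g1] m1 by blast
  ultimately show ?case
    using insert.hyps
    by (simp add: avg_insert flip: fun_cong[OF f1_def] fun_cong[OF g1_def]) (simp add: algebra_simps)
qed

text \<open>
  The square-root trick: if one of \<open>n\<close> equally likely increasing events occurs with high probability,
  then each of them does, because by Harris's inequality the complements are positively correlated.
\<close>

lemma root_trick:
  assumes "finite V" "\<And>i \<omega> \<eta>. \<omega> \<subseteq> \<eta> \<Longrightarrow> A i \<omega> \<Longrightarrow> A i \<eta>" "\<And>i. i < n \<Longrightarrow> pr V (A i) = p"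
  shows "(1 - p) ^ n \<le> 1 - pr V (\<lambda>\<omega>. \<exists>i<n. A i \<omega>)"
  using assms(3)
proof (induction n)
  case 0
  then show ?case using assms(1) by (simp add: pr_def avg_const)
next
  case (Suc n)
  let ?f = "\<lambda>\<omega>. - of_bool (\<forall>i<n. \<not> A i \<omega>) :: real" and ?g = "\<lambda>\<omega>. - of_bool (\<not> A n \<omega>) :: real"
  have "1 - pr V (\<lambda>\<omega>. \<exists>i<n. A i \<omega>) = pr V (\<lambda>\<omega>. \<forall>i<n. \<not> A i \<omega>)"
    using pr_not[OF assms(1), of "\<lambda>\<omega>. \<exists>i<n. A i \<omega>"] by simp
  moreover have "1 - p = pr V (\<lambda>\<omega>. \<not> A n \<omega>)"
    using Suc.prems pr_not[OF assms(1), of "A n"] by simp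
  moreover have "(1 - p) ^ n \<le> 1 - pr V (\<lambda>\<omega>. \<exists>i<n. A i \<omega>)"
    using Suc by simp
  ultimately have "(1 - p) ^ Suc n \<le> pr V (\<lambda>\<omega>. \<not> A n \<omega>) * pr V (\<lambda>\<omega>. \<forall>i<n. \<not> A i \<omega>)"
    using pr_nonneg[of V "\<lambda>\<omega>. \<not> A n \<omega>"] by (simp add: mult_left_mono)
  also have "\<dots> = avg V ?f * avg V ?g"
    using avg_cmult[of V "-1"] by (simp add: pr_def)
  also have "\<dots> \<le> avg V (\<lambda>\<omega>. ?f \<omega> * ?g \<omega>)"
    by (rule harris[OF assms(1)]) (use assms(2) in \<open>auto simp: of_bool_def\<close>)
  also have "\<dots> = pr V (\<lambda>\<omega>. \<not> (\<exists>i<Suc n. A i \<omega>))"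
    unfolding pr_def by (rule avg_cong) (auto simp: less_Suc_eq)
  also have "\<dots> = 1 - pr V (\<lambda>\<omega>. \<exists>i<Suc n. A i \<omega>)"
    by (rule pr_not[OF assms(1)])
  finally show ?case .
qed

section \<open>Fourier analysis on the cube\<close>

text \<open>
  The Walsh character of \<open>S\<close>. Since \<open>S\<close> and \<open>\<omega>\<close> play symmetric roles, orthogonality in either variable is
  the same statement.
\<close>

definition walsh :: "'a set \<Rightarrow> 'a set \<Rightarrow> real" where
  "walsh S \<omega> = (-1) ^ card (S \<inter> \<omega>)"

definition fourier :: "'a set \<Rightarrow> ('a set \<Rightarrow> real) \<Rightarrow> 'a set \<Rightarrow> real" where
  "fourier V f S = avg V (\<lambda>\<omega>. f \<omega> * walsh S \<omega>)"

lemma walsh_commute: "walsh S \<omega> = walsh \<omega> S"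
  by (simp add: walsh_def Int_commute)

lemma walsh_empty: "walsh {} \<omega> = 1"
  by (simp add: walsh_def)

lemma abs_walsh: "\<bar>walsh S \<omega>\<bar> = 1"
  by (simp add: walsh_def)

lemma walsh_sym_diff:
  assumes "finite S"
  shows "walsh S (sym_diff a b) = walsh S a * walsh S b"
proof -
  have split: "card (S \<inter> c) = card (S \<inter> (c - d)) + card (S \<inter> (c \<inter> d))" for c d :: "'a set"
    using assms by (subst card_Un_disjoint[symmetric]) (auto intro!: arg_cong[of _ _ card])
  have "card (S \<inter> sym_diff a b) = card (S \<inter> (a - b)) + card (S \<inter> (b - a))"
    using assms by (subst card_Un_disjoint[symmetric]) (auto intro!: arg_cong[of _ _ card])
  moreover have "card (S \<inter> (b \<inter> a)) = card (S \<inter> (a \<inter> b))"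
    by (simp add: Int_commute)
  ultimately have "card (S \<inter> sym_diff a b) + 2 * card (S \<inter> (a \<inter> b)) = card (S \<inter> a) + card (S \<inter> b)"
    using split[of a b] split[of b a] by simp
  then have "(-1 :: real) ^ (card (S \<inter> sym_diff a b) + 2 * card (S \<inter> (a \<inter> b)))
      = (-1) ^ (card (S \<inter> a) + card (S \<inter> b))" by simp
  then show ?thesis by (simp add: walsh_def power_add)
qed

lemma avg_flip:
  assumes "x \<in> V"
  shows "avg V (\<lambda>\<omega>. f (sym_diff \<omega> {x})) = avg V f"
  by (rule avg_permute, rule bij_betwI[where g = "\<lambda>\<omega>. sym_diff \<omega> {x}"]) (use assms in auto)

lemma walsh_flip:
  assumes "finite S" "x \<in> S"
  shows "walsh S (sym_diff \<omega> {x}) = - walsh S \<omega>"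
  using assms by (simp only: walsh_sym_diff) (simp add: walsh_def)

lemma avg_walsh:
  assumes "finite V" "S \<subseteq> V"
  shows "avg V (walsh S) = of_bool (S = {})"
proof (cases "S = {}")
  case True
  then have "walsh S = (\<lambda>_. 1)" by (auto simp: walsh_def)
  then show ?thesis using assms True by (simp add: avg_const)
next
  case False
  then obtain x where x: "x \<in> S" by auto
  have "avg V (walsh S) = avg V (\<lambda>\<omega>. walsh S (sym_diff \<omega> {x}))"
    using avg_flip[of x V "walsh S"] x assms by auto
  also have "\<dots> = - avg V (walsh S)"
    using walsh_flip[OF finite_subset[OF assms(2,1)] x] avg_cmult[of V "-1" "walsh S"] by simp
  finally show ?thesis using False by simp
qed

lemma fourier_inversion:
  assumes "finite V" "\<omega> \<subseteq> V"
  shows "f \<omega> = (\<Sum>S\<in>Pow V. fourier V f S * walsh S \<omega>)"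
proof -
  have fin: "finite \<eta>" if "\<eta> \<subseteq> V" for \<eta> using that assms finite_subset by auto
  have "(\<Sum>S\<in>Pow V. fourier V f S * walsh S \<omega>)
      = (\<Sum>\<eta>\<in>Pow V. f \<eta> * (\<Sum>S\<in>Pow V. walsh S \<eta> * walsh S \<omega>) / 2 ^ card V)"
    unfolding fourier_def avg_def sum_divide_distrib sum_distrib_left sum_distrib_right
    by (subst sum.swap) (simp add: mult_ac)
  also have "\<dots> = (\<Sum>\<eta>\<in>Pow V. if \<eta> = \<omega> then f \<eta> else 0)"
  proof (rule sum.cong[OF refl])
    fix \<eta> assume "\<eta> \<in> Pow V"
    then have "(\<Sum>S\<in>Pow V. walsh S \<eta> * walsh S \<omega>) = (\<Sum>S\<in>Pow V. walsh (sym_diff \<eta> \<omega>) S)"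
      using walsh_sym_diff[OF fin, of _ \<eta> \<omega>] by (intro sum.cong) (auto simp: walsh_commute[of _ \<eta>] walsh_commute[of _ \<omega>] walsh_commute[of "sym_diff \<eta> \<omega>"])
    moreover have "(\<Sum>S\<in>Pow V. walsh (sym_diff \<eta> \<omega>) S) / 2 ^ card V = of_bool (sym_diff \<eta> \<omega> = {})"
    proof -
      have "avg V (walsh (sym_diff \<eta> \<omega>)) = of_bool (sym_diff \<eta> \<omega> = {})"
        by (rule avg_walsh[OF assms(1)]) (use \<open>\<eta> \<in> Pow V\<close> assms(2) in auto)
      then show ?thesis by (simp only: avg_def)
    qed
    moreover have "sym_diff \<eta> \<omega> = {} \<longleftrightarrow> \<eta> = \<omega>" by auto
    ultimately show "f \<eta> * (\<Sum>S\<in>Pow V. walsh S \<eta> * walsh S \<omega>) / 2 ^ card V = (if \<eta> = \<omega> then f \<eta> else 0)"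
      by (simp flip: times_divide_eq_right)
  qed
  also have "\<dots> = f \<omega>" using assms by (simp add: sum.delta')
  finally show ?thesis by simp
qed

lemma parseval:
  assumes "finite V"
  shows "(\<Sum>S\<in>Pow V. (fourier V f S)\<^sup>2) = avg V (\<lambda>\<omega>. (f \<omega>)\<^sup>2)"
proof -
  have "avg V (\<lambda>\<omega>. (f \<omega>)\<^sup>2) = avg V (\<lambda>\<omega>. \<Sum>S\<in>Pow V. fourier V f S * (f \<omega> * walsh S \<omega>))"
    using fourier_inversion[OF assms, of _ f]
    by (intro avg_cong) (simp add: power2_eq_square sum_distrib_left mult_ac)
  also have "\<dots> = (\<Sum>S\<in>Pow V. fourier V f S * fourier V f S)"
    by (simp add: avg_sum avg_cmult fourier_def)
  finally show ?thesis by (simp add: power2_eq_square)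
qed

text \<open>
  Expanding \<open>h\<close> alone suffices: a character of \<open>V - sym_diff a b\<close> factors into characters of \<open>V\<close>, \<open>a\<close> and
  \<open>b\<close>, after which the two averages become the Fourier coefficients of \<open>f\<close> and \<open>g\<close>.
\<close>

lemma fourier_triple:
  assumes "finite V"
  shows "avg V (\<lambda>a. avg V (\<lambda>b. f a * g b * h (V - sym_diff a b)))
       = (\<Sum>S\<in>Pow V. walsh S V * (fourier V f S * fourier V g S * fourier V h S))"
proof -
  have ch: "walsh S (V - sym_diff a b) = walsh S V * walsh S a * walsh S b"
    if "S \<subseteq> V" "a \<subseteq> V" "b \<subseteq> V" for S a b
  proof -
    have "V - sym_diff a b = sym_diff V (sym_diff a b)" using that by auto
    moreover have "finite S" using that assms by (meson finite_subset)
    ultimately show ?thesis by (metis walsh_sym_diff mult.assoc)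
  qed
  have "avg V (\<lambda>a. avg V (\<lambda>b. f a * g b * h (V - sym_diff a b)))
      = avg V (\<lambda>a. avg V (\<lambda>b. \<Sum>S\<in>Pow V. walsh S V * fourier V h S * (f a * walsh S a) * (g b * walsh S b)))"
  proof (intro avg_cong)
    fix a b assume "a \<subseteq> V" "b \<subseteq> V"
    have "h (V - sym_diff a b) = (\<Sum>S\<in>Pow V. fourier V h S * walsh S (V - sym_diff a b))"
      by (rule fourier_inversion[OF assms]) auto
    also have "\<dots> = (\<Sum>S\<in>Pow V. fourier V h S * (walsh S V * walsh S a * walsh S b))"
      using \<open>a \<subseteq> V\<close> \<open>b \<subseteq> V\<close> by (intro sum.cong) (auto simp: ch)
    finally show "f a * g b * h (V - sym_diff a b)
      = (\<Sum>S\<in>Pow V. walsh S V * fourier V h S * (f a * walsh S a) * (g b * walsh S b))"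
      by (simp add: sum_distrib_left mult_ac)
  qed
  also have "\<dots> = (\<Sum>S\<in>Pow V. walsh S V * fourier V h S * fourier V f S * fourier V g S)"
  proof -
    have "avg V (\<lambda>b. \<Sum>S\<in>Pow V. walsh S V * fourier V h S * (f a * walsh S a) * (g b * walsh S b))
        = (\<Sum>S\<in>Pow V. walsh S V * fourier V h S * fourier V g S * (f a * walsh S a))" for a
      by (simp only: avg_sum avg_cmult flip: fourier_def[of V g]) (simp only: mult_ac)
    then have "avg V (\<lambda>a. avg V (\<lambda>b. \<Sum>S\<in>Pow V. walsh S V * fourier V h S * (f a * walsh S a) * (g b * walsh S b)))
        = (\<Sum>S\<in>Pow V. walsh S V * fourier V h S * fourier V g S * fourier V f S)"
      by (simp only: avg_sum avg_cmult flip: fourier_def[of V f])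
    then show ?thesis by (simp only: mult_ac)
  qed
  finally show ?thesis by (simp add: mult_ac)
qed

text \<open>
  Flipping the membership of \<open>x\<close> changes the sign of the character, so configurations for which \<open>x\<close> is not
  pivotal cancel in pairs.
\<close>

lemma fourier_le_influence:
  assumes "finite V" "S \<subseteq> V" "x \<in> S"
  shows "\<bar>fourier V (\<lambda>\<omega>. of_bool (A \<omega>)) S\<bar> \<le> pr V (\<lambda>\<omega>. A (insert x \<omega>) \<noteq> A (\<omega> - {x}))"
proof -
  let ?f = "\<lambda>\<omega>. of_bool (A \<omega>) :: real"
  have finS: "finite S" using assms finite_subset by auto
  have "fourier V ?f S = avg V (\<lambda>\<omega>. ?f (sym_diff \<omega> {x}) * walsh S (sym_diff \<omega> {x}))"
    unfolding fourier_def using assms avg_flip[of x V "\<lambda>\<omega>. ?f \<omega> * walsh S \<omega>"] by auto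
  also have "\<dots> = avg V (\<lambda>\<omega>. - ?f (sym_diff \<omega> {x}) * walsh S \<omega>)"
    by (intro avg_cong) (use walsh_flip[OF finS assms(3)] in \<open>simp del: Un_insert_right\<close>)
  finally have "2 * fourier V ?f S
      = avg V (\<lambda>\<omega>. ?f \<omega> * walsh S \<omega>) + avg V (\<lambda>\<omega>. - ?f (sym_diff \<omega> {x}) * walsh S \<omega>)"
    by (simp add: fourier_def)
  then have "2 * fourier V ?f S = avg V (\<lambda>\<omega>. (?f \<omega> - ?f (sym_diff \<omega> {x})) * walsh S \<omega>)"
    by (simp add: algebra_simps flip: avg_add)
  also have "\<bar>\<dots>\<bar> \<le> avg V (\<lambda>\<omega>. \<bar>(?f \<omega> - ?f (sym_diff \<omega> {x})) * walsh S \<omega>\<bar>)"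
    by (simp add: avg_def divide_right_mono sum_abs)
  also have "\<dots> \<le> pr V (\<lambda>\<omega>. A (insert x \<omega>) \<noteq> A (\<omega> - {x}))"
    unfolding pr_def
  proof (rule avg_mono)
    fix \<omega>
    have "A (sym_diff \<omega> {x}) = A (\<omega> - {x}) \<and> A \<omega> = A (insert x \<omega>) \<or>
        A (sym_diff \<omega> {x}) = A (insert x \<omega>) \<and> A \<omega> = A (\<omega> - {x})"
      by (cases "x \<in> \<omega>") (simp_all add: insert_absorb)
    then show "\<bar>(?f \<omega> - ?f (sym_diff \<omega> {x})) * walsh S \<omega>\<bar> \<le> of_bool (A (insert x \<omega>) \<noteq> A (\<omega> - {x}))"
      by (simp only: abs_mult abs_walsh) (elim disjE conjE; simp)
  qed
  finally show ?thesis by linarith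
qed

text \<open>
  The term of the empty set is the product of the means; in the others one coefficient is taken out at
  its maximum, and Parseval bounds what remains.
\<close>

lemma triple_correlation_bound:
  fixes f g h :: "'a set \<Rightarrow> real"
  assumes "finite V" "\<And>\<omega>. \<bar>g \<omega>\<bar> \<le> 1" "\<And>\<omega>. \<bar>h \<omega>\<bar> \<le> 1" "0 \<le> \<epsilon>"
    and small: "\<And>S. S \<subseteq> V \<Longrightarrow> S \<noteq> {} \<Longrightarrow> \<bar>fourier V f S\<bar> \<le> \<epsilon>"
  shows "\<bar>avg V (\<lambda>a. avg V (\<lambda>b. f a * g b * h (V - sym_diff a b))) - avg V f * avg V g * avg V h\<bar> \<le> \<epsilon>"
proof -
  let ?F = "fourier V f" and ?G = "fourier V g" and ?H = "fourier V h"
  have le1: "(\<Sum>S\<in>Pow V. (fourier V k S)\<^sup>2) \<le> 1" if "\<And>\<omega>. \<bar>k \<omega>\<bar> \<le> 1" for k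
    using avg_mono[of V "\<lambda>\<omega>. (k \<omega>)\<^sup>2" "\<lambda>_. 1"] that assms(1)
    by (simp add: parseval avg_const abs_square_le_1)
  have "avg V f * avg V g * avg V h = walsh {} V * (?F {} * ?G {} * ?H {})"
    by (simp add: fourier_def walsh_empty)
  moreover have "(\<Sum>S\<in>Pow V. walsh S V * (?F S * ?G S * ?H S))
     = walsh {} V * (?F {} * ?G {} * ?H {}) + (\<Sum>S\<in>Pow V - {{}}. walsh S V * (?F S * ?G S * ?H S))"
    using assms(1) by (subst sum.remove[of _ "{}"]) auto
  ultimately have "\<bar>avg V (\<lambda>a. avg V (\<lambda>b. f a * g b * h (V - sym_diff a b))) - avg V f * avg V g * avg V h\<bar>
      = \<bar>\<Sum>S\<in>Pow V - {{}}. walsh S V * (?F S * ?G S * ?H S)\<bar>"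
    using fourier_triple[OF assms(1), of f g h] by simp
  also have "\<dots> \<le> (\<Sum>S\<in>Pow V - {{}}. \<epsilon> * (((?G S)\<^sup>2 + (?H S)\<^sup>2) / 2))"
  proof (rule order_trans[OF sum_abs], rule sum_mono)
    fix S assume "S \<in> Pow V - {{}}"
    then have "\<bar>?F S\<bar> \<le> \<epsilon>" using small by auto
    moreover have "\<bar>?G S * ?H S\<bar> \<le> ((?G S)\<^sup>2 + (?H S)\<^sup>2) / 2"
      using sum_squares_bound[of "\<bar>?G S\<bar>" "\<bar>?H S\<bar>"] by (simp add: abs_mult)
    ultimately have "\<bar>?F S\<bar> * \<bar>?G S * ?H S\<bar> \<le> \<epsilon> * (((?G S)\<^sup>2 + (?H S)\<^sup>2) / 2)"
      by (intro mult_mono) auto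
    then show "\<bar>walsh S V * (?F S * ?G S * ?H S)\<bar> \<le> \<epsilon> * (((?G S)\<^sup>2 + (?H S)\<^sup>2) / 2)"
      by (simp add: abs_mult abs_walsh mult.assoc)
  qed
  also have "\<dots> \<le> (\<Sum>S\<in>Pow V. \<epsilon> * (((?G S)\<^sup>2 + (?H S)\<^sup>2) / 2))"
    using assms(1,4) by (intro sum_mono2) auto
  also have "\<dots> = \<epsilon> * (((\<Sum>S\<in>Pow V. (?G S)\<^sup>2) + (\<Sum>S\<in>Pow V. (?H S)\<^sup>2)) / 2)"
    by (simp add: sum_distrib_left[symmetric] sum.distrib sum_divide_distrib[symmetric])
  also have "\<dots> \<le> \<epsilon> * 1"
    using le1[of g] le1[of h] assms(2-4) by (intro mult_left_mono) auto
  finally show ?thesis by simp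
qed

section \<open>The triangular lattice\<close>

text \<open>
  The centres of hexagonal cells form a triangular lattice. In the basis of two neighbouring directions at
  angle \<open>pi/3\<close> it becomes the square lattice with one family of diagonals added.
\<close>

definition tri_adj :: "int \<times> int \<Rightarrow> int \<times> int \<Rightarrow> bool" where
  "tri_adj p q \<longleftrightarrow> (fst q - fst p, snd q - snd p) \<in> {(1, 0), (-1, 0), (0, 1), (0, -1), (1, -1), (-1, 1)}"

text \<open>
  The graph distance from the origin in this lattice; its balls are hexagons.
\<close>

definition hex_norm :: "int \<times> int \<Rightarrow> int" where
  "hex_norm p = max \<bar>fst p\<bar> (max \<bar>snd p\<bar> \<bar>fst p + snd p\<bar>)"

text \<open>
  \<open>conn S u v\<close>: there is a lattice path from \<open>u\<close> to \<open>v\<close> all of whose cells, ends included, lie in \<open>S\<close>.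
\<close>

inductive conn :: "(int \<times> int) set \<Rightarrow> int \<times> int \<Rightarrow> int \<times> int \<Rightarrow> bool" for S where
  refl: "u \<in> S \<Longrightarrow> conn S u u"
| step: "conn S u v \<Longrightarrow> tri_adj v w \<Longrightarrow> w \<in> S \<Longrightarrow> conn S u w"

lemma tri_adj_sym: "tri_adj p q \<Longrightarrow> tri_adj q p"
proof -
  let ?H = "{(1, 0), (-1, 0), (0, 1), (0, -1), (1, -1), (-1, 1)} :: (int \<times> int) set"
  have "(- a, - b) \<in> ?H" if "(a, b) \<in> ?H" for a b
    using that by auto
  from this[of "fst q - fst p" "snd q - snd p"] show "tri_adj p q \<Longrightarrow> tri_adj q p"
    by (simp only: tri_adj_def minus_diff_eq)
qed

lemma tri_adj_shift: "tri_adj (p - z) (q - z) \<longleftrightarrow> tri_adj p q"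
  by (simp add: tri_adj_def)

lemma conn_mem: "conn S u v \<Longrightarrow> u \<in> S \<and> v \<in> S"
  by (induction rule: conn.induct) auto

lemma conn_mono:
  assumes "conn S u v" "S \<subseteq> T"
  shows "conn T u v"
  using assms(1)
proof (induction rule: conn.induct)
  case (step u v w)
  then show ?case using assms(2) by (intro conn.step[OF step.IH step.hyps(2)]) (rule subsetD)
qed (intro conn.refl subsetD[OF assms(2)])

lemma conn_trans:
  assumes "conn S u v" "conn S v w"
  shows "conn S u w"
  using assms(2,1)
proof (induction rule: conn.induct)
  case (step u' v w)
  show ?case by (rule conn.step[OF step.IH[OF step.prems] step.hyps(2,3)])
qed

lemma conn_sym: "conn S u v \<Longrightarrow> conn S v u"
proof (induction rule: conn.induct)
  case (step u v w)
  have "conn S w v"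
    using step conn_mem[of S u v] conn.step[OF conn.refl[of w S] tri_adj_sym] by blast
  then show ?case using step.IH by (rule conn_trans)
qed (rule conn.refl)

lemma conn_tri_adj: "tri_adj u v \<Longrightarrow> u \<in> S \<Longrightarrow> v \<in> S \<Longrightarrow> conn S u v"
  by (rule conn.step[OF conn.refl])

lemma conn_image:
  assumes "conn S u v" "\<And>p q. tri_adj p q \<Longrightarrow> tri_adj (\<phi> p) (\<phi> q)"
  shows "conn (\<phi> ` S) (\<phi> u) (\<phi> v)"
  using assms(1)
proof (induction rule: conn.induct)
  case (step u v w)
  then show ?case by (intro conn.step[OF step.IH] assms(2) imageI)
qed (intro conn.refl imageI)

text \<open>
  The first step of a path out of \<open>Q\<close>.
\<close>

lemma conn_exit:
  assumes "conn S u v" "u \<in> Q" "v \<notin> Q"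
  obtains w w' where "conn (S \<inter> Q) u w" "tri_adj w w'" "w' \<in> S - Q"
proof -
  have "v \<in> Q \<and> conn (S \<inter> Q) u v \<or> (\<exists>w w'. conn (S \<inter> Q) u w \<and> tri_adj w w' \<and> w' \<in> S - Q)"
    using assms(1,2)
  proof (induction rule: conn.induct)
    case (step u v w)
    then show ?case
      by (cases "w \<in> Q") (blast intro: conn.intros)+
  qed (simp add: conn.refl)
  then show ?thesis using assms(3) that by blast
qed

lemma hex_norm_le_iff: "hex_norm p \<le> N \<longleftrightarrow> \<bar>fst p\<bar> \<le> N \<and> \<bar>snd p\<bar> \<le> N \<and> \<bar>fst p + snd p\<bar> \<le> N"
  by (simp add: hex_norm_def)

lemma hex_norm_ge: "\<bar>fst p\<bar> \<le> hex_norm p" "\<bar>snd p\<bar> \<le> hex_norm p" "\<bar>fst p + snd p\<bar> \<le> hex_norm p"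
  by (simp_all add: hex_norm_def)

lemma hex_norm_minus: "hex_norm (- p) = hex_norm p"
proof -
  have "\<bar>- fst p - snd p\<bar> = \<bar>fst p + snd p\<bar>" by linarith
  then show ?thesis by (simp add: hex_norm_def)
qed

lemma hex_norm_triangle: "hex_norm (p + q) \<le> hex_norm p + hex_norm q"
proof -
  have "\<bar>fst p + fst q\<bar> \<le> hex_norm p + hex_norm q" "\<bar>snd p + snd q\<bar> \<le> hex_norm p + hex_norm q"
      "\<bar>(fst p + snd p) + (fst q + snd q)\<bar> \<le> hex_norm p + hex_norm q"
    by (rule order_trans[OF abs_triangle_ineq add_mono], rule hex_norm_ge, rule hex_norm_ge)+
  then show ?thesis
    by (simp add: hex_norm_le_iff add_ac)
qed

lemma hex_norm_triangle_diff: "hex_norm (p - q) \<le> hex_norm p + hex_norm q" "hex_norm p - hex_norm q \<le> hex_norm (p - q)"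
  using hex_norm_triangle[of p "- q"] hex_norm_triangle[of "p - q" q] hex_norm_minus[of q] by simp_all

lemma hex_norm_nonneg [simp]: "0 \<le> hex_norm p"
  using hex_norm_ge(1)[of p] by linarith

lemma hex_norm_tri_adj:
  assumes "tri_adj p q"
  shows "\<bar>hex_norm p - hex_norm q\<bar> \<le> 1"
proof -
  have "hex_norm (p - q) \<le> 1" "hex_norm (q - p) \<le> 1"
    using assms by (auto simp: hex_norm_le_iff tri_adj_def)
  then show ?thesis
    using hex_norm_triangle_diff(2)[of p q] hex_norm_triangle_diff(2)[of q p] by linarith
qed

definition hex_ball :: "int \<Rightarrow> (int \<times> int) set" where
  "hex_ball N = {p. hex_norm p \<le> N}"

definition annulus :: "int \<Rightarrow> int \<Rightarrow> (int \<times> int) set" where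
  "annulus m N = {p. m < hex_norm p \<and> hex_norm p \<le> N}"

lemma finite_hex_ball [simp]: "finite (hex_ball N)"
  by (rule finite_subset[of _ "{-N..N} \<times> {-N..N}"]) (auto simp: hex_ball_def hex_norm_le_iff abs_le_iff)

lemma finite_annulus [simp]: "finite (annulus m N)"
  by (rule finite_subset[OF _ finite_hex_ball[of N]]) (auto simp: hex_ball_def annulus_def)

lemma conn_reach:
  assumes "conn S u v" "hex_norm u \<le> N" "N \<le> hex_norm v"
  obtains w where "conn (S \<inter> hex_ball N) u w" "hex_norm w = N"
proof (cases "hex_norm u = N")
  case True
  then show ?thesis
    using that[of u] conn_mem[OF assms(1)] conn.refl[of u "S \<inter> hex_ball N"] by (simp add: hex_ball_def)
next
  case False
  obtain w w' where w: "conn (S \<inter> {p. hex_norm p < N}) u w" "tri_adj w w'" "w' \<in> S - {p. hex_norm p < N}"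
    by (rule conn_exit[OF assms(1), of "{p. hex_norm p < N}"]) (use False assms(2,3) in auto)
  then have "hex_norm w' = N"
    using hex_norm_tri_adj[OF w(2)] conn_mem[OF w(1)] by auto
  moreover have "conn (S \<inter> hex_ball N) u w'"
    by (rule conn.step[OF conn_mono[OF w(1)] w(2)]) (use w(3) \<open>hex_norm w' = N\<close> in \<open>auto simp: hex_ball_def\<close>)
  ultimately show ?thesis using that by blast
qed

text \<open>
  A path from the inside of an annulus to its outside crosses it: stop at the first visit to the outer
  sphere and go back to the last exit from the inner ball.
\<close>

lemma conn_traverse:
  assumes "conn S u v" "hex_norm u \<le> m" "N \<le> hex_norm v" "m < N"
  obtains u' v' where "conn (S \<inter> annulus m N) u' v'" "hex_norm u' = m + 1" "hex_norm v' = N"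
proof -
  obtain v' where v': "conn (S \<inter> hex_ball N) u v'" "hex_norm v' = N"
    using conn_reach[OF assms(1), of N] assms(2,3,4) by auto
  obtain w w' where w: "conn (S \<inter> hex_ball N \<inter> {p. m < hex_norm p}) v' w" "tri_adj w w'"
      "w' \<in> S \<inter> hex_ball N - {p. m < hex_norm p}"
    by (rule conn_exit[OF conn_sym[OF v'(1)], of "{p. m < hex_norm p}"]) (use v'(2) assms(2,4) in auto)
  have "hex_norm w = m + 1"
    using hex_norm_tri_adj[OF w(2)] conn_mem[OF w(1)] w(3) by auto
  moreover have "S \<inter> hex_ball N \<inter> {p. m < hex_norm p} = S \<inter> annulus m N"
    by (auto simp: hex_ball_def annulus_def)
  ultimately show thesis
    using that[of w v'] w(1) v'(2) conn_sym by auto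
qed

section \<open>Planarity: crossing paths meet\<close>

text \<open>
  One edge \<open>v - w\<close> of a path, tested against the neighbours \<open>(x, y)\<close> and \<open>(x + 1, z)\<close>. The left-hand side
  asks whether the edge crosses exactly one of the two vertical rays that start between columns \<open>x\<close> and
  \<open>x + 1\<close> above \<open>(x, y)\<close>, and between columns \<open>x + 1\<close> and \<open>x + 2\<close> above \<open>(x + 1, z)\<close>; the right-hand side asks
  whether it has exactly one end in column \<open>x + 1\<close> above \<open>(x + 1, z)\<close>. Unless the edge meets one of the two
  points these agree, since an edge leaves that half-column through one of the rays.
\<close>

lemma edge_parity:
  fixes x y z vx vy wx wy :: int
  assumes ad: "(wx - vx = 1 \<and> wy - vy = 0) \<or> (wx - vx = -1 \<and> wy - vy = 0) \<or> (wx = vx \<and> wy - vy = 1)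
     \<or> (wx = vx \<and> wy - vy = -1) \<or> (wx - vx = 1 \<and> wy - vy = -1) \<or> (wx - vx = -1 \<and> wy - vy = 1)"
    and ne: "(x, y) \<noteq> (vx, vy)" "(x, y) \<noteq> (wx, wy)" "(x + 1, z) \<noteq> (vx, vy)" "(x + 1, z) \<noteq> (wx, wy)"
    and z: "z = y \<or> z = y - 1"
  shows "((vx = x \<and> wx = x + 1 \<and> vy > y \<or> wx = x \<and> vx = x + 1 \<and> wy > y) \<noteq>
          (vx = x + 1 \<and> wx = x + 1 + 1 \<and> vy > z \<or> wx = x + 1 \<and> vx = x + 1 + 1 \<and> wy > z))
       = ((vx = x + 1 \<and> vy > z) \<noteq> (wx = x + 1 \<and> wy > z))"
proof -
  consider "vx = wx" | "vx = x" "wx = x + 1" | "wx = x" "vx = x + 1" | "vx = x + 1" "wx = x + 2"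
    | "wx = x + 1" "vx = x + 2" | "vx \<noteq> wx" "vx \<noteq> x + 1" "wx \<noteq> x + 1"
    using ad by linarith
  then show ?thesis
  proof cases
    case 1
    have "vy = wy + 1 \<or> wy = vy + 1" using 1 ad by linarith
    then have "(vy > z) = (wy > z)" if "vx = x + 1" using that 1 ne(3,4) by auto
    then show ?thesis using 1 by auto
  next
    case 2
    have "vy = wy \<or> vy = wy + 1" using 2 ad by linarith
    then have "(vy > y) = (wy > z)" using z ne(1,4) 2 by auto
    then show ?thesis using 2 by auto
  next
    case 3
    have "wy = vy \<or> wy = vy + 1" using 3 ad by linarith
    then have "(wy > y) = (vy > z)" using z ne(2,3) 3 by auto
    then show ?thesis using 3 by auto
  qed auto
qed

text \<open>
  \<open>h x y\<close> is the parity of the number of edges of a path from \<open>u\<close> to \<open>v\<close> in \<open>T\<close> that cross the upward ray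
  starting just to the right of \<open>(x, y)\<close>. Off the path it changes between neighbours only through the end
  points \<open>u\<close> and \<open>v\<close>. The clauses treat the three directions of edges, points above \<open>T\<close> and points below \<open>T\<close>.
\<close>

definition parity_above :: "(int \<times> int) set \<Rightarrow> int \<times> int \<Rightarrow> int \<times> int \<Rightarrow> (int \<Rightarrow> int \<Rightarrow> bool) \<Rightarrow> bool" where
  "parity_above T u v h \<longleftrightarrow>
    (\<forall>x y. (x, y) \<notin> T \<longrightarrow> (x, y + 1) \<notin> T \<longrightarrow> h x y = h x (y + 1)) \<and>
    (\<forall>x y. (x, y) \<notin> T \<longrightarrow> (x + 1, y) \<notin> T \<longrightarrow>
       (h x y \<noteq> h (x + 1) y) = ((fst u = x + 1 \<and> snd u > y) \<noteq> (fst v = x + 1 \<and> snd v > y))) \<and>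
    (\<forall>x y. (x, y) \<notin> T \<longrightarrow> (x + 1, y - 1) \<notin> T \<longrightarrow>
       (h x y \<noteq> h (x + 1) (y - 1)) = ((fst u = x + 1 \<and> snd u > y - 1) \<noteq> (fst v = x + 1 \<and> snd v > y - 1))) \<and>
    (\<forall>x y. (\<forall>t\<in>T. snd t \<le> y) \<longrightarrow> \<not> h x y) \<and>
    (\<forall>x y. (\<forall>t\<in>T. y < snd t) \<longrightarrow> h x y = ((fst u \<le> x) \<noteq> (fst v \<le> x)))"

lemma parity_aboveD:
  assumes "parity_above T u v h"
  shows "(x, y) \<notin> T \<Longrightarrow> (x, y + 1) \<notin> T \<Longrightarrow> h x y = h x (y + 1)"
    and "(x, y) \<notin> T \<Longrightarrow> (x + 1, y) \<notin> T \<Longrightarrow>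
       (h x y \<noteq> h (x + 1) y) = ((fst u = x + 1 \<and> snd u > y) \<noteq> (fst v = x + 1 \<and> snd v > y))"
    and "(x, y) \<notin> T \<Longrightarrow> (x + 1, y - 1) \<notin> T \<Longrightarrow>
       (h x y \<noteq> h (x + 1) (y - 1)) = ((fst u = x + 1 \<and> snd u > y - 1) \<noteq> (fst v = x + 1 \<and> snd v > y - 1))"
    and "(\<forall>t\<in>T. snd t \<le> y) \<Longrightarrow> \<not> h x y"
    and "(\<forall>t\<in>T. y < snd t) \<Longrightarrow> h x y = ((fst u \<le> x) \<noteq> (fst v \<le> x))"
proof -
  note p = assms[unfolded parity_above_def]
  show "(x, y) \<notin> T \<Longrightarrow> (x, y + 1) \<notin> T \<Longrightarrow> h x y = h x (y + 1)"
    by (rule p[THEN conjunct1, rule_format])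
  show "(x, y) \<notin> T \<Longrightarrow> (x + 1, y) \<notin> T \<Longrightarrow>
       (h x y \<noteq> h (x + 1) y) = ((fst u = x + 1 \<and> snd u > y) \<noteq> (fst v = x + 1 \<and> snd v > y))"
    by (rule p[THEN conjunct2, THEN conjunct1, rule_format])
  show "(x, y) \<notin> T \<Longrightarrow> (x + 1, y - 1) \<notin> T \<Longrightarrow>
       (h x y \<noteq> h (x + 1) (y - 1)) = ((fst u = x + 1 \<and> snd u > y - 1) \<noteq> (fst v = x + 1 \<and> snd v > y - 1))"
    by (rule p[THEN conjunct2, THEN conjunct2, THEN conjunct1, rule_format])
  show "(\<forall>t\<in>T. snd t \<le> y) \<Longrightarrow> \<not> h x y"
    by (rule p[THEN conjunct2, THEN conjunct2, THEN conjunct2, THEN conjunct1, THEN spec, THEN spec, THEN mp])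
  show "(\<forall>t\<in>T. y < snd t) \<Longrightarrow> h x y = ((fst u \<le> x) \<noteq> (fst v \<le> x))"
    by (rule p[THEN conjunct2, THEN conjunct2, THEN conjunct2, THEN conjunct2, THEN spec, THEN spec, THEN mp])
qed

text \<open>
  Add the contribution of each step of the path, by induction along it.
\<close>

lemma parity_above_exists:
  assumes "conn T u v"
  shows "\<exists>h. parity_above T u v h"
  using assms
proof (induction rule: conn.induct)
  case (refl u)
  show ?case by (rule exI[of _ "\<lambda>_ _. False"]) (simp add: parity_above_def)
next
  case (step u v w)
  obtain h where "parity_above T u v h"
    using step.IH by blast
  note h = parity_aboveD[OF this]
  define e where "e x y \<longleftrightarrow> (fst v = x \<and> fst w = x + 1 \<and> snd v > y) \<or> (fst w = x \<and> fst v = x + 1 \<and> snd w > y)" for x y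
  obtain vx vy wx wy where vw: "v = (vx, vy)" "w = (wx, wy)" by (cases v, cases w)
  have vT: "v \<in> T" and wT: "w \<in> T" using step conn_mem by auto
  have ad: "(wx - vx = 1 \<and> wy - vy = 0) \<or> (wx - vx = -1 \<and> wy - vy = 0) \<or> (wx = vx \<and> wy - vy = 1)
     \<or> (wx = vx \<and> wy - vy = -1) \<or> (wx - vx = 1 \<and> wy - vy = -1) \<or> (wx - vx = -1 \<and> wy - vy = 1)"
    using step.hyps by (auto simp: tri_adj_def vw)
  have ne: "(x, y) \<noteq> (vx, vy)" "(x, y) \<noteq> (wx, wy)" if "(x, y) \<notin> T" for x y
    using that vT wT vw by auto
  have e1: "e x y = e x (y + 1)" if "(x, y) \<notin> T" "(x, y + 1) \<notin> T" for x y
  proof -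
    have "(vx = x \<longrightarrow> (y < vy) = (y + 1 < vy)) \<and> (wx = x \<longrightarrow> (y < wy) = (y + 1 < wy))"
      using ne[OF that(2)] by auto
    then show ?thesis by (auto simp: e_def vw)
  qed
  have e2: "(e x y \<noteq> e (x + 1) y) = ((fst v = x + 1 \<and> snd v > y) \<noteq> (fst w = x + 1 \<and> snd w > y))"
    if "(x, y) \<notin> T" "(x + 1, y) \<notin> T" for x y
    unfolding e_def vw fst_conv snd_conv by (rule edge_parity[OF ad]) (use ne that in blast)+
  have e3: "(e x y \<noteq> e (x + 1) (y - 1)) = ((fst v = x + 1 \<and> snd v > y - 1) \<noteq> (fst w = x + 1 \<and> snd w > y - 1))"
    if "(x, y) \<notin> T" "(x + 1, y - 1) \<notin> T" for x y
    unfolding e_def vw fst_conv snd_conv by (rule edge_parity[OF ad]) (use ne that in blast)+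
  have e4: "\<not> e x y" if "\<forall>t\<in>T. snd t \<le> y" for x y
    using that vT wT by (auto simp: e_def)
  have e5: "e x y = ((fst v \<le> x) \<noteq> (fst w \<le> x))" if "\<forall>t\<in>T. y < snd t" for x y
    using that vT wT ad by (auto simp: e_def vw)
  show ?case
    unfolding parity_above_def
  proof (intro exI[of _ "\<lambda>x y. h x y \<noteq> e x y"] conjI allI impI)
    fix x y assume a: "(x, y) \<notin> T" "(x, y + 1) \<notin> T"
    show "(h x y \<noteq> e x y) = (h x (y + 1) \<noteq> e x (y + 1))" using h(1)[OF a] e1[OF a] by simp
  next
    fix x y assume a: "(x, y) \<notin> T" "(x + 1, y) \<notin> T"
    show "((h x y \<noteq> e x y) \<noteq> (h (x + 1) y \<noteq> e (x + 1) y))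
      = ((fst u = x + 1 \<and> snd u > y) \<noteq> (fst w = x + 1 \<and> snd w > y))"
      using h(2)[OF a] e2[OF a] by argo
  next
    fix x y assume a: "(x, y) \<notin> T" "(x + 1, y - 1) \<notin> T"
    show "((h x y \<noteq> e x y) \<noteq> (h (x + 1) (y - 1) \<noteq> e (x + 1) (y - 1)))
      = ((fst u = x + 1 \<and> snd u > y - 1) \<noteq> (fst w = x + 1 \<and> snd w > y - 1))"
      using h(3)[OF a] e3[OF a] by argo
  next
    fix x y assume a: "\<forall>t\<in>T. snd t \<le> y"
    show "\<not> (h x y \<noteq> e x y)" using h(4)[OF a] e4[OF a] by simp
  next
    fix x y assume a: "\<forall>t\<in>T. y < snd t"
    show "(h x y \<noteq> e x y) = ((fst u \<le> x) \<noteq> (fst w \<le> x))" using h(5)[OF a, of x] e5[OF a, of x] by argo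
  qed
qed

text \<open>
  The parity of the crossings of a left-right path \<open>T\<close> above a point is odd below \<open>T\<close> and even above it.
  It could not change along a bottom-top path that avoids \<open>T\<close> and stays in the columns between the ends of \<open>T\<close>.
\<close>

lemma crossing_paths_meet:
  assumes T: "conn T u v" "fst u \<le> l" "r < fst v"
    and S: "conn S p q" "\<And>s. s \<in> S \<Longrightarrow> l \<le> fst s \<and> fst s \<le> r"
    and below: "\<And>t. t \<in> T \<Longrightarrow> snd p < snd t" and above: "\<And>t. t \<in> T \<Longrightarrow> snd t \<le> snd q"
  shows "S \<inter> T \<noteq> {}"
proof
  assume disj: "S \<inter> T = {}"
  obtain h where "parity_above T u v h"
    using parity_above_exists[OF T(1)] by blast
  note h = parity_aboveD[OF this]
  have right: "h x y = h (x + 1) y" if "(x, y) \<in> S" "(x + 1, y) \<in> S" for x y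
    using h(2)[of x y] that disj S(2)[OF that(1)] S(2)[OF that(2)] T(2,3) by auto
  have diag: "h x y = h (x + 1) (y - 1)" if "(x, y) \<in> S" "(x + 1, y - 1) \<in> S" for x y
    using h(3)[of x y] that disj S(2)[OF that(1)] S(2)[OF that(2)] T(2,3) by auto
  have up: "h x y = h x (y + 1)" if "(x, y) \<in> S" "(x, y + 1) \<in> S" for x y
    using h(1)[of x y] that disj by auto
  have "h (fst p) (snd p) = h (fst q) (snd q)"
    using S(1)
  proof (induction rule: conn.induct)
    case (step u' v' w')
    obtain x y x' y' where [simp]: "v' = (x, y)" "w' = (x', y')" by (cases v', cases w')
    have mem: "(x, y) \<in> S" "(x', y') \<in> S" using step conn_mem by auto
    have "(x' = x + 1 \<and> y' = y) \<or> (x = x' + 1 \<and> y = y') \<or> (x' = x \<and> y' = y + 1) \<or> (x = x' \<and> y = y' + 1)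
        \<or> (x' = x + 1 \<and> y' = y - 1) \<or> (x = x' + 1 \<and> y = y' - 1)"
      using step.hyps(2) by (auto simp: tri_adj_def)
    then have "h x y = h x' y'"
      using mem right[of x y] right[of x' y'] up[of x y] up[of x' y'] diag[of x y] diag[of x' y'] by auto
    then show ?case using step.IH by simp
  qed auto
  moreover have "h (fst p) (snd p)"
    using h(5)[of "snd p" "fst p"] below S(2)[of p] conn_mem[OF S(1)] T(2,3) by auto
  moreover have "\<not> h (fst q) (snd q)"
    using h(4)[of "snd q" "fst q"] above by auto
  ultimately show False by simp
qed

section \<open>Hexagons and alternating arms\<close>

text \<open>
  Rotation by \<open>pi/3\<close> about the origin, in lattice coordinates.
\<close>

definition rot :: "int \<times> int \<Rightarrow> int \<times> int" where
  "rot p = (- snd p, fst p + snd p)"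

text \<open>
  The sides of the hexagonal sphere of radius \<open>N\<close>, each including its two corners. The index is counted
  modulo 6 (\<open>side_mod\<close>), and the definition by rotation makes the symmetry between the sides immediate.
\<close>

definition side :: "nat \<Rightarrow> int \<Rightarrow> (int \<times> int) set" where
  "side i N = (rot ^^ i) ` {p. fst p = N \<and> - N \<le> snd p \<and> snd p \<le> 0}"

lemma tri_adj_rot: "tri_adj p q \<Longrightarrow> tri_adj (rot p) (rot q)"
proof -
  let ?H = "{(1, 0), (-1, 0), (0, 1), (0, -1), (1, -1), (-1, 1)} :: (int \<times> int) set"
  have "(- b, a + b) \<in> ?H" if "(a, b) \<in> ?H" for a b
    using that by auto
  from this[of "fst q - fst p" "snd q - snd p"] show "tri_adj p q \<Longrightarrow> tri_adj (rot p) (rot q)"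
    by (simp add: tri_adj_def rot_def algebra_simps)
qed

lemma hex_norm_rot [simp]: "hex_norm (rot p) = hex_norm p"
proof -
  have "\<bar>- snd p + (fst p + snd p)\<bar> = \<bar>fst p\<bar>" by simp
  then show ?thesis unfolding hex_norm_def rot_def fst_conv snd_conv abs_minus_cancel
    by (simp only: max.commute max.left_commute)
qed

lemma rot_rot_6: "rot (rot (rot (rot (rot (rot p))))) = p"
  by (simp add: rot_def)

lemma inj_rot: "inj rot"
  by (rule inj_on_inverseI[of _ "\<lambda>p. rot (rot (rot (rot (rot p))))"]) (rule rot_rot_6)

lemma rot_pow_6: "rot ^^ 6 = id"
  by (rule ext) (simp add: eval_nat_numeral rot_rot_6)

lemma rot_pow_6_mult: "rot ^^ (6 * i + j) = rot ^^ j"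
proof (induction i)
  case (Suc i)
  have "rot ^^ (6 * Suc i + j) = rot ^^ 6 \<circ> rot ^^ (6 * i + j)"
    by (simp add: add.assoc flip: funpow_add)
  then show ?case by (simp add: Suc.IH rot_pow_6)
qed simp

lemma tri_adj_rot_pow: "tri_adj p q \<Longrightarrow> tri_adj ((rot ^^ i) p) ((rot ^^ i) q)"
  by (induction i) (simp_all add: tri_adj_rot)

lemma hex_norm_rot_pow [simp]: "hex_norm ((rot ^^ i) p) = hex_norm p"
  by (induction i) simp_all

lemma inj_rot_pow: "inj (rot ^^ i)"
  using inj_rot by (rule inj_fn)

lemma rot_image_side: "(rot ^^ i) ` side j N = side (i + j) N"
  by (simp add: side_def image_image funpow_add)

lemma side_mod: "side (6 * i + j) N = side j N"
  by (simp add: side_def rot_pow_6_mult)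

lemma side_iff:
  "p \<in> side 0 N \<longleftrightarrow> fst p = N \<and> - N \<le> snd p \<and> snd p \<le> 0"
  "p \<in> side 1 N \<longleftrightarrow> fst p + snd p = N \<and> 0 \<le> fst p \<and> fst p \<le> N"
  "p \<in> side 2 N \<longleftrightarrow> snd p = N \<and> - N \<le> fst p \<and> fst p \<le> 0"
  "p \<in> side 3 N \<longleftrightarrow> fst p = - N \<and> 0 \<le> snd p \<and> snd p \<le> N"
  "p \<in> side 4 N \<longleftrightarrow> fst p + snd p = - N \<and> - N \<le> fst p \<and> fst p \<le> 0"
  "p \<in> side 5 N \<longleftrightarrow> snd p = - N \<and> 0 \<le> fst p \<and> fst p \<le> N"
proof -
  have im: "p \<in> rot ` A \<longleftrightarrow> (fst p + snd p, - fst p) \<in> A" for p A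
    by (auto simp: rot_def image_iff) (force intro: bexI[rotated])
  have S: "side (Suc i) N = rot ` side i N" for i
    by (simp add: side_def image_image)
  show 0: "p \<in> side 0 N \<longleftrightarrow> fst p = N \<and> - N \<le> snd p \<and> snd p \<le> 0" for p
    by (simp add: side_def)
  show 1: "p \<in> side 1 N \<longleftrightarrow> fst p + snd p = N \<and> 0 \<le> fst p \<and> fst p \<le> N" for p
    using S[of 0] by (simp only: One_nat_def im 0) (simp, arith)
  show 2: "p \<in> side 2 N \<longleftrightarrow> snd p = N \<and> - N \<le> fst p \<and> fst p \<le> 0" for p
  proof -
    have "side 2 N = rot ` side 1 N" using S[of 1] by (simp add: numeral_2_eq_2)
    then show ?thesis by (simp only: im 1) (simp, arith)
  qed
  show 3: "p \<in> side 3 N \<longleftrightarrow> fst p = - N \<and> 0 \<le> snd p \<and> snd p \<le> N" for p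
    using S[of 2] by (auto simp: im 2)
  show 4: "p \<in> side 4 N \<longleftrightarrow> fst p + snd p = - N \<and> - N \<le> fst p \<and> fst p \<le> 0" for p
    using S[of 3] by (auto simp: im 3)
  show "p \<in> side 5 N \<longleftrightarrow> snd p = - N \<and> 0 \<le> fst p \<and> fst p \<le> N"
    using S[of 4] by (auto simp: im 4)
qed

lemma side_hex_norm: "0 \<le> N \<Longrightarrow> p \<in> side i N \<Longrightarrow> hex_norm p = N"
proof -
  have "hex_norm p = N" if "0 \<le> N" "fst p = N" "- N \<le> snd p" "snd p \<le> 0" for p
    using that hex_norm_ge(1)[of p] by (intro antisym) (auto simp: hex_norm_le_iff)
  then show "0 \<le> N \<Longrightarrow> p \<in> side i N \<Longrightarrow> hex_norm p = N"
    by (auto simp: side_def)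
qed

lemma side_cover:
  assumes "hex_norm p = N"
  shows "\<exists>i<6. p \<in> side i N"
proof -
  have b: "\<bar>fst p\<bar> \<le> N" "\<bar>snd p\<bar> \<le> N" "\<bar>fst p + snd p\<bar> \<le> N"
    using hex_norm_ge[of p] assms by auto
  have "\<bar>fst p\<bar> = N \<or> \<bar>snd p\<bar> = N \<or> \<bar>fst p + snd p\<bar> = N"
    using assms by (auto simp: hex_norm_def max_def split: if_splits)
  then consider "fst p = N" | "fst p + snd p = N" | "snd p = N" | "fst p = - N" | "fst p + snd p = - N" | "snd p = - N"
    by linarith
  then have "p \<in> side 0 N \<or> p \<in> side 1 N \<or> p \<in> side 2 N \<or> p \<in> side 3 N \<or> p \<in> side 4 N \<or> p \<in> side 5 N"
    unfolding side_iff using b by cases (simp_all del: One_nat_def)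
  then show ?thesis
    by (elim disjE) (rule exI, erule conjI[rotated], simp)+
qed

lemma hex_norm_step_inward:
  assumes "hex_norm p = k + 1" "0 \<le> k"
  obtains q where "tri_adj p q" "hex_norm q = k"
proof -
  have base: "\<exists>q. tri_adj r q \<and> hex_norm q = k" if r: "r \<in> side 0 (k + 1)" for r
  proof -
    define q where "q = (if snd r = - (k + 1) then (k, - k) else (k, snd r))"
    have "tri_adj r q"
      using r by (auto simp: side_iff tri_adj_def q_def)
    moreover have "hex_norm q \<le> k"
      using r assms(2) by (auto simp: hex_norm_le_iff side_iff q_def)
    moreover have "k \<le> hex_norm q"
      using hex_norm_ge(1)[of q] assms(2) by (auto simp: q_def)
    ultimately show ?thesis by (intro exI[of _ q] conjI antisym)
  qed
  obtain i where "p \<in> side i (k + 1)"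
    using side_cover[OF assms(1)] by auto
  then obtain r where r: "r \<in> side 0 (k + 1)" "p = (rot ^^ i) r"
    by (auto simp: side_def)
  obtain q where "tri_adj r q" "hex_norm q = k" using base[OF r(1)] by auto
  then show thesis using that[of "(rot ^^ i) q"] r(2) tri_adj_rot_pow by auto
qed

lemma hex_ball_conn_0:
  assumes "hex_norm p \<le> m"
  shows "conn (hex_ball m) p 0"
proof -
  have "conn (hex_ball m) p 0" if "hex_norm p = int k" "int k \<le> m" for k p
    using that
  proof (induction k arbitrary: p)
    case 0
    then have "p = 0" using hex_norm_ge(1,2)[of p] by (intro prod_eqI) auto
    then show ?case using 0 by (auto simp: hex_ball_def intro: conn.refl)
  next
    case (Suc k)
    obtain q where q: "tri_adj p q" "hex_norm q = int k"
      using hex_norm_step_inward[of p "int k"] Suc.prems by auto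
    have "conn (hex_ball m) p q"
      using q Suc.prems by (intro conn_tri_adj) (auto simp: hex_ball_def)
    then show ?case using Suc.IH[of q] q Suc.prems conn_trans by auto
  qed
  from this[of p "nat (hex_norm p)"] show ?thesis using assms by simp
qed

text \<open>
  Both paths are prolonged outside the hexagon, to make them cross a rectangle: \<open>T\<close> horizontally to the
  right of its end on side 1, and \<open>S\<close> from its start on side 0 by one step to the right and then straight
  down, and by one step up from its end on side 2. The prolongations create no new intersection, except
  at the common corner of sides 0 and 1, and there the paths themselves meet.
\<close>

lemma hexagon_crossing_0:
  assumes S: "conn S p q" "S \<subseteq> hex_ball N" "p \<in> side 0 N" "q \<in> side 2 N"
    and T: "conn T u v" "T \<subseteq> hex_ball N" "u \<in> side 3 N" "v \<in> side 1 N"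
    and N: "0 < N"
  shows "S \<inter> T \<noteq> {}"
proof
  assume disj: "S \<inter> T = {}"
  define ray where "ray = {(x, snd v) | x. fst v \<le> x \<and> x \<le> N + 2}"
  define col where "col = {(N + 1, y) | y. - N - 1 \<le> y \<and> y \<le> snd p}"
  define T' S' where "T' = T \<union> ray" and "S' = insert (fst q, N + 1) (S \<union> col)"
  have pq: "fst p = N" "- N \<le> snd p" "snd p \<le> 0" "snd q = N" "- N \<le> fst q" "fst q \<le> 0"
    using S(3,4) by (auto simp: side_iff)
  have uv: "fst u = - N" "fst v + snd v = N" "0 \<le> fst v" "fst v \<le> N"
    using T(3,4) side_iff(2)[of v N] side_iff(4)[of u N] by (simp_all del: One_nat_def)
  have box: "\<bar>fst s\<bar> \<le> N \<and> \<bar>snd s\<bar> \<le> N \<and> \<bar>fst s + snd s\<bar> \<le> N" if "s \<in> S \<union> T" for s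
    using that S(2) T(2) by (auto simp: hex_ball_def hex_norm_le_iff)
  have ray: "conn ray v (fst v + int k, snd v)" if "fst v + int k \<le> N + 2" for k
    using that
  proof (induction k)
    case 0
    then have "v \<in> ray" by (cases v) (simp add: ray_def)
    then show ?case by (simp add: conn.refl)
  next
    case (Suc k)
    show ?case
      by (rule conn.step[OF Suc.IH]) (use Suc.prems in \<open>auto simp: tri_adj_def ray_def\<close>)
  qed
  have "conn T' u v" using T(1) conn_mono[of T u v T'] by (auto simp: T'_def)
  moreover have "conn T' v (N + 2, snd v)"
    using conn_mono[OF ray[of "nat (N + 2 - fst v)"], of T'] uv by (auto simp: T'_def)
  ultimately have T': "conn T' u (N + 2, snd v)" by (rule conn_trans)
  have col: "conn col (N + 1, snd p) (N + 1, snd p - int k)" if "int k \<le> snd p + N + 1" for k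
    using that
  proof (induction k)
    case 0
    then show ?case by (auto intro!: conn.refl simp: col_def)
  next
    case (Suc k)
    show ?case
      by (rule conn.step[OF Suc.IH]) (use Suc.prems in \<open>auto simp: tri_adj_def col_def\<close>)
  qed
  have "conn S' (N + 1, snd p) (N + 1, - N - 1)"
    using conn_mono[OF col[of "nat (snd p + N + 1)"], of S'] pq by (auto simp: S'_def)
  then have "conn S' (N + 1, - N - 1) (N + 1, snd p)" by (rule conn_sym)
  moreover have "conn S' (N + 1, snd p) p"
    using conn_mem[OF S(1)] pq by (intro conn_tri_adj) (auto simp: S'_def col_def tri_adj_def)
  moreover have "conn S' p q"
    using conn_mono[OF S(1), of S'] by (auto simp: S'_def)
  moreover have "conn S' q (fst q, N + 1)"
    using conn_mem[OF S(1)] pq by (intro conn_tri_adj) (auto simp: S'_def tri_adj_def)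
  ultimately have S': "conn S' (N + 1, - N - 1) (fst q, N + 1)" by (blast intro: conn_trans)
  have "S' \<inter> T' \<noteq> {}"
  proof (rule crossing_paths_meet[OF T' _ _ S'])
    show "fst u \<le> - N" using uv by simp
    show "N + 1 < fst (N + 2, snd v)" by simp
    show "- N \<le> fst s \<and> fst s \<le> N + 1" if "s \<in> S'" for s
      using that box[of s] pq N by (auto simp: S'_def col_def abs_le_iff)
    show "snd (N + 1, - N - 1) < snd t" if "t \<in> T'" for t
      using that box[of t] uv N by (auto simp: T'_def ray_def abs_le_iff)
    show "snd t \<le> snd (fst q, N + 1)" if "t \<in> T'" for t
      using that box[of t] uv N by (auto simp: T'_def ray_def abs_le_iff)
  qed
  then obtain s where s: "s \<in> S'" "s \<in> T'" by auto
  have vp: "v \<noteq> p" using disj conn_mem[OF S(1)] conn_mem[OF T(1)] by auto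
  have sS: "s \<in> S \<or> (fst s = N + 1 \<and> snd s \<le> snd p) \<or> (snd s = N + 1)"
    using s(1) by (auto simp: S'_def col_def)
  have sT: "s \<in> T \<or> (fst v \<le> fst s \<and> snd s = snd v)"
    using s(2) by (auto simp: T'_def ray_def)
  show False
  proof (cases "s \<in> T")
    case True
    then have "s \<notin> S" using disj by auto
    then show False using sS box[of s] True by auto
  next
    case False
    then have sv: "fst v \<le> fst s" "snd s = snd v" using sT by auto
    show False
    proof (cases "s \<in> S")
      case True
      then have "fst s = fst v" using box[of s] sv uv by auto
      then have "s = v" using sv by (auto intro: prod_eqI)
      then show False using True conn_mem[OF T(1)] disj by auto
    next
      case False
      have "snd v \<le> snd p" using False sS sv uv by auto
      then have "snd v = 0" "snd p = 0" using uv pq by auto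
      then have "v = p" using uv pq by (auto intro: prod_eqI)
      then show False using vp by simp
    qed
  qed
qed

text \<open>
  Reduction to \<open>i = 0\<close> by the rotation through \<open>5 * i\<close> steps, the inverse of the one through \<open>i\<close> steps.
\<close>

lemma hexagon_crossing:
  assumes S: "conn S p q" "S \<subseteq> hex_ball N" "p \<in> side i N" "q \<in> side (i + 2) N"
    and T: "conn T u v" "T \<subseteq> hex_ball N" "u \<in> side (i + 3) N" "v \<in> side (i + 1) N"
    and N: "0 < N"
  shows "S \<inter> T \<noteq> {}"
proof -
  define \<psi> where "\<psi> = rot ^^ (5 * i)"
  have side: "\<psi> r \<in> side j N" if "r \<in> side (i + j) N" for r j
  proof -
    have "\<psi> r \<in> side (5 * i + (i + j)) N"
      unfolding rot_image_side[of _ "i + j", symmetric] \<psi>_def using that by (rule imageI)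
    then show ?thesis using side_mod[of i j N] by (simp add: algebra_simps)
  qed
  have "\<psi> ` S \<inter> \<psi> ` T \<noteq> {}"
  proof (rule hexagon_crossing_0[OF _ _ _ _ _ _ _ _ N])
    show "conn (\<psi> ` S) (\<psi> p) (\<psi> q)" "conn (\<psi> ` T) (\<psi> u) (\<psi> v)"
      using conn_image[OF S(1), of \<psi>] conn_image[OF T(1), of \<psi>] tri_adj_rot_pow by (auto simp: \<psi>_def)
    show "\<psi> ` S \<subseteq> hex_ball N" "\<psi> ` T \<subseteq> hex_ball N"
      using S(2) T(2) by (auto simp: \<psi>_def hex_ball_def)
    show "\<psi> p \<in> side 0 N" "\<psi> q \<in> side 2 N" "\<psi> u \<in> side 3 N" "\<psi> v \<in> side 1 N"
      using side[of p 0] side[of q 2] side[of u 3] side[of v 1] S T by auto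
  qed
  moreover have "inj \<psi>" unfolding \<psi>_def by (rule inj_rot_pow)
  ultimately show ?thesis by (simp flip: image_Int)
qed

definition arm :: "nat \<Rightarrow> int \<Rightarrow> int \<Rightarrow> (int \<times> int) set \<Rightarrow> bool" where
  "arm i m N \<omega> \<longleftrightarrow> (\<exists>u v. hex_norm u = m + 1 \<and> v \<in> side i N \<and> conn (\<omega> \<inter> annulus m N) u v)"

definition six_arms :: "int \<Rightarrow> int \<Rightarrow> (int \<times> int) set \<Rightarrow> bool" where
  "six_arms m N \<omega> \<longleftrightarrow> (\<forall>i\<in>{0, 2, 4}. arm i m N \<omega>) \<and> (\<forall>i\<in>{1, 3, 5}. arm i m N (- \<omega>))"

text \<open>
  The two neighbouring closed arms, joined through the inner ball, form a path between sides
  \<open>i + 1\<close> and \<open>i + 3\<close> that an open path in the annulus cannot cross.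
\<close>

lemma six_arms_separate:
  assumes six: "six_arms m N \<omega>" and mN: "0 \<le> m" "m < N"
    and i: "i \<in> {0, 2, 4}" and v: "v \<in> side i N" "w \<in> side (i + 2) N"
  shows "\<not> conn (\<omega> \<inter> annulus m N) v w"
proof
  assume c: "conn (\<omega> \<inter> annulus m N) v w"
  define T where "T = (- \<omega> \<inter> annulus m N) \<union> hex_ball m"
  have arm: "\<exists>u v. hex_norm u = m + 1 \<and> v \<in> side (i + j) N \<and> conn (- \<omega> \<inter> annulus m N) u v" if "j \<in> {1, 3}" for j
  proof -
    have "side 7 N = side 1 N" using side_mod[of 1 1 N] by simp
    moreover have "i + j \<in> {1, 3, 5} \<or> i + j = 7" using i that by auto
    ultimately obtain k where k: "k \<in> {1, 3, 5}" "side (i + j) N = side k N"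
      by (metis insertI1)
    have "arm k m N (- \<omega>)" using six k(1) unfolding six_arms_def by blast
    then show ?thesis unfolding k(2) arm_def .
  qed
  have to0: "\<exists>v\<in>side (i + j) N. conn T 0 v" if j: "j \<in> {1, 3}" for j
  proof -
    obtain u v where uv: "hex_norm u = m + 1" "v \<in> side (i + j) N" "conn (- \<omega> \<inter> annulus m N) u v"
      using arm[OF j] by auto
    obtain q where q: "tri_adj u q" "hex_norm q = m"
      using hex_norm_step_inward[OF uv(1) mN(1)] by auto
    have "conn T 0 q"
      using conn_mono[OF hex_ball_conn_0[of q m], of T] q by (auto simp: T_def intro: conn_sym)
    moreover have "conn T q u"
      using q uv conn_mem[OF uv(3)] by (intro conn_tri_adj tri_adj_sym[OF q(1)]) (auto simp: T_def hex_ball_def)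
    moreover have "conn T u v"
      using conn_mono[OF uv(3), of T] by (auto simp: T_def)
    ultimately show ?thesis using uv(2) by (blast intro: conn_trans)
  qed
  obtain a b where ab: "a \<in> side (i + 3) N" "b \<in> side (i + 1) N" "conn T 0 a" "conn T 0 b"
    using to0[of 1] to0[of 3] by auto
  have "conn T a b" using ab conn_sym conn_trans by blast
  moreover have "T \<subseteq> hex_ball N" "\<omega> \<inter> annulus m N \<subseteq> hex_ball N"
    using mN by (auto simp: T_def hex_ball_def annulus_def)
  ultimately have "(\<omega> \<inter> annulus m N) \<inter> T \<noteq> {}"
    using hexagon_crossing[OF c _ v, of T a b] ab mN by auto
  then show False by (auto simp: T_def annulus_def hex_ball_def)
qed

section \<open>Counting trifurcations\<close>

text \<open>
  The combinatorial core of the Burton--Keane argument. Each \<open>D i\<close> is split into two nonempty classes,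
  \<open>X i\<close> and the rest, and two sets are disjoint or one lies within one class of the other, as for the branches of a
  tree. A set \<open>D i\<close> of least size contains none of the others in a class, so a point of \<open>X i\<close> can be
  discarded together with the index \<open>i\<close> while all other classes stay nonempty.
\<close>

lemma laminar_card_le:
  assumes "finite I" "finite L"
    and "\<And>i. i \<in> I \<Longrightarrow> D i \<subseteq> L" "\<And>i. i \<in> I \<Longrightarrow> X i \<subseteq> D i"
    and "\<And>i. i \<in> I \<Longrightarrow> X i \<noteq> {}" "\<And>i. i \<in> I \<Longrightarrow> D i - X i \<noteq> {}"
    and "\<And>i j. i \<in> I \<Longrightarrow> j \<in> I \<Longrightarrow> i \<noteq> j \<Longrightarrow> D i \<inter> D j = {} \<or> D i \<subseteq> X j \<or> D i \<subseteq> D j - X j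
           \<or> D j \<subseteq> X i \<or> D j \<subseteq> D i - X i"
  shows "card I \<le> card L"
  using assms
proof (induction "card I" arbitrary: I L D X)
  case 0
  then show ?case by simp
next
  case (Suc n)
  note fin = Suc.prems(1,2) and DL = Suc.prems(3) and XD = Suc.prems(4)
    and ne = Suc.prems(5,6) and lam = Suc.prems(7)
  have "I \<noteq> {}" using Suc.hyps(2) by auto
  then obtain i where i: "i \<in> I" and min: "\<And>j. j \<in> I \<Longrightarrow> card (D i) \<le> card (D j)"
    using ex_min_if_finite[of "(\<lambda>i. card (D i)) ` I"] fin(1)
    by (metis arg_min_if_finite(1) arg_min_least)
  obtain l where l: "l \<in> X i" using ne(1)[OF i] by auto
  obtain l' where l': "l' \<in> D i" "l' \<notin> X i" using ne(2)[OF i] by auto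
  have ll': "l \<noteq> l'" and lD: "l \<in> D i" "l \<in> L" using l l' XD[OF i] DL[OF i] by auto
  have finD: "finite (D i)" using DL[OF i] fin(2) finite_subset by blast
  \<comment> \<open>By minimality no other set fits into a proper part of \<open>D i\<close>.\<close>
  have lam_i: "D i \<inter> D j = {} \<or> D i \<subseteq> X j \<or> D i \<subseteq> D j - X j" if j: "j \<in> I" "j \<noteq> i" for j
  proof -
    have "\<not> D j \<subseteq> X i"
      using min[OF j(1)] l' XD[OF i] psubset_card_mono[OF finD, of "D j"] by auto
    moreover have "\<not> D j \<subseteq> D i - X i"
      using min[OF j(1)] l XD[OF i] psubset_card_mono[OF finD, of "D j"] by auto
    ultimately show ?thesis using lam[OF i j(1)] j(2) by blast
  qed
  have "card (I - {i}) \<le> card (L - {l})"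
  proof (rule Suc.hyps(1)[of "I - {i}" "L - {l}" "\<lambda>j. D j - {l}" "\<lambda>j. X j - {l}"])
    show "n = card (I - {i})" using Suc.hyps(2) i fin by simp
    show "finite (I - {i})" "finite (L - {l})" using fin by auto
    fix j assume "j \<in> I - {i}"
    then have j: "j \<in> I" "j \<noteq> i" by auto
    show "D j - {l} \<subseteq> L - {l}" "X j - {l} \<subseteq> D j - {l}" using DL[OF j(1)] XD[OF j(1)] by auto
    show "X j - {l} \<noteq> {}"
    proof (cases "l \<in> X j")
      case True
      then have "D i \<subseteq> X j" using lam_i[OF j] lD XD[OF j(1)] by blast
      then show ?thesis using l' ll' by auto
    next
      case False
      then show ?thesis using ne(1)[OF j(1)] by auto
    qed
    show "D j - {l} - (X j - {l}) \<noteq> {}"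
    proof (cases "l \<in> D j - X j")
      case True
      then have "D i \<subseteq> D j - X j" using lam_i[OF j] lD by blast
      then show ?thesis using l' ll' by auto
    next
      case False
      then show ?thesis using ne(2)[OF j(1)] by auto
    qed
  next
    fix j k assume "j \<in> I - {i}" "k \<in> I - {i}" "j \<noteq> k"
    then show "(D j - {l}) \<inter> (D k - {l}) = {} \<or> D j - {l} \<subseteq> X k - {l} \<or> D j - {l} \<subseteq> D k - {l} - (X k - {l})
           \<or> D k - {l} \<subseteq> X j - {l} \<or> D k - {l} \<subseteq> D j - {l} - (X j - {l})"
      using lam[of j k] by blast
  qed
  then show ?case
    using Suc.hyps(2) i lD fin by (simp add: card_Diff_singleton) (metis Suc_le_mono Suc_pred card_gt_0_iff empty_iff)
qed

lemma conn_avoids_or_hits: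
  assumes "conn S x w" "x \<notin> B"
  shows "conn (S - B) x w \<or> (\<exists>q\<in>B. conn S x q)"
  using assms
proof (induction rule: conn.induct)
  case (refl u)
  then show ?case by (simp add: conn.refl)
next
  case (step u v w)
  show ?case
  proof (cases "w \<in> B")
    case True
    then show ?thesis using conn.step[OF step.hyps] by blast
  next
    case False
    then show ?thesis using step.IH[OF step.prems] conn.step[of "S - B" u v w] step.hyps by blast
  qed
qed

text \<open>
  The block \<open>B\<close> is an open connected set, and removing it from \<open>G\<close> leaves three points of \<open>L\<close> in different
  components that were all joined to \<open>B\<close>.
\<close>

definition trifurcation :: "(int \<times> int) set \<Rightarrow> (int \<times> int) set \<Rightarrow> (int \<times> int) set \<Rightarrow> bool" where
  "trifurcation G L B \<longleftrightarrow> B \<subseteq> G \<and> (\<forall>p\<in>B. \<forall>q\<in>B. conn B p q) \<and>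
     (\<exists>a b c. {a, b, c} \<subseteq> L \<and> (\<forall>x\<in>{a, b, c}. \<exists>p\<in>B. conn G x p) \<and>
        \<not> conn (G - B) a b \<and> \<not> conn (G - B) b c \<and> \<not> conn (G - B) c a)"

text \<open>
  In each component of \<open>G\<close> choose a root among its leaves (the points of \<open>L\<close>), and let \<open>D i\<close> be the set of
  leaves that the block \<open>B i\<close> separates from the root. The root lies in at most one of the three branches,
  so \<open>D i\<close> contains leaves of two of them. Seen from another block \<open>B j\<close>, everything beyond \<open>B i\<close> hangs together
  through \<open>B i\<close>; this makes the family laminar, so that \<open>laminar_card_le\<close> applies.
\<close>

lemma trifurcation_card_le:
  assumes "finite I" "finite L"
    and tri: "\<And>i. i \<in> I \<Longrightarrow> trifurcation G L (B i)"
    and disj: "\<And>i j. i \<in> I \<Longrightarrow> j \<in> I \<Longrightarrow> i \<noteq> j \<Longrightarrow> B i \<inter> B j = {}"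
    and BL: "\<And>i. i \<in> I \<Longrightarrow> B i \<inter> L = {}"
  shows "card I \<le> card L"
proof -
  define K where "K i = {x \<in> L. \<exists>p\<in>B i. conn G x p}" for i
  define r where "r i = (SOME x. x \<in> K i)" for i
  define D where "D i = {x \<in> K i. \<not> conn (G - B i) x (r i)}" for i
  have BG: "B i \<subseteq> G" and Bconn: "\<And>p q. p \<in> B i \<Longrightarrow> q \<in> B i \<Longrightarrow> conn (B i) p q" if "i \<in> I" for i
    using tri[OF that] by (auto simp: trifurcation_def)
  have ex: "\<exists>d e. d \<in> D i \<and> e \<in> D i \<and> \<not> conn (G - B i) e d" if i: "i \<in> I" for i
  proof -
    obtain a b c where abc: "{a, b, c} \<subseteq> L" "\<forall>x\<in>{a, b, c}. \<exists>p\<in>B i. conn G x p"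
        "\<not> conn (G - B i) a b" "\<not> conn (G - B i) b c" "\<not> conn (G - B i) c a"
      using tri[OF i] unfolding trifurcation_def by (elim conjE exE) (rule that)
    have K: "a \<in> K i" "b \<in> K i" "c \<in> K i"
      using abc(1,2) by (simp_all add: K_def)
    have "\<not> (conn (G - B i) a (r i) \<and> conn (G - B i) b (r i))"
        "\<not> (conn (G - B i) b (r i) \<and> conn (G - B i) c (r i))"
        "\<not> (conn (G - B i) c (r i) \<and> conn (G - B i) a (r i))"
      using abc(3-5) conn_sym conn_trans by blast+
    then consider "a \<in> D i" "b \<in> D i" | "b \<in> D i" "c \<in> D i" | "c \<in> D i" "a \<in> D i"
      using K unfolding D_def by blast
    then show ?thesis using abc(3-5) by cases blast+
  qed
  then obtain d where d: "\<And>i. i \<in> I \<Longrightarrow> d i \<in> D i \<and> (\<exists>e. e \<in> D i \<and> \<not> conn (G - B i) e (d i))"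
    by metis
  define X where "X i = {x \<in> D i. conn (G - B i) x (d i)}" for i
  \<comment> \<open>A leaf whose paths meet \<open>B i\<close> before \<open>B j\<close> is joined to \<open>B i\<close> off \<open>B j\<close>.\<close>
  have avoid: "\<exists>p\<in>B i. conn (G - B j) x p"
    if ij: "i \<in> I" "j \<in> I" "i \<noteq> j" and x: "x \<in> L" "\<exists>p\<in>B i. conn G x p"
      and no: "\<not> (\<exists>q\<in>B j. conn (G - B i) x q)" for i j x
  proof -
    have xB: "x \<notin> B i" "x \<notin> B j" using x(1) BL[OF ij(1)] BL[OF ij(2)] by auto
    obtain p where p: "p \<in> B i" "conn G x p" using x(2) by auto
    obtain w w' where w: "conn (G \<inter> - B i) x w" "tri_adj w w'" "w' \<in> G - - B i"
      by (rule conn_exit[OF p(2), of "- B i"]) (use xB p in auto)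
    have "conn (G - B i) x w" using w(1) by (simp add: Diff_eq)
    then have "conn (G - B i - B j) x w"
      using conn_avoids_or_hits[of "G - B i" x w "B j"] xB no by blast
    then have "conn (G - B j) x w" by (rule conn_mono) auto
    then have "conn (G - B j) x w'"
      by (rule conn.step[OF _ w(2)]) (use w(3) disj[OF ij] in auto)
    then show ?thesis using w(3) by auto
  qed
  \<comment> \<open>If the root lies on the side of \<open>B j\<close> as seen from \<open>B i\<close>, the leaves cut off by \<open>B i\<close> lie in one class of \<open>B j\<close>.\<close>
  have single_class: "D i \<inter> D j = {} \<or> D i \<subseteq> X j \<or> D i \<subseteq> D j - X j"
    if ij: "i \<in> I" "j \<in> I" "i \<noteq> j" and K: "K i = K j" and r: "\<exists>q\<in>B j. conn (G - B i) (r i) q" for i j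
  proof -
    have near: "\<exists>p\<in>B i. conn (G - B j) x p" if x: "x \<in> D i" for x
    proof -
      have "\<not> (\<exists>q\<in>B j. conn (G - B i) x q)"
      proof
        assume "\<exists>q\<in>B j. conn (G - B i) x q"
        then obtain q q' where q: "q \<in> B j" "conn (G - B i) x q" "q' \<in> B j" "conn (G - B i) (r i) q'"
          using r by auto
        have "conn (G - B i) q q'"
          using conn_mono[OF Bconn[OF ij(2) q(1,3)], of "G - B i"] BG[OF ij(2)] disj[OF ij] by blast
        then have "conn (G - B i) x (r i)" using q conn_sym conn_trans by blast
        then show False using x by (simp add: D_def)
      qed
      then show ?thesis using avoid[OF ij] x by (simp add: D_def K_def)
    qed
    have same: "conn (G - B j) x y" if xy: "x \<in> D i" "y \<in> D i" for x y
    proof -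
      obtain p q where p: "p \<in> B i" "conn (G - B j) x p" "q \<in> B i" "conn (G - B j) y q"
        using near[OF xy(1)] near[OF xy(2)] by auto
      have "conn (G - B j) p q"
        using conn_mono[OF Bconn[OF ij(1) p(1,3)], of "G - B j"] BG[OF ij(1)] disj[OF ij] by blast
      then show ?thesis using p conn_sym conn_trans by blast
    qed
    have "r i = r j" using K by (simp add: r_def)
    show ?thesis
    proof (cases "D i \<inter> D j = {}")
      case False
      then obtain z where z: "z \<in> D i" "z \<in> D j" by auto
      have Dj: "D i \<subseteq> D j"
      proof
        fix y assume y: "y \<in> D i"
        have "\<not> conn (G - B j) y (r j)"
        proof
          assume "conn (G - B j) y (r j)"
          then have "conn (G - B j) z (r j)" by (rule conn_trans[OF same[OF z(1) y]])
          then show False using z(2) by (simp add: D_def)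
        qed
        then show "y \<in> D j" using y K by (simp add: D_def)
      qed
      show ?thesis
      proof (cases "conn (G - B j) z (d j)")
        case True
        have "D i \<subseteq> X j"
        proof
          fix y assume y: "y \<in> D i"
          then show "y \<in> X j"
            using Dj conn_trans[OF same[OF y z(1)] True] unfolding X_def by blast
        qed
        then show ?thesis by simp
      next
        case False
        have "y \<notin> X j" if y: "y \<in> D i" for y
        proof
          assume "y \<in> X j"
          then have "conn (G - B j) y (d j)" by (simp add: X_def)
          then show False using False conn_trans[OF same[OF z(1) y]] by blast
        qed
        then show ?thesis using Dj by blast
      qed
    qed simp
  qed
  show ?thesis
  proof (rule laminar_card_le[OF assms(1,2), of D X])
    fix i assume i: "i \<in> I"
    show "D i \<subseteq> L" "X i \<subseteq> D i" by (auto simp: D_def K_def X_def)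
    have "d i \<in> D i" using d[OF i] by simp
    then have "d i \<in> G - B i"
      using BL[OF i] conn_mem unfolding D_def K_def by blast
    then have "d i \<in> X i" using \<open>d i \<in> D i\<close> by (simp add: X_def conn.refl)
    then show "X i \<noteq> {}" by auto
    show "D i - X i \<noteq> {}" using d[OF i] by (auto simp: X_def)
  next
    fix i j assume ij: "i \<in> I" "j \<in> I" "i \<noteq> j"
    show "D i \<inter> D j = {} \<or> D i \<subseteq> X j \<or> D i \<subseteq> D j - X j \<or> D j \<subseteq> X i \<or> D j \<subseteq> D i - X i"
    proof (cases "K i \<inter> K j = {}")
      case True
      then have "D i \<inter> D j = {}" by (auto simp: D_def)
      then show ?thesis by simp
    next
      case False
      then obtain x p q where x: "p \<in> B i" "q \<in> B j" "conn G x p" "conn G x q"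
        by (auto simp: K_def)
      have KK: "y \<in> K k'" if "y \<in> K k" "k \<in> I" "p \<in> B k" "q \<in> B k'" "conn G p q" for y k k' p q
      proof -
        obtain p' where p': "p' \<in> B k" "conn G y p'" "y \<in> L" using \<open>y \<in> K k\<close> by (auto simp: K_def)
        have "conn G p' p" using conn_mono[OF Bconn[OF \<open>k \<in> I\<close> p'(1) \<open>p \<in> B k\<close>] BG[OF \<open>k \<in> I\<close>]] .
        then have "conn G y q" using p'(2) \<open>conn G p q\<close> conn_trans by blast
        then show ?thesis using \<open>q \<in> B k'\<close> p'(3) by (auto simp: K_def)
      qed
      have pq: "conn G p q" "conn G q p" using x conn_sym conn_trans by blast+
      have K: "K i = K j"
        using KK[OF _ ij(1) x(1,2) pq(1)] KK[OF _ ij(2) x(2,1) pq(2)] by blast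
      then have r: "r i = r j" by (simp add: r_def)
      have "r i \<in> K i"
        using False someI_ex[of "\<lambda>x. x \<in> K i"] by (auto simp: r_def)
      then have p: "r i \<in> L" "\<exists>p\<in>B i. conn G (r i) p" by (simp_all add: K_def)
      show ?thesis
      proof (cases "\<exists>q\<in>B j. conn (G - B i) (r i) q")
        case True
        then show ?thesis using single_class[OF ij K] by blast
      next
        case False
        have "\<exists>q\<in>B i. conn (G - B j) (r j) q"
          using avoid[OF ij p(1) _ False] p(2) r by auto
        then show ?thesis using single_class[OF ij(2,1) _ K[symmetric]] ij(3) by blast
      qed
    qed
  qed
qed

section \<open>The one-arm probability tends to zero\<close>

definition crossed :: "int \<Rightarrow> int \<Rightarrow> (int \<times> int) set \<Rightarrow> bool" where
  "crossed m N \<omega> \<longleftrightarrow> (\<exists>u v. hex_norm u = m + 1 \<and> hex_norm v = N \<and> conn (\<omega> \<inter> annulus m N) u v)"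

definition arm_prob :: "int \<Rightarrow> int \<Rightarrow> real" where
  "arm_prob m N = pr (annulus m N) (crossed m N)"

lemma crossed_mono: "\<omega> \<subseteq> \<eta> \<Longrightarrow> crossed m N \<omega> \<Longrightarrow> crossed m N \<eta>"
  unfolding crossed_def using conn_mono[of "\<omega> \<inter> annulus m N" _ _ "\<eta> \<inter> annulus m N"] by blast

lemma crossed_local: "crossed m N \<omega> \<longleftrightarrow> crossed m N (\<omega> \<inter> annulus m N)"
  by (simp add: crossed_def)

lemma crossed_split:
  assumes c: "crossed m N \<omega>" and "m < k" "k < N"
  shows "crossed m k \<omega> \<and> crossed k N \<omega>"
proof -
  obtain u v where uv: "hex_norm u = m + 1" "hex_norm v = N" "conn (\<omega> \<inter> annulus m N) u v"
    using c by (auto simp: crossed_def)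
  obtain w where w: "conn (\<omega> \<inter> annulus m N \<inter> hex_ball k) u w" "hex_norm w = k"
    by (rule conn_reach[OF uv(3), of k]) (use assms uv in auto)
  have "conn (\<omega> \<inter> annulus m k) u w"
    by (rule conn_mono[OF w(1)]) (auto simp: annulus_def hex_ball_def)
  moreover obtain u' v' where u': "conn (\<omega> \<inter> annulus m N \<inter> annulus k N) u' v'" "hex_norm u' = k + 1" "hex_norm v' = N"
    by (rule conn_traverse[OF uv(3), of k N]) (use assms uv in auto)
  have "conn (\<omega> \<inter> annulus k N) u' v'"
    by (rule conn_mono[OF u'(1)]) auto
  ultimately show ?thesis
    unfolding crossed_def using uv(1) w(2) u'(2,3) by blast
qed

lemma arm_prob_submult:
  assumes "m < k" "k < N"
  shows "arm_prob m N \<le> arm_prob m k * arm_prob k N"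
proof -
  have sub: "annulus m k \<subseteq> annulus m N" "annulus k N \<subseteq> annulus m N" "annulus m k \<inter> annulus k N = {}"
    using assms by (auto simp: annulus_def)
  have "arm_prob m N \<le> pr (annulus m N) (\<lambda>\<omega>. crossed m k \<omega> \<and> crossed k N \<omega>)"
    unfolding arm_prob_def by (rule pr_mono) (rule crossed_split[OF _ assms])
  also have "\<dots> = pr (annulus m N) (crossed m k) * pr (annulus m N) (crossed k N)"
    by (rule pr_indep[OF finite_annulus sub]) (rule crossed_local)+
  also have "\<dots> = arm_prob m k * arm_prob k N"
    using pr_restrict[where A = "crossed m k", OF finite_annulus sub(1) crossed_local]
      pr_restrict[where A = "crossed k N", OF finite_annulus sub(2) crossed_local] by (simp add: arm_prob_def)
  finally show ?thesis .
qed

text \<open>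
  Concatenate annuli that are crossed with probability less than \<open>q\<close>: after \<open>j\<close> of them the one-arm
  probability is at most \<open>q ^ j\<close>.
\<close>

lemma arm_prob_dichotomy:
  assumes "0 < q" "q < 1" "\<And>m. 1 \<le> m \<Longrightarrow> \<exists>N>m. arm_prob m N < q" "0 < \<epsilon>"
  shows "\<exists>N\<ge>1. arm_prob 0 N < \<epsilon>"
proof -
  have "\<exists>N\<ge>1. arm_prob 0 N \<le> q ^ j" for j
  proof (induction j)
    case 0
    then show ?case by (intro exI[of _ 1]) (simp add: arm_prob_def pr_le_1)
  next
    case (Suc j)
    then obtain k where k: "1 \<le> k" "arm_prob 0 k \<le> q ^ j" by auto
    obtain N where N: "k < N" "arm_prob k N < q" using assms(3)[OF k(1)] by auto
    have "arm_prob 0 N \<le> arm_prob 0 k * arm_prob k N"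
      using arm_prob_submult[of 0 k N] k N by simp
    also have "\<dots> \<le> q ^ j * q"
      using k N assms(1) by (intro mult_mono) (auto simp: arm_prob_def pr_nonneg)
    finally show ?case using k N by (intro exI[of _ N]) (simp add: mult.commute)
  qed
  moreover obtain j where "q ^ j < \<epsilon>"
    using real_arch_pow_inv[OF assms(4,2)] by auto
  ultimately show ?thesis by (meson le_less_trans)
qed

lemma arm_mono: "\<omega> \<subseteq> \<eta> \<Longrightarrow> arm i m N \<omega> \<Longrightarrow> arm i m N \<eta>"
  unfolding arm_def using conn_mono[of "\<omega> \<inter> annulus m N" _ _ "\<eta> \<inter> annulus m N"] by blast

lemma arm_local: "arm i m N \<omega> \<longleftrightarrow> arm i m N (\<omega> \<inter> annulus m N)"
  by (simp add: arm_def)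

lemma arm_rot:
  assumes "arm i m N \<omega>"
  shows "arm (Suc i) m N (rot ` \<omega>)"
proof -
  obtain u v where uv: "hex_norm u = m + 1" "v \<in> side i N" "conn (\<omega> \<inter> annulus m N) u v"
    using assms by (auto simp: arm_def)
  have "conn (rot ` (\<omega> \<inter> annulus m N)) (rot u) (rot v)"
    using uv(3) tri_adj_rot by (rule conn_image)
  moreover have "rot ` (\<omega> \<inter> annulus m N) \<subseteq> rot ` \<omega> \<inter> annulus m N"
    by (auto simp: annulus_def)
  moreover have "rot v \<in> side (Suc i) N"
    using rot_image_side[of 1 i N] uv(2) by auto
  ultimately show ?thesis
    unfolding arm_def using uv(1) conn_mono by (intro exI[of _ "rot u"] exI[of _ "rot v"]) auto
qed

lemma rot_image_annulus: "rot ` annulus m N = annulus m N"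
proof
  show "rot ` annulus m N \<subseteq> annulus m N" by (auto simp: annulus_def)
  show "annulus m N \<subseteq> rot ` annulus m N"
  proof
    fix p assume "p \<in> annulus m N"
    then have "rot (rot (rot (rot (rot p)))) \<in> annulus m N" by (simp add: annulus_def)
    then show "p \<in> rot ` annulus m N" using rot_rot_6[of p] by (metis imageI)
  qed
qed

text \<open>
  Rotation by one step does not decrease the probability, and six steps return to the starting side.
\<close>

lemma pr_arm_side: "pr (annulus m N) (arm i m N) = pr (annulus m N) (arm 0 m N)"
proof -
  let ?p = "\<lambda>i. pr (annulus m N) (arm i m N)"
  \<comment> \<open>The annulus is invariant under rotation, and a rotated arm is an arm to the next side.\<close>
  have step: "?p i \<le> ?p (Suc i)" for i
  proof -
    have "?p i \<le> pr (annulus m N) (\<lambda>\<omega>. arm (Suc i) m N (rot ` \<omega>))"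
      by (rule pr_mono) (rule arm_rot)
    also have "\<dots> = pr (rot ` annulus m N) (arm (Suc i) m N)"
      using inj_rot by (intro pr_image[symmetric]) (auto intro: inj_on_subset)
    finally show ?thesis by (simp add: rot_image_annulus)
  qed
  have mono: "?p i \<le> ?p j" if "i \<le> j" for i j
    using lift_Suc_mono_le[of ?p, OF step that] .
  have "?p (6 * i) = ?p 0"
    using side_mod[of i 0 N] by (simp add: arm_def[abs_def])
  then show ?thesis using mono[of 0 i] mono[of i "6 * i"] by simp
qed

lemma pr_arm_ge:
  assumes "1 - (1 / 12) ^ 6 \<le> arm_prob m N"
  shows "1 - 1 / 12 \<le> pr (annulus m N) (arm i m N)"
proof -
  define p where "p = pr (annulus m N) (arm 0 m N)"
  have "(1 - p) ^ 6 \<le> 1 - pr (annulus m N) (\<lambda>\<omega>. \<exists>i<6. arm i m N \<omega>)"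
  proof (rule root_trick[OF finite_annulus])
    show "arm i m N \<eta>" if "\<omega> \<subseteq> \<eta>" "arm i m N \<omega>" for i \<omega> \<eta>
      using that by (rule arm_mono)
    show "pr (annulus m N) (arm i m N) = p" for i
      unfolding p_def by (rule pr_arm_side)
  qed
  also have "\<dots> \<le> 1 - arm_prob m N"
  proof -
    have "\<exists>i<6. arm i m N \<omega>" if "crossed m N \<omega>" for \<omega>
      using that side_cover unfolding crossed_def arm_def by blast
    then show ?thesis by (simp add: arm_prob_def pr_mono)
  qed
  also have "\<dots> \<le> (1 / 12) ^ 6" using assms by simp
  finally have "1 - p \<le> 1 / 12"
    using power_mono_iff[of "1 - p" "1 / 12" 6] pr_le_1[OF finite_annulus, of m N "arm 0 m N"] by (simp add: p_def)
  then show ?thesis using pr_arm_side[of m N i] by (simp add: p_def)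
qed

text \<open>
  Each of the six arms is missing with probability at most \<open>1/12\<close>. For the closed arms this uses that
  complementation preserves the uniform measure: here the density \<open>1/2\<close> is essential.
\<close>

lemma pr_six_arms_ge:
  assumes "1 - (1 / 12) ^ 6 \<le> arm_prob m N"
  shows "1 / 2 \<le> pr (annulus m N) (six_arms m N)"
proof -
  let ?V = "annulus m N"
  note op = pr_arm_ge[OF assms]
  have cl: "1 - 1 / 12 \<le> pr ?V (\<lambda>\<omega>. arm i m N (- \<omega>))" for i
  proof -
    have "arm i m N (- \<omega>) = arm i m N (?V - \<omega>)" for \<omega>
    proof -
      have "- \<omega> \<inter> ?V = (?V - \<omega>) \<inter> ?V" by auto
      then show ?thesis unfolding arm_def by (simp only:)
    qed
    then show ?thesis using op[of i] pr_compl[of ?V "arm i m N"] by simp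
  qed
  have "1 - (1 / 12 + (1 / 12 + (1 / 12 + (1 / 12 + (1 / 12 + 1 / 12))))) \<le>
    pr ?V (\<lambda>\<omega>. arm 0 m N \<omega> \<and> arm 2 m N \<omega> \<and> arm 4 m N \<omega> \<and>
      arm 1 m N (- \<omega>) \<and> arm 3 m N (- \<omega>) \<and> arm 5 m N (- \<omega>))"
    by (intro pr_Int_ge finite_annulus op cl)
  also have "\<dots> \<le> pr ?V (six_arms m N)"
    by (rule pr_mono) (simp add: six_arms_def)
  finally show ?thesis by simp
qed

definition branching :: "int \<Rightarrow> int \<Rightarrow> (int \<times> int) set \<Rightarrow> bool" where
  "branching m N \<omega> \<longleftrightarrow> six_arms m N \<omega> \<and> hex_ball m \<subseteq> \<omega>"

lemma six_arms_local: "six_arms m N \<omega> \<longleftrightarrow> six_arms m N (\<omega> \<inter> annulus m N)"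
proof -
  have "arm i m N (- \<omega>) = arm i m N (- (\<omega> \<inter> annulus m N))" for i
  proof -
    have "- \<omega> \<inter> annulus m N = - (\<omega> \<inter> annulus m N) \<inter> annulus m N" by auto
    then show ?thesis unfolding arm_def by (simp only:)
  qed
  then show ?thesis using arm_local[of _ m N \<omega>] by (simp add: six_arms_def)
qed

text \<open>
  The arms and the filling of the central ball depend on disjoint sets of cells. The bound does not
  depend on \<open>N\<close>, which is what the counting argument needs.
\<close>

lemma pr_branching_ge:
  assumes "1 - (1 / 12) ^ 6 \<le> arm_prob m N" "m < N"
  shows "1 / 2 / 2 ^ card (hex_ball m) \<le> pr (hex_ball N) (branching m N)"
proof -
  have sub: "annulus m N \<subseteq> hex_ball N" "hex_ball m \<subseteq> hex_ball N" "annulus m N \<inter> hex_ball m = {}"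
    using assms(2) by (auto simp: annulus_def hex_ball_def)
  have loc: "hex_ball m \<subseteq> \<omega> \<longleftrightarrow> hex_ball m \<subseteq> \<omega> \<inter> hex_ball m" for \<omega> by auto
  have "pr (hex_ball N) (branching m N) = pr (hex_ball N) (six_arms m N) * pr (hex_ball N) (\<lambda>\<omega>. hex_ball m \<subseteq> \<omega>)"
    unfolding branching_def by (rule pr_indep[OF finite_hex_ball sub], rule six_arms_local, rule loc)
  also have "\<dots> = pr (annulus m N) (six_arms m N) * pr (hex_ball m) (\<lambda>\<omega>. hex_ball m \<subseteq> \<omega>)"
    using pr_restrict[where A = "six_arms m N", OF finite_hex_ball sub(1) six_arms_local]
      pr_restrict[where A = "\<lambda>\<omega>. hex_ball m \<subseteq> \<omega>", OF finite_hex_ball sub(2) loc]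
    by simp
  also have "pr (hex_ball m) (\<lambda>\<omega>. hex_ball m \<subseteq> \<omega>) = 1 / 2 ^ card (hex_ball m)"
  proof -
    have "(\<Sum>\<omega>\<in>Pow (hex_ball m). of_bool (hex_ball m \<subseteq> \<omega>)) = (\<Sum>\<omega>\<in>{hex_ball m}. 1 :: real)"
      by (rule sum.mono_neutral_cong_right) auto
    then show ?thesis by (simp add: pr_def avg_def)
  qed
  finally show ?thesis
    using divide_right_mono[OF pr_six_arms_ge[OF assms(1)], of "2 ^ card (hex_ball m)"] by simp
qed

lemma pr_branching_shift:
  assumes "finite V" "(\<lambda>p. p + z) ` hex_ball N \<subseteq> V" "m < N"
  shows "pr V (\<lambda>\<omega>. branching m N ((\<lambda>p. p - z) ` \<omega>)) = pr (hex_ball N) (branching m N)"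
proof -
  have inj: "inj_on (\<lambda>p. p - z) V" by (rule inj_onI) simp
  have sub: "hex_ball N \<subseteq> (\<lambda>p. p - z) ` V"
  proof
    fix p assume "p \<in> hex_ball N"
    then have "p + z \<in> V" using assms(2) by auto
    then show "p \<in> (\<lambda>p. p - z) ` V" by (force intro: image_eqI[of _ _ "p + z"])
  qed
  have loc: "branching m N \<omega> \<longleftrightarrow> branching m N (\<omega> \<inter> hex_ball N)" for \<omega>
  proof -
    have *: "\<omega> \<inter> hex_ball N \<inter> annulus m N = \<omega> \<inter> annulus m N" "hex_ball m \<subseteq> hex_ball N"
      using assms(3) by (auto simp: annulus_def hex_ball_def)
    then show ?thesis
      using six_arms_local[of m N \<omega>] six_arms_local[of m N "\<omega> \<inter> hex_ball N"]
      by (auto simp: branching_def)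
  qed
  show ?thesis
    using pr_image[OF inj, of "branching m N"] pr_restrict[where A = "branching m N", OF _ sub loc] assms(1) by simp
qed

text \<open>
  The arms from the ball around \<open>z\<close> reach distance \<open>2 * L\<close> from \<open>z\<close>, hence leave the fixed hexagon of radius
  \<open>L\<close> about the origin. Cut at their first visit to its boundary, they end at leaves that all these balls
  share. Within the hexagon and off the ball, two leaves cannot be joined, for then the uncut arms would be.
\<close>

lemma branching_trifurcation:
  assumes br: "branching m (2 * L) ((\<lambda>p. p - z) ` \<omega>)" and m: "0 \<le> m" and L: "hex_norm z + m + 1 < L"
  shows "trifurcation (\<omega> \<inter> hex_ball L) {p. hex_norm p = L} ((\<lambda>p. p + z) ` hex_ball m)"
proof -
  define A where "A = {p. m < hex_norm (p - z) \<and> hex_norm (p - z) \<le> 2 * L}"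
  define B where "B = (\<lambda>p. p + z) ` hex_ball m"
  define S where "S = \<omega> \<inter> A"
  have mN: "m < 2 * L" using L m hex_norm_nonneg[of z] by linarith
  have Bz: "p \<in> B \<longleftrightarrow> hex_norm (p - z) \<le> m" for p
    unfolding B_def hex_ball_def by (force intro: image_eqI[of _ _ "p - z"])
  have shift: "((\<lambda>p. p - z) ` \<omega>) \<inter> annulus m (2 * L) = (\<lambda>p. p - z) ` S"
    by (auto simp: S_def A_def annulus_def)
  have unshift: "(\<lambda>p. p + z) ` (\<lambda>p. p - z) ` S = S"
    by (simp add: image_image)
  have six: "six_arms m (2 * L) ((\<lambda>p. p - z) ` \<omega>)" and full: "hex_ball m \<subseteq> (\<lambda>p. p - z) ` \<omega>"
    using br by (auto simp: branching_def)
  have tri_adj_plus: "tri_adj p q \<Longrightarrow> tri_adj (p + z) (q + z)" for p q by (simp add: tri_adj_def)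
  have B\<omega>: "B \<subseteq> \<omega>"
  proof
    fix p assume "p \<in> B"
    then have "p - z \<in> (\<lambda>p. p - z) ` \<omega>" using full Bz by (auto simp: hex_ball_def)
    then show "p \<in> \<omega>" by auto
  qed
  have hnL: "hex_norm p \<le> hex_norm (p - z) + hex_norm z" "hex_norm (p - z) \<le> hex_norm p + hex_norm z" for p
    using hex_norm_triangle[of "p - z" z] hex_norm_triangle_diff[of p z] by auto
  have BL: "B \<subseteq> hex_ball L"
  proof
    fix p assume "p \<in> B"
    then show "p \<in> hex_ball L" using Bz[of p] hnL(1)[of p] L by (simp add: hex_ball_def)
  qed
  have Bconn: "conn B p q" if "p \<in> B" "q \<in> B" for p q
  proof -
    have "conn B x z" if "x \<in> B" for x
      using conn_image[OF hex_ball_conn_0[of "x - z" m], of "\<lambda>p. p + z"] that tri_adj_plus Bz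
      by (simp add: B_def[symmetric])
    then show ?thesis using that conn_sym conn_trans by blast
  qed
  have arms: "\<exists>v w. v - z \<in> side i (2 * L) \<and> hex_norm w = L \<and> conn S v w \<and> (\<exists>p\<in>B. conn (\<omega> \<inter> hex_ball L) w p)"
    if i: "i \<in> {0, 2, 4}" for i
  proof -
    have "arm i m (2 * L) ((\<lambda>p. p - z) ` \<omega>)" using six i unfolding six_arms_def by blast
    then obtain u v where uv: "hex_norm u = m + 1" "v \<in> side i (2 * L)" "conn ((\<lambda>p. p - z) ` S) u v"
      unfolding arm_def shift by blast
    have c: "conn S (u + z) (v + z)"
      using conn_image[OF uv(3), of "\<lambda>p. p + z"] tri_adj_plus unshift by simp
    have "hex_norm v = 2 * L" using side_hex_norm[OF _ uv(2)] mN m by simp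
    then have hv: "L \<le> hex_norm (v + z)" using hex_norm_triangle_diff(1)[of "v + z" z] L m by simp
    have hu: "hex_norm (u + z) \<le> L" using hex_norm_triangle[of u z] uv(1) L by simp
    obtain w where w: "conn (S \<inter> hex_ball L) (u + z) w" "hex_norm w = L"
      by (rule conn_reach[OF c hu hv])
    obtain q where q: "tri_adj u q" "hex_norm q = m" using hex_norm_step_inward[OF uv(1) m] .
    have qB: "q + z \<in> B" using q Bz by simp
    have "conn (\<omega> \<inter> hex_ball L) (u + z) (q + z)"
      using tri_adj_plus[OF q(1)] qB B\<omega> BL conn_mem[OF w(1)] by (intro conn_tri_adj) (auto simp: S_def)
    moreover have "conn (\<omega> \<inter> hex_ball L) w (u + z)"
      using conn_mono[OF conn_sym[OF w(1)], of "\<omega> \<inter> hex_ball L"] by (auto simp: S_def)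
    ultimately have "conn (\<omega> \<inter> hex_ball L) w (q + z)" using conn_trans by blast
    moreover have "conn S (u + z) w" using conn_mono[OF w(1), of S] by auto
    then have "conn S (v + z) w" using c conn_sym conn_trans by blast
    ultimately show ?thesis using uv(2) w(2) qB
      by (intro exI[of _ "v + z"] exI[of _ w]) auto
  qed
  have sep: "\<not> conn S v v'" if "i \<in> {0, 2, 4}" "v - z \<in> side i (2 * L)" "v' - z \<in> side (i + 2) (2 * L)" for i v v'
  proof
    assume "conn S v v'"
    then have "conn ((\<lambda>p. p - z) ` S) (v - z) (v' - z)"
      using conn_image[of S v v' "\<lambda>p. p - z"] tri_adj_shift by simp
    then show False using six_arms_separate[OF six m mN that] shift by simp
  qed
  have rest: "\<omega> \<inter> hex_ball L - B \<subseteq> S"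
  proof
    fix p assume "p \<in> \<omega> \<inter> hex_ball L - B"
    then show "p \<in> S" using Bz[of p] hnL(2)[of p] L m by (simp add: S_def A_def hex_ball_def)
  qed
  have off: "\<not> conn (\<omega> \<inter> hex_ball L - B) w w'"
    if "i \<in> {0, 2, 4}" "v - z \<in> side i (2 * L)" "v' - z \<in> side (i + 2) (2 * L)" "conn S v w" "conn S v' w'" for i v v' w w'
  proof
    assume "conn (\<omega> \<inter> hex_ball L - B) w w'"
    then have "conn S w w'" using rest by (rule conn_mono)
    then have "conn S v v'" using that(4,5) conn_sym conn_trans by blast
    then show False using sep[OF that(1-3)] by simp
  qed
  obtain v0 w0 where 0: "v0 - z \<in> side 0 (2 * L)" "hex_norm w0 = L" "conn S v0 w0" "\<exists>p\<in>B. conn (\<omega> \<inter> hex_ball L) w0 p"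
    using arms[of 0] by blast
  obtain v2 w2 where 2: "v2 - z \<in> side 2 (2 * L)" "hex_norm w2 = L" "conn S v2 w2" "\<exists>p\<in>B. conn (\<omega> \<inter> hex_ball L) w2 p"
    using arms[of 2] by blast
  obtain v4 w4 where 4: "v4 - z \<in> side 4 (2 * L)" "hex_norm w4 = L" "conn S v4 w4" "\<exists>p\<in>B. conn (\<omega> \<inter> hex_ball L) w4 p"
    using arms[of 4] by blast
  have "side 6 (2 * L) = side 0 (2 * L)" using side_mod[of 1 0 "2 * L"] by simp
  then have side: "v2 - z \<in> side (0 + 2) (2 * L)" "v4 - z \<in> side (2 + 2) (2 * L)" "v0 - z \<in> side (4 + 2) (2 * L)"
    using 0(1) 2(1) 4(1) by (simp_all only: arith_simps add_0_left add_numeral_left numeral_plus_numeral)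
  have cut: "\<not> conn (\<omega> \<inter> hex_ball L - B) w0 w2" "\<not> conn (\<omega> \<inter> hex_ball L - B) w2 w4"
      "\<not> conn (\<omega> \<inter> hex_ball L - B) w4 w0"
    by (rule off[OF _ 0(1) side(1) 0(3) 2(3)], simp)
       (rule off[OF _ 2(1) side(2) 2(3) 4(3)], simp, rule off[OF _ 4(1) side(3) 4(3) 0(3)], simp)
  have leaves: "{w0, w2, w4} \<subseteq> {p. hex_norm p = L}" "\<forall>x\<in>{w0, w2, w4}. \<exists>p\<in>B. conn (\<omega> \<inter> hex_ball L) x p"
    using 0(2,4) 2(2,4) 4(2,4) by simp_all
  have "\<exists>a b c. {a, b, c} \<subseteq> {p. hex_norm p = L} \<and> (\<forall>x\<in>{a, b, c}. \<exists>p\<in>B. conn (\<omega> \<inter> hex_ball L) x p) \<and>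
      \<not> conn (\<omega> \<inter> hex_ball L - B) a b \<and> \<not> conn (\<omega> \<inter> hex_ball L - B) b c \<and> \<not> conn (\<omega> \<inter> hex_ball L - B) c a"
    by (rule exI[of _ w0], rule exI[of _ w2], rule exI[of _ w4]) (intro conjI leaves cut)
  then have "trifurcation (\<omega> \<inter> hex_ball L) {p. hex_norm p = L} B"
    using B\<omega> BL Bconn by (simp only: trifurcation_def) blast
  then show ?thesis by (simp add: B_def)
qed

lemma card_sphere_le:
  assumes "0 \<le> L"
  shows "finite {p. hex_norm p = L}" "real (card {p. hex_norm p = L}) \<le> 6 * (of_int L + 1)"
proof -
  show fin: "finite {p. hex_norm p = L}"
    by (rule finite_subset[OF _ finite_hex_ball[of L]]) (auto simp: hex_ball_def)
  have side: "finite (side i L)" "card (side i L) \<le> nat (L + 1)" for i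
  proof -
    have "side i L = (rot ^^ i) ` Pair L ` {- L..0}"
      by (auto simp: side_def image_iff)
    then show "finite (side i L)" "card (side i L) \<le> nat (L + 1)"
      using card_image_le[of "{- L..0}" "Pair L"] card_image_le[of "Pair L ` {- L..0}" "rot ^^ i"] by auto
  qed
  have "card {p. hex_norm p = L} \<le> card (\<Union>i<6. side i L)"
  proof (rule card_mono)
    show "finite (\<Union>i<6. side i L)" using side(1) by simp
    show "{p. hex_norm p = L} \<subseteq> (\<Union>i<6. side i L)"
      using side_cover[of _ L] by (simp add: subset_iff Bex_def)
  qed
  also have "\<dots> \<le> (\<Sum>i<6. card (side i L))" by (rule card_UN_le) simp
  also have "\<dots> \<le> (\<Sum>i<(6::nat). nat (L + 1))" by (rule sum_mono) (rule side(2))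
  finally have "card {p. hex_norm p = L} \<le> 6 * nat (L + 1)" by simp
  then have "real (card {p. hex_norm p = L}) \<le> real (6 * nat (L + 1))" by (rule of_nat_mono)
  then show "real (card {p. hex_norm p = L}) \<le> 6 * (of_int L + 1)" using assms by simp
qed

text \<open>
  Place \<open>k\<^sup>2\<close> disjoint balls of radius \<open>m\<close> in a hexagon of radius \<open>L\<close> proportional to \<open>k\<close>. If the crossing
  probabilities were all close to \<open>1\<close>, the expected number of trifurcations would be at least \<open>\<delta> * k\<^sup>2\<close> with
  \<open>\<delta>\<close> depending only on \<open>m\<close>, whereas it never exceeds the number of cells on the sphere, which is linear
  in \<open>k\<close>.
\<close>

lemma arm_prob_not_close_to_1:
  assumes m: "1 \<le> m"
  shows "\<exists>N>m. arm_prob m N < 1 - (1 / 12) ^ 6"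
proof (rule ccontr)
  assume "\<not> ?thesis"
  then have high: "1 - (1 / 12) ^ 6 \<le> arm_prob m N" if "m < N" for N using that by (meson not_le)
  define \<delta> :: real where "\<delta> = 1 / 2 / 2 ^ card (hex_ball m)"
  \<comment> \<open>Centres with spacing \<open>s > 2 * m\<close> have disjoint balls of radius \<open>m\<close>.\<close>
  define s where "s = 2 * m + 2"
  have \<delta>: "0 < \<delta>" by (simp add: \<delta>_def)
  have bound: "\<delta> * real k \<le> 6 * (2 * of_int s + 1)" if k: "1 \<le> k" for k :: nat
  proof -
    define L where "L = 2 * s * int k"
    define z where "z = (\<lambda>(a, b). (s * int a, s * int b))"
    define I where "I = {..<k} \<times> {..<k}"
    \<comment> \<open>\<open>3 * L\<close> leaves room for the arms of length \<open>2 * L\<close> around every centre.\<close>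
    define V where "V = hex_ball (3 * L)"
    define T where "T i \<omega> \<longleftrightarrow> branching m (2 * L) ((\<lambda>p. p - z i) ` \<omega>)" for i \<omega>
    have sk: "2 * s * (int k - 1) + 2 * s = L" by (simp add: L_def algebra_simps)
    have zL: "hex_norm (z i) + m + 1 < L" if iI: "i \<in> I" for i
    proof -
      obtain a b where ab: "i = (a, b)" "a < k" "b < k" using iI by (cases i) (auto simp: I_def)
      have "s * int a \<le> s * (int k - 1)" "s * int b \<le> s * (int k - 1)"
        using ab m by (intro mult_left_mono; simp add: s_def)+
      moreover have "0 \<le> s * int a" "0 \<le> s * int b" using m by (simp_all add: s_def)
      ultimately have "hex_norm (z i) \<le> 2 * s * (int k - 1)"
        by (simp add: hex_norm_le_iff z_def ab)
      then show ?thesis using sk m by (simp add: s_def)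
    qed
    have "hex_norm (z (0, 0)) + m + 1 < L" using k by (intro zL) (simp add: I_def)
    then have L: "m < L" "0 \<le> L" using m hex_norm_nonneg[of "z (0, 0)"] by linarith+
    have apart: "(\<lambda>p. p + z i) ` hex_ball m \<inter> (\<lambda>p. p + z j) ` hex_ball m = {}" if "i \<noteq> j" for i j
    proof (rule ccontr)
      assume "\<not> ?thesis"
      then obtain x p q where "x = p + z i" "x = q + z j" "p \<in> hex_ball m" "q \<in> hex_ball m" by blast
      then have pq: "hex_norm p \<le> m" "hex_norm q \<le> m" "p + z i = q + z j"
        by (simp_all add: hex_ball_def)
      have "z i - z j = q - p" using pq(3) by (simp add: algebra_simps)
      then have "hex_norm (z i - z j) \<le> 2 * m" using hex_norm_triangle_diff(1)[of q p] pq by simp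
      then have "\<bar>fst (z i) - fst (z j)\<bar> < s" "\<bar>snd (z i) - snd (z j)\<bar> < s"
        using hex_norm_ge(1,2)[of "z i - z j"] by (simp_all add: s_def)
      then have "\<bar>s * (int (fst i) - int (fst j))\<bar> < s" "\<bar>s * (int (snd i) - int (snd j))\<bar> < s"
        by (simp_all add: z_def case_prod_beta right_diff_distrib)
      moreover have "0 < s" using m by (simp add: s_def)
      ultimately have "\<bar>int (fst i) - int (fst j)\<bar> < 1" "\<bar>int (snd i) - int (snd j)\<bar> < 1"
        by (simp_all add: abs_mult)
      then show False using that by (simp add: prod_eq_iff)
    qed
    have few: "(\<Sum>i\<in>I. of_bool (T i \<omega>)) \<le> 6 * (of_int L + 1 :: real)" for \<omega>
    proof -
      have "card {i \<in> I. T i \<omega>} \<le> card {p. hex_norm p = L}"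
      proof (rule trifurcation_card_le[where B = "\<lambda>i. (\<lambda>p. p + z i) ` hex_ball m" and G = "\<omega> \<inter> hex_ball L"])
        show "finite {i \<in> I. T i \<omega>}" by (simp add: I_def)
        show "finite {p. hex_norm p = L}" by (rule card_sphere_le[OF L(2)])
        show "(\<lambda>p. p + z i) ` hex_ball m \<inter> {p. hex_norm p = L} = {}" if "i \<in> {i \<in> I. T i \<omega>}" for i
        proof -
          have "hex_norm (p + z i) \<noteq> L" if "hex_norm p \<le> m" for p
            using that hex_norm_triangle[of p "z i"] zL[of i] \<open>i \<in> {i \<in> I. T i \<omega>}\<close> by simp
          then show ?thesis unfolding hex_ball_def by blast
        qed
        show "trifurcation (\<omega> \<inter> hex_ball L) {p. hex_norm p = L} ((\<lambda>p. p + z i) ` hex_ball m)" if "i \<in> {i \<in> I. T i \<omega>}" for i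
          using branching_trifurcation[of m L "z i" \<omega>] zL[of i] that m by (simp add: T_def)
      qed (rule apart)
      moreover have "(\<Sum>i\<in>I. of_bool (T i \<omega>)) = real (card {i \<in> I. T i \<omega>})"
        by (simp add: I_def of_bool_def sum.If_cases Int_def)
      ultimately show ?thesis using card_sphere_le(2)[OF L(2)] by linarith
    qed
    have "\<delta> \<le> pr V (T i)" if "i \<in> I" for i
    proof -
      have "(\<lambda>p. p + z i) ` hex_ball (2 * L) \<subseteq> V"
      proof
        fix p assume "p \<in> (\<lambda>p. p + z i) ` hex_ball (2 * L)"
        then obtain q where "p = q + z i" "hex_norm q \<le> 2 * L" by (auto simp: hex_ball_def)
        then show "p \<in> V" using zL[OF that] hex_norm_triangle[of q "z i"] m by (simp add: V_def hex_ball_def)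
      qed
      then have "pr V (T i) = pr (hex_ball (2 * L)) (branching m (2 * L))"
        unfolding T_def using pr_branching_shift[of V "z i" "2 * L" m] L m by (simp add: V_def)
      then show ?thesis using pr_branching_ge[OF high, of "2 * L"] L m by (simp add: \<delta>_def)
    qed
    then have "(\<Sum>i\<in>I. \<delta>) \<le> (\<Sum>i\<in>I. pr V (T i))" by (rule sum_mono)
    also have "\<dots> = avg V (\<lambda>\<omega>. \<Sum>i\<in>I. of_bool (T i \<omega>))" by (simp add: pr_def avg_sum)
    also have "\<dots> \<le> avg V (\<lambda>_. 6 * (of_int L + 1))" by (rule avg_mono) (rule few)
    also have "\<dots> = 6 * (of_int L + 1)" by (simp add: avg_const V_def)
    finally have "real k * (\<delta> * real k) \<le> 6 * (2 * of_int s * real k + 1)"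
      by (simp add: I_def L_def mult_ac)
    also have "\<dots> \<le> real k * (6 * (2 * of_int s + 1))" using k by (simp add: algebra_simps)
    finally show ?thesis using k by simp
  qed
  obtain k :: nat where k: "6 * (2 * of_int s + 1) / \<delta> < real k" using reals_Archimedean2 by blast
  have "0 < 6 * (2 * of_int s + 1) / \<delta>" using \<delta> m by (intro divide_pos_pos) (simp_all add: s_def)
  then have "0 < real k" using k by linarith
  then have "1 \<le> k" by simp
  moreover have "6 * (2 * of_int s + 1) < \<delta> * real k"
    using k \<delta> by (simp add: pos_divide_less_eq mult.commute)
  ultimately show False using bound[of k] by simp
qed

text \<open>
  Harris's theorem: critical site percolation on the triangular lattice does not percolate.
\<close>

theorem one_arm_vanishes:
  assumes "0 < \<epsilon>"
  shows "\<exists>N\<ge>1. arm_prob 0 N < \<epsilon>"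
proof (rule arm_prob_dichotomy[OF _ _ arm_prob_not_close_to_1 assms])
  show "0 < 1 - (1 / 12 :: real) ^ 6" "1 - (1 / 12 :: real) ^ 6 < 1"
    by (simp_all add: power_one_over)
qed

section \<open>Geometry of the hexagon and its cells\<close>

lemma norm_60_degrees:
  "(cmod (of_real x * cis A + of_real y * cis (A + pi / 3)))\<^sup>2 = x\<^sup>2 + x * y + y\<^sup>2"
proof -
  have eq: "of_real x * cis A + of_real y * cis (A + pi / 3)
      = cis A * Complex (x + y / 2) (y * (sqrt 3 / 2))"
  proof -
    have "cis (pi / 3) = Complex (1 / 2) (sqrt 3 / 2)"
      by (simp add: complex_eq_iff cos_60 sin_60)
    then have rotate: "cis (A + pi / 3) = cis A * Complex (1 / 2) (sqrt 3 / 2)"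
      by (simp only: cis_mult flip: \<open>cis (pi / 3) = _\<close>)
    show ?thesis unfolding rotate by (simp add: complex_eq_iff algebra_simps)
  qed
  have "(cmod (of_real x * cis A + of_real y * cis (A + pi / 3)))\<^sup>2 = (x + y / 2)\<^sup>2 + (y * (sqrt 3 / 2))\<^sup>2"
    unfolding eq by (simp add: norm_mult cmod_power2)
  also have "\<dots> = x\<^sup>2 + x * y + y\<^sup>2"
    by (simp add: power2_eq_square algebra_simps)
  finally show ?thesis .
qed

text \<open>
  The honeycomb in the lattice coordinates used above.
\<close>

definition cell_center :: "complex \<Rightarrow> real \<Rightarrow> real \<Rightarrow> int \<times> int \<Rightarrow> complex" where
  "cell_center c r \<theta> p = c + of_real (sqrt 3 * r) *
     (of_int (fst p) * cis (\<theta> + pi / 6) + of_int (snd p) * cis (\<theta> + pi / 2))"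

lemma honeycomb_eq: "honeycomb c r \<theta> = range (cell_center c r \<theta>)"
proof -
  have "x \<in> honeycomb c r \<theta> \<longleftrightarrow> (\<exists>a b. x = cell_center c r \<theta> (a, b))" for x
    by (simp add: honeycomb_def cell_center_def)
  then show ?thesis by (simp add: set_eq_iff image_iff)
qed

lemma cell_center_dist:
  "(dist (cell_center c r \<theta> p) (cell_center c r \<theta> q))\<^sup>2 =
     3 * r\<^sup>2 * of_int ((fst (p - q))\<^sup>2 + fst (p - q) * snd (p - q) + (snd (p - q))\<^sup>2)"
proof -
  have "cell_center c r \<theta> p - cell_center c r \<theta> q =
      of_real (sqrt 3 * r) * (of_real (of_int (fst (p - q))) * cis (\<theta> + pi / 6) +
        of_real (of_int (snd (p - q))) * cis ((\<theta> + pi / 6) + pi / 3))"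
    by (simp add: cell_center_def algebra_simps)
  then show ?thesis
    unfolding dist_norm by (simp only: norm_mult power_mult_distrib norm_60_degrees norm_of_real power2_abs) simp
qed

lemma cell_center_dist_le:
  assumes "0 \<le> r"
  shows "dist (cell_center c r \<theta> p) (cell_center c r \<theta> q) \<le> 3 * r * of_int (hex_norm (p - q))"
proof (rule power2_le_imp_le)
  define a b h where "a = fst (p - q)" and "b = snd (p - q)" and "h = hex_norm (p - q)"
  have "a\<^sup>2 \<le> h\<^sup>2" "b\<^sup>2 \<le> h\<^sup>2" "(a + b)\<^sup>2 \<le> h\<^sup>2"
    using hex_norm_ge[of "p - q"] power_mono[of "\<bar>a\<bar>" h 2] power_mono[of "\<bar>b\<bar>" h 2] power_mono[of "\<bar>a + b\<bar>" h 2]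
    by (simp_all add: a_def b_def h_def)
  moreover have "(a + b)\<^sup>2 = a\<^sup>2 + 2 * (a * b) + b\<^sup>2" by (simp add: power2_sum)
  ultimately have "a\<^sup>2 + a * b + b\<^sup>2 \<le> 3 * h\<^sup>2"
    using zero_le_power2[of h] by linarith
  then have "real_of_int (a\<^sup>2 + a * b + b\<^sup>2) \<le> real_of_int (3 * h\<^sup>2)" by (simp only: of_int_le_iff)
  then have "3 * r\<^sup>2 * real_of_int (a\<^sup>2 + a * b + b\<^sup>2) \<le> 3 * r\<^sup>2 * real_of_int (3 * h\<^sup>2)"
    by (intro mult_left_mono) auto
  then show "(dist (cell_center c r \<theta> p) (cell_center c r \<theta> q))\<^sup>2 \<le> (3 * r * of_int (hex_norm (p - q)))\<^sup>2"
    unfolding cell_center_dist a_def[symmetric] b_def[symmetric] h_def[symmetric]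
    by (simp add: power_mult_distrib mult_ac)
qed (use assms in simp)

text \<open>
  The Eisenstein integers of norm \<open>1\<close> are the six units.
\<close>

lemma eisenstein_norm_le_1:
  fixes a b :: int
  assumes "a\<^sup>2 + a * b + b\<^sup>2 \<le> 1" "(a, b) \<noteq> (0, 0)"
  shows "(a, b) \<in> {(1, 0), (-1, 0), (0, 1), (0, -1), (1, -1), (-1, 1)}"
proof -
  have "3 * v\<^sup>2 \<le> 4" if "u\<^sup>2 + u * v + v\<^sup>2 \<le> 1" for u v :: int
  proof -
    have "3 * v\<^sup>2 \<le> (2 * u + v)\<^sup>2 + 3 * v\<^sup>2" by simp
    also have "\<dots> = 4 * (u\<^sup>2 + u * v + v\<^sup>2)" by (simp add: power2_eq_square algebra_simps)
    also have "\<dots> \<le> 4 * 1" using that by (intro mult_left_mono) simp_all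
    finally show ?thesis by simp
  qed
  from this[of a b] this[of b a] have "3 * b\<^sup>2 \<le> 4" "3 * a\<^sup>2 \<le> 4"
    using assms(1) by (simp_all add: ac_simps)
  then have "\<bar>b\<bar>\<^sup>2 < 2\<^sup>2" "\<bar>a\<bar>\<^sup>2 < 2\<^sup>2" by simp_all
  then have "\<bar>b\<bar> < 2" "\<bar>a\<bar> < 2" by (simp_all only: power2_less_imp_less abs_ge_zero zero_le_numeral)
  then have "a = -1 \<or> a = 0 \<or> a = 1" "b = -1 \<or> b = 0 \<or> b = 1" by auto
  then show ?thesis using assms by (elim disjE) simp_all
qed

lemma inj_cell_center:
  assumes "0 < r"
  shows "inj (cell_center c r \<theta>)"
proof (rule injI)
  fix p q assume eq: "cell_center c r \<theta> p = cell_center c r \<theta> q"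
  define a b where "a = fst (p - q)" and "b = snd (p - q)"
  have "3 * r\<^sup>2 * of_int (a\<^sup>2 + a * b + b\<^sup>2) = 0"
    using cell_center_dist[of c r \<theta> p q] unfolding eq by (simp add: a_def b_def)
  then have "real_of_int (a\<^sup>2 + a * b + b\<^sup>2) = 0" using assms by (simp only: mult_eq_0_iff) simp
  then have z: "a\<^sup>2 + a * b + b\<^sup>2 = 0" by (simp only: of_int_eq_0_iff)
  have "(a, b) = (0, 0)"
  proof (rule ccontr)
    assume "(a, b) \<noteq> (0, 0)"
    then have "(a, b) \<in> {(1, 0), (-1, 0), (0, 1), (0, -1), (1, -1), (-1, 1)}"
      using eisenstein_norm_le_1[of a b] z by linarith
    then show False using z by auto
  qed
  then show "p = q" by (simp add: a_def b_def prod_eq_iff)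
qed

text \<open>
  A common side has a single midpoint, which is at distance \<open>sqrt 3 / 2 * r\<close> from both centres.
\<close>

lemma cell_adj_dist:
  assumes "cell_adj r \<theta> x y" "0 \<le> r"
  shows "dist x y \<le> sqrt 3 * r"
proof -
  obtain i j where "hex_side x r \<theta> i = hex_side y r \<theta> j"
    using assms(1) by (auto simp: cell_adj_def)
  then have "{hex_vertex x r \<theta> i, hex_vertex x r \<theta> (Suc i)} = {hex_vertex y r \<theta> j, hex_vertex y r \<theta> (Suc j)}"
    by (simp add: hex_side_def)
  then have sum: "hex_vertex x r \<theta> i + hex_vertex x r \<theta> (Suc i) = hex_vertex y r \<theta> j + hex_vertex y r \<theta> (Suc j)"
    by (auto simp: doubleton_eq_iff add.commute)
  define m where "m k = cis (\<theta> + real k * pi / 3) + cis (\<theta> + real (Suc k) * pi / 3)" for k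
  have mid: "hex_vertex z r \<theta> k + hex_vertex z r \<theta> (Suc k) = 2 * z + of_real r * m k" for z k
    by (simp add: hex_vertex_def m_def algebra_simps)
  have norm_m: "cmod (m k) = sqrt 3" for k
  proof -
    have "m k = of_real 1 * cis (\<theta> + real k * pi / 3) + of_real 1 * cis ((\<theta> + real k * pi / 3) + pi / 3)"
      by (simp add: m_def algebra_simps add_divide_distrib)
    then have "(cmod (m k))\<^sup>2 = 3" by (simp only: norm_60_degrees) simp
    then show ?thesis by (metis norm_ge_zero real_sqrt_unique)
  qed
  have "2 * (x - y) = of_real r * m j - of_real r * m i"
    using sum unfolding mid by (simp add: algebra_simps)
  then have "cmod (2 * (x - y)) \<le> cmod (of_real r * m j) + cmod (of_real r * m i)"
    by (simp only: norm_triangle_ineq4)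
  moreover have "cmod (2 * (x - y)) = 2 * cmod (x - y)"
    by (simp only: norm_mult norm_numeral)
  ultimately have "2 * cmod (x - y) \<le> 2 * (sqrt 3 * r)"
    using assms(2) by (simp add: norm_mult norm_m mult.commute)
  then show ?thesis by (simp add: dist_norm)
qed

lemma cell_adj_tri_adj:
  assumes "cell_adj r \<theta> (cell_center c r \<theta> p) (cell_center c r \<theta> q)" "0 < r"
  shows "tri_adj p q"
proof -
  define a b where "a = fst (q - p)" and "b = snd (q - p)"
  have "(dist (cell_center c r \<theta> q) (cell_center c r \<theta> p))\<^sup>2 \<le> (sqrt 3 * r)\<^sup>2"
    using cell_adj_dist[OF assms(1)] assms(2) by (intro power_mono) (simp_all add: dist_commute)
  then have "(3 * r\<^sup>2) * of_int (a\<^sup>2 + a * b + b\<^sup>2) \<le> (3 * r\<^sup>2) * 1"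
    unfolding cell_center_dist a_def[symmetric] b_def[symmetric] by (simp add: power_mult_distrib)
  then have "real_of_int (a\<^sup>2 + a * b + b\<^sup>2) \<le> 1"
    using assms(2) by (subst (asm) mult_le_cancel_left_pos) auto
  then have "a\<^sup>2 + a * b + b\<^sup>2 \<le> 1" by linarith
  moreover have "p \<noteq> q" using assms(1) by (auto simp: cell_adj_def)
  then have "(a, b) \<noteq> (0, 0)" by (auto simp: a_def b_def prod_eq_iff)
  ultimately have "(a, b) \<in> {(1, 0), (-1, 0), (0, 1), (0, -1), (1, -1), (-1, 1)}"
    by (rule eisenstein_norm_le_1)
  then show ?thesis unfolding tri_adj_def a_def b_def fst_diff snd_diff .
qed

lemma hex_vertex_in: "i \<in> {1..6} \<Longrightarrow> hex_vertex c r \<alpha> i \<in> hexagon c r \<alpha>"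
  unfolding hexagon_def by (rule hull_inc) simp

lemma hex_vertex_period: "hex_vertex c r \<alpha> (i + 6) = hex_vertex c r \<alpha> i"
proof -
  have "\<alpha> + real (i + 6) * pi / 3 = \<alpha> + real i * pi / 3 + 2 * pi" by (simp add: algebra_simps add_divide_distrib)
  then show ?thesis
    by (simp only: hex_vertex_def) (simp flip: cis_mult)
qed

lemma hex_vertex_Suc_in: "i \<in> {1..6} \<Longrightarrow> hex_vertex c r \<alpha> (Suc i) \<in> hexagon c r \<alpha>"
  using hex_vertex_in[of "Suc i" c r \<alpha>] hex_vertex_period[of c r \<alpha> 1] hex_vertex_in[of 1 c r \<alpha>]
  by (cases "i = 6") simp_all

lemma convex_hexagon: "convex (hexagon c r \<alpha>)"
  by (simp add: hexagon_def)

lemma hexagon_subset_cball: "0 \<le> r \<Longrightarrow> hexagon c r \<alpha> \<subseteq> cball c r"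
  unfolding hexagon_def
  by (rule hull_minimal) (auto simp: hex_vertex_def dist_norm norm_mult)

lemma center_in_hexagon: "c \<in> hexagon c r \<alpha>"
proof -
  have "\<alpha> + real 4 * pi / 3 = \<alpha> + real 1 * pi / 3 + pi" by (simp add: field_simps)
  moreover have "cis (X + pi) = - cis X" for X
    by (simp add: complex_eq_iff)
  ultimately have "hex_vertex c r \<alpha> 4 = c - of_real r * cis (\<alpha> + real 1 * pi / 3)"
    by (simp only: hex_vertex_def) simp
  moreover have "(1 / 2) *\<^sub>R (c + z) + (1 / 2) *\<^sub>R (c - z) = c" for z :: complex
    by (simp add: complex_eq_iff field_simps)
  ultimately have "c = (1 / 2) *\<^sub>R hex_vertex c r \<alpha> 1 + (1 / 2) *\<^sub>R hex_vertex c r \<alpha> 4"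
    by (simp only: hex_vertex_def[of _ _ _ 1])
  also have "\<dots> \<in> hexagon c r \<alpha>"
    using convexD[OF convex_hexagon hex_vertex_in[of 1] hex_vertex_in[of 4], of "1/2" "1/2"] by simp
  finally show ?thesis .
qed

text \<open>
  Every point lies in one of the six sectors spanned by consecutive vertices. The angle is measured from
  vertex 1, so that the index of the sector falls within \<open>{1..6}\<close>.
\<close>

lemma sector_decomposition:
  obtains j s t where "j \<in> {1..6}" "0 \<le> s" "0 \<le> t" "s \<le> 2 * cmod (x - c)" "t \<le> 2 * cmod (x - c)"
    "x = c + of_real s * cis (\<alpha> + real j * pi / 3) + of_real t * cis (\<alpha> + real (Suc j) * pi / 3)"
proof -
  define z where "z = (x - c) * cis (- (\<alpha> + pi / 3))"
  define \<phi> where "\<phi> = Arg2pi z"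
  define \<rho> where "\<rho> = cmod (x - c)"
  define k where "k = nat \<lfloor>\<phi> / (pi / 3)\<rfloor>"
  \<comment> \<open>The angle within the sector.\<close>
  define \<psi> where "\<psi> = \<phi> - real k * (pi / 3)"
  have \<phi>: "0 \<le> \<phi>" "\<phi> < 2 * pi" using Arg2pi[of z] by (simp_all add: \<phi>_def)
  have "z = of_real (cmod z) * cis \<phi>"
    by (simp add: complex_eq_iff \<phi>_def cos_Arg2pi sin_Arg2pi)
  moreover have "cmod z = \<rho>" by (simp add: z_def \<rho>_def norm_mult)
  moreover have "x - c = z * cis (\<alpha> + pi / 3)" by (simp add: z_def mult.assoc cis_mult)
  ultimately have xc: "x - c = of_real \<rho> * cis (\<alpha> + pi / 3 + \<phi>)"
    by (simp add: cis_mult mult.assoc add_ac)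
  have fl: "real k = of_int \<lfloor>\<phi> / (pi / 3)\<rfloor>" using \<phi>(1) by (simp add: k_def)
  have \<psi>: "0 \<le> \<psi>" "\<psi> \<le> pi / 3"
  proof -
    have p3: "0 < pi / 3" by simp
    have "real k \<le> \<phi> / (pi / 3)" "\<phi> / (pi / 3) \<le> real k + 1" unfolding fl by linarith+
    then have "real k * (pi / 3) \<le> \<phi>" "\<phi> \<le> (real k + 1) * (pi / 3)"
      by (simp_all only: pos_le_divide_eq[OF p3] pos_divide_le_eq[OF p3]) 
    then show "0 \<le> \<psi>" "\<psi> \<le> pi / 3" by (simp_all add: \<psi>_def algebra_simps)
  qed
  have "real k < 6"
  proof -
    have "real k \<le> \<phi> / (pi / 3)" unfolding fl by linarith
    also have "\<dots> < 6" using \<phi>(2) by (simp add: field_simps)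
    finally show ?thesis .
  qed
  then have k6: "Suc k \<in> {1..6}" by simp
  define s where "s = \<rho> * (sin (pi / 3 - \<psi>) / (sqrt 3 / 2))"
  define t where "t = \<rho> * (sin \<psi> / (sqrt 3 / 2))"
  have sin0: "0 \<le> sin \<psi>" "0 \<le> sin (pi / 3 - \<psi>)"
    using \<psi> pi_gt_zero by (auto intro!: sin_ge_zero)
  have st0: "0 \<le> s" "0 \<le> t" using sin0 by (simp_all add: s_def t_def \<rho>_def)
  have "1 \<le> sqrt 3" by simp
  then have b: "v / (sqrt 3 / 2) \<le> 2" if "v \<le> 1" for v
    using order_trans[OF that \<open>1 \<le> sqrt 3\<close>] by (simp add: field_simps)
  have st2: "s \<le> 2 * \<rho>" "t \<le> 2 * \<rho>"
    using mult_left_mono[OF b[OF sin_le_one[of \<psi>]], of \<rho>] mult_left_mono[OF b[OF sin_le_one[of "pi / 3 - \<psi>"]], of \<rho>]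
    by (simp_all add: s_def t_def \<rho>_def mult.commute)
  have cis_split: "cis (A + \<psi>) = of_real (sin (pi / 3 - \<psi>) / (sqrt 3 / 2)) * cis A
      + of_real (sin \<psi> / (sqrt 3 / 2)) * cis (A + pi / 3)" for A
  proof -
    have "cis \<psi> = of_real (sin (pi / 3 - \<psi>) / (sqrt 3 / 2)) + of_real (sin \<psi> / (sqrt 3 / 2)) * cis (pi / 3)"
    proof -
      have "sin (pi / 3 - \<psi>) = sqrt 3 / 2 * cos \<psi> - 1 / 2 * sin \<psi>"
        by (simp add: sin_diff sin_60 cos_60)
      then show ?thesis
        by (simp only:) (simp add: complex_eq_iff sin_60 cos_60 field_simps)
    qed
    then have "cis A * cis \<psi> = cis A * (of_real (sin (pi / 3 - \<psi>) / (sqrt 3 / 2)) + of_real (sin \<psi> / (sqrt 3 / 2)) * cis (pi / 3))"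
      by simp
    then show ?thesis by (simp add: cis_mult distrib_left mult.left_commute mult.commute)
  qed
  have ang: "\<alpha> + pi / 3 + \<phi> = (\<alpha> + real (Suc k) * pi / 3) + \<psi>"
      "(\<alpha> + real (Suc k) * pi / 3) + pi / 3 = \<alpha> + real (Suc (Suc k)) * pi / 3"
    by (simp_all add: \<psi>_def field_simps)
  have "x = c + of_real s * cis (\<alpha> + real (Suc k) * pi / 3) + of_real t * cis (\<alpha> + real (Suc (Suc k)) * pi / 3)"
    using xc unfolding ang(1) cis_split unfolding ang(2) s_def t_def
    by (simp add: algebra_simps)
  then show thesis using that[OF k6 st0] st2 by (simp add: \<rho>_def)
qed

lemma convexD3:
  assumes "convex S" "x \<in> S" "y \<in> S" "z \<in> S" "0 \<le> a" "0 \<le> b" "a + b \<le> 1"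
  shows "a *\<^sub>R x + b *\<^sub>R y + (1 - a - b) *\<^sub>R z \<in> S"
proof (cases "a + b = 0")
  case True
  then have "a = 0" "b = 0" using assms by linarith+
  then show ?thesis using assms by simp
next
  case False
  define w where "w = (a / (a + b)) *\<^sub>R x + (b / (a + b)) *\<^sub>R y"
  have "w \<in> S"
    unfolding w_def using assms False by (intro convexD) (auto simp flip: add_divide_distrib)
  then have "(a + b) *\<^sub>R w + (1 - (a + b)) *\<^sub>R z \<in> S"
    using assms by (intro convexD) auto
  moreover have "(a + b) *\<^sub>R w = a *\<^sub>R x + b *\<^sub>R y"
    using False by (simp add: w_def scaleR_right_distrib)
  ultimately show ?thesis by (simp add: diff_diff_add)
qed

lemma sector_in_hexagon:
  assumes "j \<in> {1..6}" "0 \<le> s" "0 \<le> t" "s + t \<le> 1" "y \<in> hexagon c 1 \<alpha>"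
  shows "of_real s * hex_vertex c 1 \<alpha> j + of_real t * hex_vertex c 1 \<alpha> (Suc j) + of_real (1 - s - t) * y
    \<in> hexagon c 1 \<alpha>"
proof -
  have "s *\<^sub>R hex_vertex c 1 \<alpha> j + t *\<^sub>R hex_vertex c 1 \<alpha> (Suc j) + (1 - s - t) *\<^sub>R y \<in> hexagon c 1 \<alpha>"
    by (intro convexD3 convex_hexagon hex_vertex_in hex_vertex_Suc_in assms)
  then show ?thesis by (simp add: scaleR_conv_of_real)
qed

text \<open>
  The outer unit normal of side \<open>j\<close>.
\<close>

definition side_normal :: "real \<Rightarrow> nat \<Rightarrow> complex" where
  "side_normal \<alpha> j = cis (\<alpha> + real j * pi / 3 + pi / 6)"

lemma inner_cis: "cis a \<bullet> cis b = cos (a - b)"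
  by (simp add: inner_complex_def cos_diff)

text \<open>
  The cosine of an odd multiple of \<open>pi/6\<close> is a zero of \<open>4 * C\<^sup>3 - 3 * C\<close>, because its triple angle is an odd
  multiple of \<open>pi/2\<close>.
\<close>

lemma cos_odd_sixth_le: "cos (of_int d * (pi / 3) - pi / 6) \<le> sqrt 3 / 2"
proof -
  define x where "x = of_int d * (pi / 3) - pi / 6"
  have "cos (3 * x) = cos (pi * of_int d - pi / 2)"
    by (simp add: x_def algebra_simps)
  also have "\<dots> = 0" by (simp add: cos_diff)
  finally have "cos x * (4 * (cos x)\<^sup>2 - 3) = 0"
    unfolding cos_treble_cos by (simp add: power2_eq_square power3_eq_cube algebra_simps)
  then have "cos x = 0 \<or> (cos x)\<^sup>2 = 3 / 4" by auto
  then have "(cos x)\<^sup>2 \<le> (sqrt 3 / 2)\<^sup>2" by (auto simp: power_divide)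
  then show ?thesis unfolding x_def[symmetric] by (rule power2_le_imp_le) simp
qed

lemma hexagon_halfplane:
  assumes "x \<in> hexagon c 1 \<alpha>"
  shows "side_normal \<alpha> j \<bullet> (x - c) \<le> sqrt 3 / 2"
proof -
  let ?H = "{x. side_normal \<alpha> j \<bullet> x \<le> sqrt 3 / 2 + side_normal \<alpha> j \<bullet> c}"
  have "hexagon c 1 \<alpha> \<subseteq> ?H"
    unfolding hexagon_def
  proof (rule hull_minimal)
    show "convex ?H" by (rule convex_halfspace_le)
    show "hex_vertex c 1 \<alpha> ` {1..6} \<subseteq> ?H"
    proof
      fix v assume "v \<in> hex_vertex c 1 \<alpha> ` {1..6}"
      then obtain i where i: "v = hex_vertex c 1 \<alpha> i" by auto
      have ang: "\<alpha> + real i * pi / 3 - (\<alpha> + real j * pi / 3 + pi / 6) = of_int (int i - int j) * (pi / 3) - pi / 6"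
        by (simp add: field_simps)
      have "side_normal \<alpha> j \<bullet> (v - c) = cos (\<alpha> + real i * pi / 3 - (\<alpha> + real j * pi / 3 + pi / 6))"
      proof -
        have "v - c = cis (\<alpha> + real i * pi / 3)" by (simp add: i hex_vertex_def)
        then show ?thesis unfolding side_normal_def by (subst inner_commute) (simp only: inner_cis)
      qed
      also have "\<dots> \<le> sqrt 3 / 2"
        unfolding ang by (rule cos_odd_sixth_le)
      finally show "v \<in> ?H" by (simp add: inner_diff_right)
    qed
  qed
  then show ?thesis using assms by (auto simp: inner_diff_right)
qed

lemma side_normal_vertices:
  "side_normal \<alpha> j \<bullet> cis (\<alpha> + real j * pi / 3) = sqrt 3 / 2"
  "side_normal \<alpha> j \<bullet> cis (\<alpha> + real (Suc j) * pi / 3) = sqrt 3 / 2"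
proof -
  have "\<alpha> + real j * pi / 3 + pi / 6 - (\<alpha> + real j * pi / 3) = pi / 6" by simp
  then show "side_normal \<alpha> j \<bullet> cis (\<alpha> + real j * pi / 3) = sqrt 3 / 2"
    by (simp only: side_normal_def inner_cis cos_30)
  have "\<alpha> + real j * pi / 3 + pi / 6 - (\<alpha> + real (Suc j) * pi / 3) = - (pi / 6)" by (simp add: field_simps)
  then show "side_normal \<alpha> j \<bullet> cis (\<alpha> + real (Suc j) * pi / 3) = sqrt 3 / 2"
    by (simp only: side_normal_def inner_cis cos_minus cos_30)
qed

text \<open>
  Let \<open>e\<close> be \<open>1\<close> minus the sum of the coordinates of \<open>x\<close> in its sector. Then \<open>x\<close> is within \<open>e\<close> of the side of that
  sector. On the other hand \<open>hexagon c 1 \<alpha>\<close> contains the ball of radius \<open>1/4\<close> about its centre; by convexity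
  it contains the ball of radius \<open>e / 4\<close> about \<open>x\<close>, so a point outside within \<open>d\<close> of \<open>x\<close> forces \<open>e \<le> 4 * d\<close>.
\<close>

lemma near_outside_near_side:
  assumes x: "x \<in> hexagon c 1 \<alpha>" and w: "w \<notin> hexagon c 1 \<alpha>" and d: "dist x w \<le> d"
  shows "\<exists>j\<in>{1..6}. infdist x (hex_side c 1 \<alpha> j) \<le> 4 * d"
proof -
  obtain j s t where j: "j \<in> {1..6}" and st: "0 \<le> s" "0 \<le> t"
    and xs: "x = c + of_real s * cis (\<alpha> + real j * pi / 3) + of_real t * cis (\<alpha> + real (Suc j) * pi / 3)"
    by (rule sector_decomposition[of x c \<alpha>])
  define e where "e = 1 - s - t"
  have "side_normal \<alpha> j \<bullet> (x - c) = (s + t) * (sqrt 3 / 2)"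
    unfolding xs by (simp only: add_diff_cancel_left' add.assoc inner_add_right flip: scaleR_conv_of_real)
      (simp add: side_normal_vertices distrib_right del: of_nat_Suc)
  then have "(s + t) * (sqrt 3 / 2) \<le> 1 * (sqrt 3 / 2)"
    using hexagon_halfplane[OF x, of j] by simp
  then have "s + t \<le> 1" by (rule mult_right_le_imp_le) simp
  then have e0: "0 \<le> e" by (simp add: e_def)
  have d0: "0 \<le> d" using d zero_le_dist order_trans by blast
  \<comment> \<open>The coordinates of a point in its sector are at most twice its distance from the centre.\<close>
  have small_in: "y \<in> hexagon c 1 \<alpha>" if y: "dist c y \<le> 1 / 4" for y
  proof -
    obtain i u v where i: "i \<in> {1..6}" and uv: "0 \<le> u" "0 \<le> v" "u \<le> 2 * cmod (y - c)" "v \<le> 2 * cmod (y - c)"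
      and ys: "y = c + of_real u * cis (\<alpha> + real i * pi / 3) + of_real v * cis (\<alpha> + real (Suc i) * pi / 3)"
      by (rule sector_decomposition[of y c \<alpha>])
    have "u + v \<le> 1" using uv y by (simp add: dist_norm norm_minus_commute)
    from sector_in_hexagon[OF i uv(1,2) this center_in_hexagon]
    show ?thesis by (simp add: ys hex_vertex_def algebra_simps)
  qed
  have "e \<le> 4 * d"
  proof (rule ccontr)
    assume "\<not> e \<le> 4 * d"
    then have e: "4 * d < e" "0 < e" using d0 by linarith+
    define y where "y = c + (w - x) / of_real e"
    have "dist c y = dist x w / e"
      using e by (simp add: y_def dist_norm norm_divide norm_minus_commute)
    also have "\<dots> \<le> 1 / 4" using e d by (simp add: divide_simps)
    finally have "y \<in> hexagon c 1 \<alpha>" by (rule small_in)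
    from sector_in_hexagon[OF j st \<open>s + t \<le> 1\<close> this]
    have "of_real s * hex_vertex c 1 \<alpha> j + of_real t * hex_vertex c 1 \<alpha> (Suc j) + of_real e * y \<in> hexagon c 1 \<alpha>"
      by (simp add: e_def)
    moreover have "of_real e * y = of_real e * c + w - x"
      using e by (simp add: y_def distrib_left)
    ultimately have "w \<in> hexagon c 1 \<alpha>"
      by (simp add: xs e_def hex_vertex_def algebra_simps)
    then show False using w by simp
  qed
  moreover have "infdist x (hex_side c 1 \<alpha> j) \<le> e"
  proof -
    define x' where "x' = (1 - t) *\<^sub>R hex_vertex c 1 \<alpha> j + t *\<^sub>R hex_vertex c 1 \<alpha> (Suc j)"
    have "x' \<in> hex_side c 1 \<alpha> j"
      using st \<open>s + t \<le> 1\<close> by (auto simp: hex_side_def closed_segment_def x'_def intro!: exI[of _ t])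
    then have "infdist x (hex_side c 1 \<alpha> j) \<le> dist x x'" by (rule infdist_le)
    also have "x' - x = of_real e * cis (\<alpha> + real j * pi / 3)"
      by (simp add: x'_def xs e_def hex_vertex_def scaleR_conv_of_real algebra_simps)
    then have "dist x x' = e" using e0 by (simp add: dist_norm norm_minus_commute[of x] norm_mult)
    finally show ?thesis .
  qed
  ultimately show ?thesis using j by force
qed

lemma infdist_hex_side_normal:
  assumes "infdist x (hex_side c 1 \<alpha> j) \<le> d"
  shows "sqrt 3 / 2 - d \<le> side_normal \<alpha> j \<bullet> (x - c)"
proof -
  obtain z where z: "z \<in> hex_side c 1 \<alpha> j" "infdist x (hex_side c 1 \<alpha> j) = dist x z"
    by (rule infdist_attains_inf[of "hex_side c 1 \<alpha> j" x]) (auto simp: hex_side_def)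
  obtain u where "z = (1 - u) *\<^sub>R hex_vertex c 1 \<alpha> j + u *\<^sub>R hex_vertex c 1 \<alpha> (Suc j)"
    using z(1) by (auto simp: hex_side_def closed_segment_def)
  then have "z - c = (1 - u) *\<^sub>R cis (\<alpha> + real j * pi / 3) + u *\<^sub>R cis (\<alpha> + real (Suc j) * pi / 3)"
    by (simp add: hex_vertex_def scaleR_conv_of_real algebra_simps)
  then have "side_normal \<alpha> j \<bullet> (z - c) = (1 - u) * (sqrt 3 / 2) + u * (sqrt 3 / 2)"
    by (simp only: inner_add_right inner_scaleR_right side_normal_vertices)
  then have "side_normal \<alpha> j \<bullet> (z - c) = sqrt 3 / 2"
    by (simp only: distrib_right[symmetric]) simp
  moreover have "side_normal \<alpha> j \<bullet> (z - x) \<le> d"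
    using norm_cauchy_schwarz[of "side_normal \<alpha> j" "z - x"] assms z(2)
    by (simp add: side_normal_def dist_norm norm_minus_commute)
  ultimately show ?thesis by (simp add: inner_diff_right)
qed

text \<open>
  Measured along the common normal, the two sides are at distance \<open>sqrt 3\<close>.
\<close>

lemma opposite_sides_far:
  assumes "infdist x (hex_side c 1 \<alpha> k) \<le> d" "infdist y (hex_side c 1 \<alpha> (k + 3)) \<le> d"
  shows "sqrt 3 - 2 * d \<le> dist x y"
proof -
  have "\<alpha> + real (k + 3) * pi / 3 + pi / 6 = \<alpha> + real k * pi / 3 + pi / 6 + pi" by (simp add: field_simps)
  moreover have "cis (X + pi) = - cis X" for X
    by (simp add: complex_eq_iff)
  ultimately have "side_normal \<alpha> (k + 3) = - side_normal \<alpha> k"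
    unfolding side_normal_def by (simp only:)
  then have "sqrt 3 / 2 - d \<le> side_normal \<alpha> k \<bullet> (x - c)" "sqrt 3 / 2 - d \<le> - (side_normal \<alpha> k \<bullet> (y - c))"
    using infdist_hex_side_normal[OF assms(1)] infdist_hex_side_normal[OF assms(2)] by simp_all
  then have "sqrt 3 - 2 * d \<le> side_normal \<alpha> k \<bullet> (x - y)"
    by (simp add: inner_diff_right)
  also have "\<dots> \<le> dist x y"
    using norm_cauchy_schwarz[of "side_normal \<alpha> k" "x - y"] by (simp add: side_normal_def dist_norm)
  finally show ?thesis .
qed

text \<open>
  A boundary cell has a neighbour that is not contained in the hexagon, so its centre is within
  \<open>3 / n\<close> of a point outside; some side is then within four times that distance, and the nearest sides are
  at least as close.
\<close>

lemma side_cells_near: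
  assumes x: "x \<in> side_cells c \<alpha> \<theta> n A" and n: "0 < n"
  shows "infdist x (hex_side c 1 \<alpha> A) \<le> 12 / real n"
proof -
  let ?r = "1 / real n"
  obtain y where xM: "x \<in> cells_in c \<alpha> \<theta> n" and y: "y \<in> honeycomb c ?r \<theta>" "y \<notin> cells_in c \<alpha> \<theta> n"
      and adj: "cell_adj ?r \<theta> x y"
      and near: "\<And>B. B \<in> {1..6} \<Longrightarrow> infdist x (hex_side c 1 \<alpha> A) \<le> infdist x (hex_side c 1 \<alpha> B)"
    using x by (auto simp: side_cells_def boundary_cells_def)
  have "\<not> hexagon y ?r \<theta> \<subseteq> hexagon c 1 \<alpha>" using y by (simp add: cells_in_def)
  then obtain w where w: "w \<in> hexagon y ?r \<theta>" "w \<notin> hexagon c 1 \<alpha>" by auto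
  have "dist y w \<le> ?r" using hexagon_subset_cball[of ?r y \<theta>] w(1) by auto
  moreover have "dist x y \<le> 2 * ?r"
    using cell_adj_dist[OF adj] mult_right_mono[of "sqrt 3" 2 ?r] real_sqrt_le_iff[of 3 4] by simp
  ultimately have "dist x w \<le> 3 * ?r" using dist_triangle[of x w y] by linarith
  moreover have "x \<in> hexagon c 1 \<alpha>"
    using xM center_in_hexagon[of x ?r \<theta>] by (auto simp: cells_in_def)
  ultimately obtain j where "j \<in> {1..6}" "infdist x (hex_side c 1 \<alpha> j) \<le> 4 * (3 * ?r)"
    using near_outside_near_side w(2) by blast
  then show ?thesis using near[of j] by simp
qed

lemma side_cells_far:
  assumes "x \<in> side_cells c \<alpha> \<theta> n k" "y \<in> side_cells c \<alpha> \<theta> n (k + 3)" "48 \<le> n"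
  shows "1 \<le> dist x y"
proof -
  have n: "0 < n" "24 / real n \<le> 1 / 2" using assms(3) by (simp_all add: divide_simps)
  have "(3 / 2)\<^sup>2 \<le> (3 :: real)" by (simp add: power2_eq_square)
  then have "3 / 2 \<le> sqrt 3" by (rule real_le_rsqrt)
  then show ?thesis
    using opposite_sides_far[OF side_cells_near[OF assms(1) n(1)] side_cells_near[OF assms(2) n(1)]] n(2)
    by simp
qed

lemma finite_cells_in:
  assumes "0 < n"
  shows "finite (cells_in c \<alpha> \<theta> n)"
proof -
  let ?f = "cell_center c (1 / real n) \<theta>"
  have "cells_in c \<alpha> \<theta> n \<subseteq> ?f ` hex_ball (2 * int n)"
  proof
    fix x assume x: "x \<in> cells_in c \<alpha> \<theta> n"
    then obtain p where p: "x = ?f p" by (auto simp: cells_in_def honeycomb_eq)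
    have "x \<in> hexagon c 1 \<alpha>"
      using x center_in_hexagon[of x "1 / real n" \<theta>] by (auto simp: cells_in_def)
    then have "dist (?f p) (?f 0) \<le> 1"
      using hexagon_subset_cball[of 1 c \<alpha>] p by (auto simp: cell_center_def dist_commute)
    then have "(dist (?f p) (?f 0))\<^sup>2 \<le> 1" by (simp add: power_le_one)
    then have "3 * (1 / real n)\<^sup>2 * real_of_int ((fst p)\<^sup>2 + fst p * snd p + (snd p)\<^sup>2) \<le> 1"
      by (simp only: cell_center_dist diff_zero)
    then have "3 * real_of_int ((fst p)\<^sup>2 + fst p * snd p + (snd p)\<^sup>2) \<le> (real n)\<^sup>2"
      using assms by (simp add: power_divide divide_simps)
    then have "real_of_int (3 * ((fst p)\<^sup>2 + fst p * snd p + (snd p)\<^sup>2)) \<le> real_of_int ((int n)\<^sup>2)"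
      by simp
    then have N: "3 * ((fst p)\<^sup>2 + fst p * snd p + (snd p)\<^sup>2) \<le> (int n)\<^sup>2"
      by (simp only: of_int_le_iff)
    have half: "\<bar>v\<bar> \<le> 2 * int n" if "3 * (u\<^sup>2 + u * v + v\<^sup>2) \<le> (int n)\<^sup>2" for u v :: int
    proof -
      have "3 * v\<^sup>2 \<le> (2 * u + v)\<^sup>2 + 3 * v\<^sup>2" by simp
      also have "\<dots> = 4 * (u\<^sup>2 + u * v + v\<^sup>2)" by (simp add: power2_eq_square algebra_simps)
      finally have "9 * v\<^sup>2 \<le> 4 * (int n)\<^sup>2" using that by linarith
      then have "v\<^sup>2 \<le> 4 * (int n)\<^sup>2" using zero_le_power2[of v] by linarith
      then have "\<bar>v\<bar>\<^sup>2 \<le> (2 * int n)\<^sup>2" by (simp add: power_mult_distrib)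
      then show ?thesis by (rule power2_le_imp_le) simp
    qed
    have "\<bar>fst p\<bar> \<le> 2 * int n" "\<bar>snd p\<bar> \<le> 2 * int n"
      using half[of "fst p" "snd p"] half[of "snd p" "fst p"] N by (simp_all add: ac_simps)
    moreover have "\<bar>fst p + snd p\<bar> \<le> 2 * int n"
      using half[of "- fst p" "fst p + snd p"] N by (simp add: power2_eq_square algebra_simps)
    ultimately show "x \<in> ?f ` hex_ball (2 * int n)" unfolding p by (auto simp: hex_ball_def hex_norm_le_iff)
  qed
  then show ?thesis by (rule finite_subset) simp
qed

section \<open>Pivotal cells and asymptotic independence\<close>

lemma successively_cell_adj_conn:
  assumes "successively (cell_adj r \<theta>) (map (cell_center c r \<theta>) ps)" "ps \<noteq> []" "0 < r"
  shows "conn (set ps) (hd ps) (last ps)"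
  using assms(2,1)
proof (induction ps rule: list_nonempty_induct)
  case (single p)
  then show ?case by (simp add: conn.refl)
next
  case (cons p ps)
  then obtain q qs where qs: "ps = q # qs" by (cases ps) auto
  have "tri_adj p q"
    using cons.prems cell_adj_tri_adj[of r \<theta> c p q] assms(3) by (simp add: qs)
  then have "conn (set (p # ps)) p (hd ps)"
    by (intro conn_tri_adj) (simp_all add: qs)
  moreover have "conn (set ps) (hd ps) (last ps)"
    using cons by (simp add: qs)
  then have "conn (set (p # ps)) (hd ps) (last ps)"
    by (rule conn_mono) auto
  ultimately show ?case
    using cons.hyps conn_trans by simp
qed

definition chained :: "('a \<Rightarrow> 'a \<Rightarrow> bool) \<Rightarrow> 'a set \<Rightarrow> 'a set \<Rightarrow> 'a set \<Rightarrow> bool" where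
  "chained adj A B W \<longleftrightarrow>
    (\<exists>xs. xs \<noteq> [] \<and> hd xs \<in> A \<and> last xs \<in> B \<and> set xs \<subseteq> W \<and> successively adj xs)"

lemma percolates_chained:
  "percolates M adj \<omega> k A B \<longleftrightarrow> chained adj A B {x \<in> M. \<omega> x \<in> {0, k}}"
  unfolding percolates_def chained_def by (intro arg_cong[of _ _ Ex] ext) auto

text \<open>
  A path from \<open>A\<close> to \<open>B\<close> through the pivotal cell has an end at distance at least \<open>1/2\<close> from that cell. The
  part of the path between them crosses an annulus about the cell, which itself is not used, as
  \<open>annulus 0 R\<close> omits the centre.
\<close>

lemma pivotal_crossed:
  fixes c :: complex and r \<theta> :: real
  defines "pt \<equiv> cell_center c r \<theta>"
  assumes r: "0 < r" and AB: "\<And>a b. a \<in> A \<Longrightarrow> b \<in> B \<Longrightarrow> 1 \<le> dist a b"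
    and R: "1 \<le> R" "6 * r * of_int R \<le> 1"
    and \<omega>: "\<omega> \<subseteq> range pt"
    and piv: "chained (cell_adj r \<theta>) A B (insert (pt z) \<omega>)" "\<not> chained (cell_adj r \<theta>) A B (\<omega> - {pt z})"
  shows "crossed 0 R ((\<lambda>x. inv pt x - z) ` \<omega>)"
proof -
  have inj: "inj pt" unfolding pt_def using r by (rule inj_cell_center)
  obtain xs where xs: "xs \<noteq> []" "hd xs \<in> A" "last xs \<in> B" "set xs \<subseteq> insert (pt z) \<omega>"
      "successively (cell_adj r \<theta>) xs"
    using piv(1) by (auto simp: chained_def)
  have "\<forall>x\<in>set xs. \<exists>p. x = pt p" using xs(4) \<omega> by blast
  then obtain ps where ps: "xs = map pt ps" using ex_map_conv[of xs pt] by auto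
  have "pt z \<in> set xs" using xs piv(2) unfolding chained_def by auto
  then have "z \<in> set ps" by (simp add: ps inj_image_mem_iff[OF inj])
  then obtain ys zs where yz: "ps = ys @ z # zs" by (auto simp: in_set_conv_decomp)
  have succ: "successively (cell_adj r \<theta>) (map pt (ys @ [z]))" "successively (cell_adj r \<theta>) (map pt (z # zs))"
    using xs(5) by (auto simp: ps yz successively_append_iff successively_Cons)
  have "conn (set (ys @ [z])) (hd (ys @ [z])) z" "conn (set (z # zs)) z (last (z # zs))"
    using successively_cell_adj_conn[OF succ(1)[unfolded pt_def] _ r]
      successively_cell_adj_conn[OF succ(2)[unfolded pt_def] _ r] by simp_all
  then have "conn (set ps) (hd (ys @ [z])) z" "conn (set ps) z (last (z # zs))"
    by (auto elim!: conn_mono simp: yz)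
  moreover have "hd ps = hd (ys @ [z])" "last ps = last (z # zs)"
    by (simp_all add: yz hd_append)
  ultimately have conn: "conn (set ps) z (hd ps)" "conn (set ps) z (last ps)"
    using conn_sym by auto
  have "1 \<le> dist (pt (hd ps)) (pt (last ps))"
    using AB[OF xs(2,3)] xs(1) by (simp add: ps hd_map last_map)
  then have "1 / 2 \<le> dist (pt (hd ps)) (pt z) \<or> 1 / 2 \<le> dist (pt (last ps)) (pt z)"
    using dist_triangle2[of "pt (hd ps)" "pt (last ps)" "pt z"] by linarith
  then obtain e where e: "conn (set ps) z e" "1 / 2 \<le> dist (pt e) (pt z)" using conn by blast
  have "1 / 2 \<le> 3 * r * of_int (hex_norm (e - z))"
    using e(2) cell_center_dist_le[of r c \<theta> e z] r by (simp add: pt_def)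
  then have "6 * r * of_int R \<le> 6 * r * of_int (hex_norm (e - z))" using R(2) by linarith
  then have far: "R \<le> hex_norm (e - z)" using r by simp
  have tri_adj_minus: "tri_adj p q \<Longrightarrow> tri_adj (p - z) (q - z)" for p q
    by (simp add: tri_adj_shift)
  have path: "conn ((\<lambda>p. p - z) ` set ps) (z - z) (e - z)"
    using e(1) tri_adj_minus by (rule conn_image)
  have hn0: "hex_norm 0 = 0" by (simp add: hex_norm_def)
  obtain u v where uv: "conn ((\<lambda>p. p - z) ` set ps \<inter> annulus 0 R) u v" "hex_norm u = 0 + 1" "hex_norm v = R"
    by (rule conn_traverse[OF path, of 0 R]) (use far hn0 R(1) in simp_all)
  have "(\<lambda>p. p - z) ` set ps \<inter> annulus 0 R \<subseteq> (\<lambda>x. inv pt x - z) ` \<omega> \<inter> annulus 0 R"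
  proof
    fix q assume "q \<in> (\<lambda>p. p - z) ` set ps \<inter> annulus 0 R"
    then obtain p where p: "p \<in> set ps" "q = p - z" "q \<in> annulus 0 R" by auto
    have "p \<noteq> z" using p(2,3) hn0 by (auto simp: annulus_def)
    then have "pt p \<noteq> pt z" using inj_eq[OF inj] by simp
    moreover have "pt p \<in> insert (pt z) \<omega>" using p(1) xs(4) by (auto simp: ps)
    ultimately have "pt p \<in> \<omega>" by auto
    moreover have "inv pt (pt p) = p" using inj by (rule inv_f_f)
    ultimately show "q \<in> (\<lambda>x. inv pt x - z) ` \<omega> \<inter> annulus 0 R"
      using p(2,3) by (auto intro!: image_eqI[of _ _ "pt p"])
  qed
  from conn_mono[OF uv(1) this] show ?thesis
    unfolding crossed_def using uv(2,3) by (intro exI[of _ u] exI[of _ v] conjI) simp_all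
qed

lemma influence_le_arm_prob:
  assumes M: "finite M" "M \<subseteq> honeycomb c r \<theta>" and r: "0 < r"
    and AB: "\<And>a b. a \<in> A \<Longrightarrow> b \<in> B \<Longrightarrow> 1 \<le> dist a b"
    and R: "1 \<le> R" "6 * r * of_int R \<le> 1" and x: "x \<in> M"
  shows "pr M (\<lambda>\<omega>. chained (cell_adj r \<theta>) A B (insert x \<omega>) \<noteq> chained (cell_adj r \<theta>) A B (\<omega> - {x}))
    \<le> arm_prob 0 R"
proof -
  let ?pt = "cell_center c r \<theta>"
  obtain z where z: "x = ?pt z" using x M(2) by (auto simp: honeycomb_eq)
  define g where "g y = inv ?pt y - z" for y
  have sub: "M \<subseteq> range ?pt" using M(2) by (simp add: honeycomb_eq)
  have inj: "inj_on g M"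
    using inj_on_inv_into[OF sub] by (simp add: g_def inj_on_def)
  have mono: "chained (cell_adj r \<theta>) A B \<omega> \<Longrightarrow> \<omega> \<subseteq> \<eta> \<Longrightarrow> chained (cell_adj r \<theta>) A B \<eta>" for \<omega> \<eta>
    unfolding chained_def by blast
  have "pr M (\<lambda>\<omega>. chained (cell_adj r \<theta>) A B (insert x \<omega>) \<noteq> chained (cell_adj r \<theta>) A B (\<omega> - {x}))
      \<le> pr M (\<lambda>\<omega>. crossed 0 R (g ` \<omega>))"
  proof (rule pr_mono)
    fix \<omega> assume \<omega>: "\<omega> \<subseteq> M"
      and ne: "chained (cell_adj r \<theta>) A B (insert x \<omega>) \<noteq> chained (cell_adj r \<theta>) A B (\<omega> - {x})"
    have piv: "chained (cell_adj r \<theta>) A B (insert (?pt z) \<omega>)" "\<not> chained (cell_adj r \<theta>) A B (\<omega> - {?pt z})"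
      using ne mono[of "\<omega> - {x}" "insert x \<omega>"] unfolding z by blast+
    have "\<omega> \<subseteq> range ?pt" using \<omega> sub by (rule subset_trans)
    from pivotal_crossed[OF r AB R this piv] show "crossed 0 R (g ` \<omega>)"
      unfolding g_def .
  qed
  also have "\<dots> = pr (g ` M) (crossed 0 R)"
    using inj by (rule pr_image[symmetric])
  also have "\<dots> \<le> pr (g ` M \<union> annulus 0 R) (crossed 0 R)"
  proof (rule pr_mono_sites)
    show "finite (g ` M \<union> annulus 0 R)" using M(1) by simp
    show "g ` M \<subseteq> g ` M \<union> annulus 0 R" by (rule Un_upper1)
  qed (rule crossed_mono)
  also have "\<dots> = arm_prob 0 R"
    unfolding arm_prob_def
  proof (rule pr_restrict)
    show "finite (g ` M \<union> annulus 0 R)" using M(1) by simp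
    show "annulus 0 R \<subseteq> g ` M \<union> annulus 0 R" by (rule Un_upper2)
  qed (rule crossed_local)
  finally show ?thesis .
qed

text \<open>
  A colouring amounts to a pair of independent uniform sets: the cells of colour \<open>0\<close> or \<open>1\<close>, and the cells
  of colour \<open>0\<close> or \<open>2\<close>.
\<close>

lemma coloring_measure_eq_avg:
  assumes M: "finite M"
  shows "measure (coloring_space M) {\<omega> \<in> colorings M. Q {x \<in> M. \<omega> x \<in> {0, 1}} {x \<in> M. \<omega> x \<in> {0, 2}}}
    = avg M (\<lambda>a. avg M (\<lambda>b. of_bool (Q a b)))"
proof -
  let ?C = "colorings M"
  let ?a = "\<lambda>\<omega>. {x \<in> M. \<omega> x \<in> {0, 1 :: nat}}" and ?b = "\<lambda>\<omega>. {x \<in> M. \<omega> x \<in> {0, 2 :: nat}}"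
  define col where "col = (\<lambda>(a, b). \<lambda>x\<in>M. if x \<in> a then (if x \<in> b then 0 else 1) else (if x \<in> b then 2 else 3 :: nat))"
  have finC: "finite ?C" using M by (simp add: colorings_def finite_PiE)
  have "real (card {\<omega> \<in> ?C. Q (?a \<omega>) (?b \<omega>)}) = (\<Sum>\<omega>\<in>?C. of_bool (Q (?a \<omega>) (?b \<omega>)))"
    using finC by (simp add: of_bool_def sum.If_cases Int_def)
  also have "\<dots> = (\<Sum>(a, b)\<in>Pow M \<times> Pow M. of_bool (Q a b))"
  proof (rule sum.reindex_bij_witness[where i = col and j = "\<lambda>\<omega>. (?a \<omega>, ?b \<omega>)"])
    fix \<omega> assume \<omega>: "\<omega> \<in> ?C"
    show "col (?a \<omega>, ?b \<omega>) = \<omega>"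
    proof
      fix x
      show "col (?a \<omega>, ?b \<omega>) x = \<omega> x"
      proof (cases "x \<in> M")
        case True
        then have "\<omega> x \<in> {0, 1, 2, 3}" using PiE_mem[OF \<omega>[unfolded colorings_def]] by simp
        then show ?thesis using True by (auto simp: col_def)
      next
        case False
        then show ?thesis using \<omega> by (simp add: col_def colorings_def PiE_arb[of \<omega>])
      qed
    qed
  next
    fix p assume "p \<in> Pow M \<times> Pow M"
    then obtain a b where p: "p = (a, b)" "a \<subseteq> M" "b \<subseteq> M" by auto
    show "(?a (col p), ?b (col p)) = p" using p by (auto simp: col_def split: if_splits)
    show "col p \<in> ?C" by (auto simp: p col_def colorings_def)
  qed auto
  also have "\<dots> = (\<Sum>a\<in>Pow M. \<Sum>b\<in>Pow M. of_bool (Q a b))"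
    by (simp add: sum.cartesian_product)
  finally have card: "real (card {\<omega> \<in> ?C. Q (?a \<omega>) (?b \<omega>)}) = (\<Sum>a\<in>Pow M. \<Sum>b\<in>Pow M. of_bool (Q a b))" .
  have "(4 :: real) ^ card M = 2 ^ card M * 2 ^ card M" by (simp flip: power_mult_distrib)
  then show ?thesis
    unfolding measure_coloring_space[OF M Collect_restrict] card avg_def
    by (simp add: sum_divide_distrib)
qed

text \<open>
  The hypothesis \<open>48 \<le> n\<close> makes cells of opposite sides at least \<open>1\<close> apart, and \<open>6 * R \<le> n\<close> puts the far
  end of a path at least \<open>R\<close> lattice steps away from the pivotal cell.
\<close>

lemma perc_correlation_le:
  fixes c :: complex and \<alpha> \<theta> :: real
  assumes n: "48 \<le> n" and R: "1 \<le> R" "6 * of_int R \<le> real n"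
  shows "\<bar>coloring_prob c \<alpha> \<theta> n (perc_event c \<alpha> \<theta> n 1 \<inter> perc_event c \<alpha> \<theta> n 2 \<inter> perc_event c \<alpha> \<theta> n 3)
       - coloring_prob c \<alpha> \<theta> n (perc_event c \<alpha> \<theta> n 1)
       * coloring_prob c \<alpha> \<theta> n (perc_event c \<alpha> \<theta> n 2)
       * coloring_prob c \<alpha> \<theta> n (perc_event c \<alpha> \<theta> n 3)\<bar> \<le> arm_prob 0 R"
proof -
  define M where "M = cells_in c \<alpha> \<theta> n"
  define F where "F k = chained (cell_adj (1 / real n) \<theta>) (side_cells c \<alpha> \<theta> n k) (side_cells c \<alpha> \<theta> n (k + 3))" for k
  define f where "f k \<omega> = (of_bool (F k \<omega>) :: real)" for k \<omega>
  have fin: "finite M" using n by (simp add: M_def finite_cells_in)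
  have event: "perc_event c \<alpha> \<theta> n k = {\<omega> \<in> colorings M. F k {x \<in> M. \<omega> x \<in> {0, k}}}" for k
    by (simp only: perc_event_def percolates_chained F_def M_def)
  \<comment> \<open>In bits: colour \<open>0\<close> is 11, colour \<open>1\<close> is 10, colour \<open>2\<close> is 01 and colour \<open>3\<close> is 00.\<close>
  have third: "{x \<in> M. \<omega> x \<in> {0, 3}} = M - sym_diff {x \<in> M. \<omega> x \<in> {0, 1}} {x \<in> M. \<omega> x \<in> {0, 2}}"
    if "\<omega> \<in> colorings M" for \<omega>
  proof (rule set_eqI)
    fix x
    show "x \<in> {x \<in> M. \<omega> x \<in> {0, 3}} \<longleftrightarrow> x \<in> M - sym_diff {x \<in> M. \<omega> x \<in> {0, 1}} {x \<in> M. \<omega> x \<in> {0, 2}}"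
    proof (cases "x \<in> M")
      case True
      then have "\<omega> x \<in> {0, 1, 2, 3}" using PiE_mem[OF that[unfolded colorings_def]] by simp
      then show ?thesis using True by auto
    qed simp
  qed
  have event3: "perc_event c \<alpha> \<theta> n 3
      = {\<omega> \<in> colorings M. F 3 (M - sym_diff {x \<in> M. \<omega> x \<in> {0, 1}} {x \<in> M. \<omega> x \<in> {0, 2}})}"
    unfolding event
  proof (rule Collect_cong)
    fix \<omega>
    show "\<omega> \<in> colorings M \<and> F 3 {x \<in> M. \<omega> x \<in> {0, 3}} \<longleftrightarrow> \<omega> \<in> colorings M \<and>
        F 3 (M - sym_diff {x \<in> M. \<omega> x \<in> {0, 1}} {x \<in> M. \<omega> x \<in> {0, 2}})"
      using arg_cong[OF third[of \<omega>], of "F 3"] by argo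
  qed
  have prob: "coloring_prob c \<alpha> \<theta> n {\<omega> \<in> colorings M. Q {x \<in> M. \<omega> x \<in> {0, 1}} {x \<in> M. \<omega> x \<in> {0, 2}}}
      = avg M (\<lambda>a. avg M (\<lambda>b. of_bool (Q a b)))" for Q
    unfolding coloring_prob_def M_def[symmetric] by (rule coloring_measure_eq_avg[OF fin])
  have P1: "coloring_prob c \<alpha> \<theta> n (perc_event c \<alpha> \<theta> n 1) = avg M (f 1)"
    unfolding event prob[of "\<lambda>a b. F 1 a"] by (simp add: avg_const fin f_def[abs_def])
  have P2: "coloring_prob c \<alpha> \<theta> n (perc_event c \<alpha> \<theta> n 2) = avg M (f 2)"
    unfolding event prob[of "\<lambda>a b. F 2 b"] by (simp add: avg_const fin f_def[abs_def])
  have "avg M (\<lambda>b. f 3 (M - sym_diff a b)) = avg M (f 3)" if "a \<subseteq> M" for a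
    by (rule avg_permute, rule bij_betwI[where g = "\<lambda>b. M - sym_diff a b"]) (use that in auto)
  then have P3: "coloring_prob c \<alpha> \<theta> n (perc_event c \<alpha> \<theta> n 3) = avg M (f 3)"
    unfolding event3 prob[of "\<lambda>a b. F 3 (M - sym_diff a b)"] f_def[symmetric]
    by (subst avg_cong[of M _ "\<lambda>_. avg M (f 3)"]) (simp_all add: avg_const fin)
  have "perc_event c \<alpha> \<theta> n 1 \<inter> perc_event c \<alpha> \<theta> n 2 \<inter> perc_event c \<alpha> \<theta> n 3
      = {\<omega> \<in> colorings M. F 1 {x \<in> M. \<omega> x \<in> {0, 1}} \<and> F 2 {x \<in> M. \<omega> x \<in> {0, 2}} \<and>
          F 3 (M - sym_diff {x \<in> M. \<omega> x \<in> {0, 1}} {x \<in> M. \<omega> x \<in> {0, 2}})}"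
    unfolding event3 unfolding event by blast
  then have P123: "coloring_prob c \<alpha> \<theta> n (perc_event c \<alpha> \<theta> n 1 \<inter> perc_event c \<alpha> \<theta> n 2 \<inter> perc_event c \<alpha> \<theta> n 3)
      = avg M (\<lambda>a. avg M (\<lambda>b. f 1 a * f 2 b * f 3 (M - sym_diff a b)))"
    by (simp only: prob[of "\<lambda>a b. F 1 a \<and> F 2 b \<and> F 3 (M - sym_diff a b)"] f_def of_bool_conj mult.assoc)
  show ?thesis
    unfolding P1 P2 P3 P123
  proof (rule triple_correlation_bound[OF fin])
    show "\<bar>f 2 \<omega>\<bar> \<le> 1" "\<bar>f 3 \<omega>\<bar> \<le> 1" for \<omega> by (simp_all add: f_def)
    show "0 \<le> arm_prob 0 R" by (simp add: arm_prob_def pr_nonneg)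
    fix S assume S: "S \<subseteq> M" "S \<noteq> {}"
    then obtain x where x: "x \<in> S" by auto
    have "\<bar>fourier M (f 1) S\<bar> \<le> pr M (\<lambda>\<omega>. F 1 (insert x \<omega>) \<noteq> F 1 (\<omega> - {x}))"
      using fourier_le_influence[OF fin S(1) x, of "F 1"] by (simp only: f_def[abs_def])
    also have "\<dots> \<le> arm_prob 0 R"
      unfolding F_def
    proof (rule influence_le_arm_prob[OF fin _ _ _ R(1)])
      show "M \<subseteq> honeycomb c (1 / real n) \<theta>" by (auto simp: M_def cells_in_def)
      show "0 < 1 / real n" "6 * (1 / real n) * of_int R \<le> 1" using n R by (simp_all add: divide_simps)
      show "x \<in> M" using x S by auto
      show "1 \<le> dist a b" if "a \<in> side_cells c \<alpha> \<theta> n 1" "b \<in> side_cells c \<alpha> \<theta> n (1 + 3)" for a b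
        using side_cells_far[OF that n] .
    qed
    finally show "\<bar>fourier M (f 1) S\<bar> \<le> arm_prob 0 R" .
  qed
qed

theorem theorem1:
  fixes c :: complex and \<alpha> :: real and \<theta> :: "nat \<Rightarrow> real"
  shows
    "(\<lambda>n. coloring_prob c \<alpha> (\<theta> n) n
             (perc_event c \<alpha> (\<theta> n) n 1 \<inter> perc_event c \<alpha> (\<theta> n) n 2 \<inter> perc_event c \<alpha> (\<theta> n) n 3)
           - coloring_prob c \<alpha> (\<theta> n) n (perc_event c \<alpha> (\<theta> n) n 1)
           * coloring_prob c \<alpha> (\<theta> n) n (perc_event c \<alpha> (\<theta> n) n 2)
           * coloring_prob c \<alpha> (\<theta> n) n (perc_event c \<alpha> (\<theta> n) n 3))
       \<longlonglongrightarrow> 0"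
  (is "?f \<longlonglongrightarrow> 0")
proof (rule LIMSEQ_I)
  fix \<epsilon> :: real assume "0 < \<epsilon>"
  then obtain R where R: "1 \<le> R" "arm_prob 0 R < \<epsilon>" using one_arm_vanishes by blast
  have "norm (?f n - 0) < \<epsilon>" if "max 48 (nat (6 * R)) \<le> n" for n
  proof -
    have "48 \<le> n" "6 * real_of_int R \<le> real n" using that by linarith+
    then have "\<bar>?f n\<bar> \<le> arm_prob 0 R" by (intro perc_correlation_le R(1))
    then show ?thesis using R(2) by simp
  qed
  then show "\<exists>no. \<forall>n\<ge>no. norm (?f n - 0) < \<epsilon>" by blast
qed

end
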